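(* Let $q>2$ be even. Then an ${\rm Sp}(6,q)$-space has maximal symplectic partial spreads of each of the following sizes: (i) $q^3-q^2+1$; (ii) $q^2+1$; (iii) $2q^2+1$; (iv) $q^2+q+1$, if $q=2^{2e+1}$; (v) $q^2-q+1$, if $q=2^{2e+1}$; (vi) $q^2-sq+2s-1$, if $q=2^{2e+1}$ and $1\le s\le\sqrt{q/2}-1$; (vii) $n_r=q^3-rq^2+(r-1)(q+2)+\binom{r}{2}(q-2)+1$, if $1\le r\le q/5$; (viii) $n_4-1=q^3-4q^2+3(q+2)+6(q-2)$, if $q\ge16$.
   Context: An ${\rm Sp}(6,q)$-space is a $6$-dimensional $\mathbb{F}_q$-space with a nondegenerate alternating form. A symplectic partial spread is a set of totally isotropic $3$-dimensional subspaces pairwise meeting only in $0$; it is maximal if not properly contained in another symplectic partial spread. *)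

theory Defs
  imports Complex_Main
begin

text \<open>
  The field is the type \<open>'k\<close>, the space is the type \<open>'v\<close>.  In the library,
  \<open>dim UNIV = 6\<close> also excludes infinite-dimensional spaces, which get \<open>dim UNIV = 0\<close>.
\<close>

locale Sp6_space = vector_space scale
  for scale :: "'k::field \<Rightarrow> 'v::ab_group_add \<Rightarrow> 'v" +
  fixes form :: "'v \<Rightarrow> 'v \<Rightarrow> 'k" and q :: nat
  assumes card_field: "finite (UNIV :: 'k set)" "card (UNIV :: 'k set) = q"
    and dim_6: "dim (UNIV :: 'v set) = 6"
    and linear_left: "\<And>y. Vector_Spaces.linear scale (*) (\<lambda>x. form x y)"
    and linear_right: "\<And>x. Vector_Spaces.linear scale (*) (\<lambda>y. form x y)"
    and alternating: "\<And>x. form x x = 0"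
    and nondegenerate: "\<And>x. (\<And>y. form x y = 0) \<Longrightarrow> x = 0"
begin

definition totally_isotropic :: "'v set \<Rightarrow> bool" where
  "totally_isotropic W \<longleftrightarrow> (\<forall>x\<in>W. \<forall>y\<in>W. form x y = 0)"

definition symplectic_partial_spread :: "'v set set \<Rightarrow> bool" where
  "symplectic_partial_spread S \<longleftrightarrow>
     (\<forall>W\<in>S. subspace W \<and> dim W = 3 \<and> totally_isotropic W) \<and>
     pairwise (\<lambda>U W. U \<inter> W = {0}) S"

definition maximal_symplectic_partial_spread :: "'v set set \<Rightarrow> bool" where
  "maximal_symplectic_partial_spread S \<longleftrightarrow>
     symplectic_partial_spread S \<and> \<not> (\<exists>T. symplectic_partial_spread T \<and> S \<subset> T)"

text \<open>The size is an integer so that sizes given by subtractions are not truncated.\<close>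

definition has_maximal_spread_of_size :: "int \<Rightarrow> bool" where
  "has_maximal_spread_of_size n \<longleftrightarrow>
     (\<exists>S. maximal_symplectic_partial_spread S \<and> finite S \<and> int (card S) = n)"

end

end

theory Submission
  imports Defs "HOL-Computational_Algebra.Polynomial"
begin

text \<open>
  Fix one member \<open>L\<close> of the spread.  The Lagrangian subspaces disjoint from \<open>L\<close> correspond to symmetric
  \<open>3 \<times> 3\<close> matrices, and two of them are disjoint iff the determinant of the sum of their matrices is
  nonzero.  In characteristic 2, with \<open>a\<^sub>i = s\<^sub>i\<^sub>i\<close> and \<open>c\<^sub>i = a\<^sub>j a\<^sub>k + s\<^sub>j\<^sub>k\<^sup>2\<close>, this determinant becomes the
  hyperbolic quadratic form \<open>\<Sum>a\<^sub>i c\<^sub>i\<close> evaluated at a difference of points.  So maximal symplectic partial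
  spreads are maximal sets of pairwise nonperpendicular singular points (partial ovoids) of the hyperbolic
  quadric in 8-space.

  \<^item> (ii) is an elliptic quadric of a 4-space.  For (iii), take the cone with vertex \<open>p\<close> over an elliptic
    quadric, choose one point other than \<open>p\<close> on each of its lines, and add the points other than \<open>p\<close> of a
    second elliptic quadric; (iv) does the same with the cone over a Tits ovoid and a conic.
  \<^item> (i), (vii), (viii): take the ovoid defined by the norm and adjoint maps of the cubic extension, \<open>r\<close>
    points off it, and replace the \<open>r\<close> hyperplane sections perpendicular to these points by the points.  The
    points are chosen so that all sections share a subline; off this subline two sections share \<open>q - 1\<close>
    points and three share one.  The result is maximal because a section has \<open>q\<^sup>2 + 1\<close> points and two sections
    with nonperpendicular poles share at most \<open>3 q + 3\<close>.
  \<^item> (v), (vi): replace \<open>s\<close> plane sections of a Tits ovoid through two common points by their poles.  By a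
    character sum, a hyperplane not through the nucleus meets the Tits ovoid in at least \<open>q + 1 - \<surd>(2 q)\<close>
    points, and few of them lie on each of the plane sections.
\<close>

text \<open>The fixed member becomes the base point at infinity of an affine chart, so every set
  built below has one element fewer than the spread. Passing from the off-diagonal entries to the
  adjugate diagonal loses nothing, since squaring is an additive bijection of a finite field of
  characteristic 2. Pairwise nonperpendicularity is settled by direct computation; the work lies in
  maximality, where an arbitrary further point z must be shown perpendicular to some member. In the
  families that remove sections of an ovoid, a counterexample z would have all ovoid points
  perpendicular to it inside the removed sections. A lower bound for the number of these points is
  therefore compared with an upper bound for those in each section. The comparison dictates the
  ranges. For the Desarguesian ovoid it reads r(3q + 3) < q^2, which r \<le> q/5 guarantees. For the
  Tits ovoid put q = 2 t^2: besides the section of the base point, s - 1 \<le> t - 2 sections are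
  removed, and in the tightest case each takes at most 2t + 2 of at least q points.\<close>

type_synonym 'a vec6 = "'a \<times> 'a \<times> 'a \<times> 'a \<times> 'a \<times> 'a"

type_synonym 'a vec8 = "'a \<times> 'a \<times> 'a \<times> 'a \<times> 'a \<times> 'a \<times> 'a \<times> 'a"

subsection \<open>Finite fields of characteristic 2\<close>

lemma even_card_fixpoint_free_involution:
  assumes "finite A" "\<And>x. x \<in> A \<Longrightarrow> f x \<in> A \<and> f x \<noteq> x \<and> f (f x) = x"
  shows "even (card A)"
  using assms
proof (induction A rule: finite_psubset_induct)
  case (psubset A)
  show ?case
  proof (cases "A = {}")
    case False
    then obtain x where x: "x \<in> A" by auto
    let ?B = "A - {x, f x}"
    have fx: "f x \<in> A" "f x \<noteq> x" "f (f x) = x" using psubset.prems[OF x] by auto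
    have "even (card ?B)"
    proof (rule psubset.IH)
      show "?B \<subset> A" using x by auto
      fix y assume "y \<in> ?B"
      then have "y \<in> A" "y \<noteq> x" "y \<noteq> f x" by auto
      moreover from this have "f y \<in> A" "f y \<noteq> y" "f (f y) = y" using psubset.prems[of y] by auto
      ultimately show "f y \<in> ?B \<and> f y \<noteq> y \<and> f (f y) = y" using fx(3) by (metis DiffI insertE singletonD)
    qed
    moreover have "card A = card ?B + card {x, f x}"
    proof -
      have "A = ?B \<union> {x, f x}" using x fx(1) by auto
      then show ?thesis using psubset.hyps(1) card_Un_disjoint[of ?B "{x, f x}"] by auto
    qed
    moreover have "card {x, f x} = 2" using fx(2) by simp
    ultimately show ?thesis by simp
  qed simp
qed

text \<open>Otherwise negation would pair off the nonzero elements, whose number is odd.\<close>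

lemma char2_if_even_card:
  assumes "finite (UNIV :: 'a::field set)" "even (card (UNIV :: 'a set))"
  shows "(1::'a) + 1 = 0"
proof (rule ccontr)
  assume ne: "(1::'a) + 1 \<noteq> 0"
  have "even (card (UNIV - {0::'a}))"
  proof (rule even_card_fixpoint_free_involution[where f = uminus])
    fix x :: 'a assume "x \<in> UNIV - {0}"
    then have "(1 + 1) * x \<noteq> 0" using ne by simp
    then have "- x \<noteq> x" by (metis distrib_right mult_1 add.right_inverse)
    then show "- x \<in> UNIV - {0} \<and> - x \<noteq> x \<and> - (- x) = x" using \<open>x \<in> UNIV - {0}\<close> by simp
  qed (use assms in auto)
  moreover have "card (UNIV - {0::'a}) = card (UNIV :: 'a set) - 1"
    using assms by (subst card_Diff_subset) auto
  moreover have "card (UNIV :: 'a set) > 0" using assms by (simp add: finite_UNIV_card_ge_0)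
  ultimately show False using assms by (metis Suc_pred even_Suc diff_Suc_1 One_nat_def)
qed

text \<open>Multiplication by a nonzero x permutes the nonzero elements; comparing their products
  shows that x to the power q - 1 is 1.\<close>

lemma finite_field_power_card:
  fixes x :: "'a::field"
  assumes "finite (UNIV :: 'a set)"
  shows "x ^ card (UNIV :: 'a set) = x"
proof (cases "x = 0")
  case True
  then show ?thesis using assms by (simp add: finite_UNIV_card_ge_0 zero_power)
next
  case False
  let ?U = "UNIV - {0::'a}"
  have img: "(*) x ` ?U = ?U"
  proof
    show "?U \<subseteq> (*) x ` ?U"
    proof
      fix y assume "y \<in> ?U"
      then have "y = x * (y / x)" "y / x \<in> ?U" using False by auto
      then show "y \<in> (*) x ` ?U" by blast
    qed
  qed (use False in auto)
  have "inj_on ((*) x) ?U" using False by (auto intro: inj_onI)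
  then have "\<Prod>?U = (\<Prod>y\<in>?U. x * y)"
    using prod.reindex[of "(*) x" ?U "\<lambda>y. y"] img by simp
  also have "\<dots> = x ^ card ?U * \<Prod>?U" by (simp add: prod.distrib)
  finally have "x ^ card ?U = 1" using assms by simp
  moreover have "card (UNIV :: 'a set) = Suc (card ?U)"
    using assms by (intro card.remove) auto
  ultimately show ?thesis by (simp only: power_Suc mult_1_right)
qed

lemma card_roots_le:
  fixes p :: "'a::field poly"
  assumes "coeff p n \<noteq> 0" "degree p \<le> n"
  shows "card {x. poly p x = 0} \<le> n"
proof -
  have "p \<noteq> 0" using assms(1) by (metis coeff_0)
  then show ?thesis using card_poly_roots_bound[of p] assms by simp
qed

locale finite_char2_field =
  fixes K :: "'k::field itself"
  assumes finite_UNIV [simp]: "finite (UNIV :: 'k set)" and one_add_one: "(1::'k) + 1 = 0"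
begin

lemma add_self [simp]: "(x::'k) + x = 0"
  by (metis distrib_right mult_1 mult_zero_left one_add_one)

lemma numeral_char2 [simp]: "numeral (Num.Bit0 n) = (0::'k)" "numeral (Num.Bit1 n) = (1::'k)"
  by (simp_all add: numeral_Bit0 numeral_Bit1)

text \<open>Once \<open>char2\<close> has expanded and ordered a sum, equal summands stand next to
  each other and this rule cancels them. That is how polynomial identities in characteristic 2 are
  proved throughout.\<close>

lemma add_self_left [simp]: "(x::'k) + (x + y) = y"
  by (simp add: add.assoc[symmetric])

lemma uminus_eq: "- (x::'k) = x"
  by (rule minus_unique) simp

lemma minus_eq_add: "(x::'k) - y = x + y"
  using diff_conv_add_uminus[of x y] uminus_eq[of y] by argo

lemma add_eq_0_iff2: "(x::'k) + y = 0 \<longleftrightarrow> x = y"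
  by (metis add_self add_self_left add_0_right)

lemmas char2 = distrib_left distrib_right ac_simps minus_eq_add uminus_eq

lemma finite_set [simp]: "finite (A :: 'k set)"
  by (rule finite_subset[of _ UNIV]) auto

lemma square_eq_iff2: "(x::'k) * x = y * y \<longleftrightarrow> x = y"
proof
  assume "x * x = y * y"
  moreover have "(x + y) * (x + y) = x * x + y * y" by (simp add: char2)
  ultimately have "(x + y) * (x + y) = 0" by simp
  then show "x = y" by (simp add: add_eq_0_iff2)
qed simp

lemma ex_rt: "\<exists>y. y * y = (x::'k)"
proof -
  have "inj (\<lambda>y::'k. y * y)" by (auto intro!: injI simp: square_eq_iff2)
  then have "surj (\<lambda>y::'k. y * y)" by (rule finite_UNIV_inj_surj[OF finite_UNIV])
  then show ?thesis by (metis surjD)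
qed

definition rt :: "'k \<Rightarrow> 'k" where "rt x = (SOME y. y * y = x)"

lemma rt_square [simp]: "rt x * rt x = x"
  unfolding rt_def by (rule someI_ex[OF ex_rt])

lemma rt_unique: "y * y = x \<Longrightarrow> rt x = y"
  using rt_square[of x] square_eq_iff2 by metis

lemma rt_add: "rt (x + y) = rt x + rt y"
  by (rule rt_unique) (simp add: char2)

text \<open>On a finite set a map that repeats a value also misses one. Applied to polynomials that
  agree at 0 and 1, this yields the irreducible quadratic and cubic without any construction of
  extension fields.\<close>

lemma ex_nonvalue:
  fixes f :: "'k \<Rightarrow> 'k"
  assumes "f a = f b" "a \<noteq> b"
  shows "\<exists>c. \<forall>x. f x \<noteq> c"
proof (rule ccontr)
  assume "\<not> ?thesis"
  then have "\<exists>x. y = f x" for y by metis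
  then have "surj f" unfolding surj_def by blast
  then have "inj f" by (rule finite_UNIV_surj_inj[OF finite_UNIV])
  then show False using assms by (auto dest: injD)
qed

lemma ex_artin_schreier: "\<exists>d::'k. \<forall>u. u * u + u \<noteq> d"
  by (rule ex_nonvalue[of _ 0 1]) auto

lemma ex_irreducible_cubic: "\<exists>d::'k. \<forall>u. u * u * u + u \<noteq> d"
  by (rule ex_nonvalue[of _ 0 1]) auto

end

subsection \<open>Hyperbolic bases\<close>

context vector_space
begin

lemma span_triple: "span {u, v, w} = {a *s u + b *s v + c *s w | a b c. True}"
  by (auto simp: span_insert span_empty span_breakdown_eq algebra_simps intro!: exI)

lemma dim_triple:
  assumes "\<And>a b c. a *s u + b *s v + c *s w = 0 \<Longrightarrow> a = 0 \<and> b = 0 \<and> c = 0"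
  shows "dim (span {u, v, w}) = 3"
proof -
  have "w \<noteq> 0" using assms[of 0 0 1] by auto
  have "v \<notin> span {w}"
  proof
    assume "v \<in> span {w}"
    then obtain k where "v = k *s w" by (auto simp: span_singleton)
    then show False using assms[of 0 1 "- k"] by simp
  qed
  moreover have "u \<notin> span {v, w}"
  proof
    assume "u \<in> span {v, w}"
    then obtain k l where "u - k *s v = l *s w" by (auto simp: span_breakdown_eq span_singleton)
    then have "1 *s u + (- k) *s v + (- l) *s w = 0" by (simp add: algebra_simps)
    from assms[OF this] show False by simp
  qed
  ultimately have "independent {u, v, w}" using \<open>w \<noteq> 0\<close> by (simp add: independent_insert)
  moreover have "v \<noteq> w" "u \<noteq> v" "u \<noteq> w"
    using \<open>v \<notin> span {w}\<close> \<open>u \<notin> span {v, w}\<close> by (auto intro: span_base)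
  ultimately show ?thesis by (simp add: dim_eq_card_independent)
qed

lemma dim_3_obtain_triple:
  assumes "subspace W" "dim W = 3"
  obtains u v w where "W = span {u, v, w}"
    "\<And>a b c. a *s u + b *s v + c *s w = 0 \<Longrightarrow> a = 0 \<and> b = 0 \<and> c = 0"
proof -
  obtain B where B: "B \<subseteq> W" "independent B" "W \<subseteq> span B" "card B = dim W"
    using basis_exists[of W] by blast
  then obtain u v w where uvw: "B = {u, v, w}" "u \<noteq> v" "v \<noteq> w" "u \<noteq> w"
    using assms(2) by (metis card_3_iff)
  have "W = span B" using B assms(1) by (metis span_minimal subset_antisym)
  moreover have "a = 0 \<and> b = 0 \<and> c = 0" if "a *s u + b *s v + c *s w = 0" for a b c
  proof -
    let ?f = "\<lambda>x. if x = u then a else if x = v then b else c"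
    have "(\<Sum>x\<in>B. ?f x *s x) = 0" using that uvw by (simp add: add.assoc)
    moreover have "finite B" using uvw by simp
    ultimately have "\<forall>x\<in>B. ?f x = 0" using independentD[OF B(2) _ subset_refl, of ?f] by simp
    then show ?thesis using uvw by (metis insertCI)
  qed
  ultimately show ?thesis using that uvw(1) by blast
qed

end

locale Sp6_char2 = Sp6_space scale form q + finite_char2_field "TYPE('k)"
  for scale :: "'k::field \<Rightarrow> 'v::ab_group_add \<Rightarrow> 'v" (infixr "*s" 75) and form q
begin

lemma form_add [simp]: "form (x + y) z = form x z + form y z" "form z (x + y) = form z x + form z y"
  using module_hom.add[OF linear_left[unfolded Vector_Spaces.linear_iff_module_hom]]
    module_hom.add[OF linear_right[unfolded Vector_Spaces.linear_iff_module_hom]] by auto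

lemma form_scale [simp]: "form (a *s y) z = a * form y z" "form z (a *s y) = a * form z y"
  using module_hom.scale[OF linear_left[unfolded Vector_Spaces.linear_iff_module_hom]]
    module_hom.scale[OF linear_right[unfolded Vector_Spaces.linear_iff_module_hom]] by auto

lemma form_0 [simp]: "form 0 z = 0"
  using form_add(1)[of 0 0 z] by simp

lemma form_commute: "form x y = form y x"
  using alternating[of "x + y"] alternating[of x] alternating[of y] by (simp add: add_eq_0_iff2)

lemma form_sum [simp]: "form (\<Sum>i\<in>A. h i) z = (\<Sum>i\<in>A. form (h i) z)"
  by (induction A rule: infinite_finite_induct) auto

lemma add_self_vector [simp]: "(x::'v) + x = 0"
  by (metis add_self scale_left_distrib scale_one scale_zero_left)

definition hyperbolic_pairs :: "nat \<Rightarrow> (nat \<Rightarrow> 'v) \<Rightarrow> (nat \<Rightarrow> 'v) \<Rightarrow> bool" where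
  "hyperbolic_pairs m e f \<longleftrightarrow> (\<forall>i<m. \<forall>j<m. form (e i) (f j) = (if i = j then 1 else 0) \<and>
     form (f i) (e j) = (if i = j then 1 else 0) \<and> form (e i) (e j) = 0 \<and> form (f i) (f j) = 0)"

text \<open>For hyperbolic pairs this removes the component in their span, addition being the same
  as subtraction here; the result vanishes iff \<open>x\<close> lies in that span.\<close>

definition proj :: "nat \<Rightarrow> (nat \<Rightarrow> 'v) \<Rightarrow> (nat \<Rightarrow> 'v) \<Rightarrow> 'v \<Rightarrow> 'v" where
  "proj m e f x = x + (\<Sum>i<m. form x (f i) *s e i + form x (e i) *s f i)"

lemma proj_perp:
  assumes "hyperbolic_pairs m e f" "j < m"
  shows "form (proj m e f x) (e j) = 0" "form (proj m e f x) (f j) = 0"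
proof -
  have pair: "form (e i) (f j) = (if i = j then 1 else 0)" "form (f i) (e j) = (if i = j then 1 else 0)"
    "form (e i) (e j) = 0" "form (f i) (f j) = 0" if "i < m" for i
    using assms that by (simp_all add: hyperbolic_pairs_def)
  have "(\<Sum>i<m. form (form x (f i) *s e i + form x (e i) *s f i) (e j)) = (\<Sum>i<m. if i = j then form x (e i) else 0)"
    by (intro sum.cong) (simp_all add: pair)
  then show "form (proj m e f x) (e j) = 0" unfolding proj_def using assms(2) by (simp only: form_add form_sum) simp
  have "(\<Sum>i<m. form (form x (f i) *s e i + form x (e i) *s f i) (f j)) = (\<Sum>i<m. if i = j then form x (f i) else 0)"
    by (intro sum.cong) (simp_all add: pair)
  then show "form (proj m e f x) (f j) = 0" unfolding proj_def using assms(2) by (simp only: form_add form_sum) simp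
qed

text \<open>A symplectic Gram-Schmidt step. The nonzero projection \<open>u\<close> has a partner by
  nondegeneracy, and projecting the partner does not change its product with \<open>u\<close>,
  because \<open>u\<close> is already orthogonal to all earlier pairs.\<close>

lemma extend_pairs:
  assumes H: "hyperbolic_pairs m e f" and ne: "proj m e f x \<noteq> 0"
  obtains e' f' where "hyperbolic_pairs (Suc m) e' f'"
proof -
  define u where "u = proj m e f x"
  obtain y0 where "form u y0 \<noteq> 0" using ne nondegenerate u_def by blast
  define y where "y = (1 / form u y0) *s y0"
  have "form u y = 1" using \<open>form u y0 \<noteq> 0\<close> by (simp add: y_def)
  define v where "v = proj m e f y"
  have u: "form u (e j) = 0" "form u (f j) = 0" "form (e j) u = 0" "form (f j) u = 0" if "j < m" for j
    using proj_perp[OF H that] form_commute by (auto simp: u_def)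
  have v: "form v (e j) = 0" "form v (f j) = 0" "form (e j) v = 0" "form (f j) v = 0" if "j < m" for j
    using proj_perp[OF H that] form_commute by (auto simp: v_def)
  have "form (\<Sum>i<m. form y (f i) *s e i + form y (e i) *s f i) u = 0"
    unfolding form_sum by (rule sum.neutral) (simp add: u)
  then have "form v u = form y u" unfolding v_def proj_def by (simp add: form_sum)
  then have "form u v = 1" "form v u = 1" using \<open>form u y = 1\<close> form_commute by metis+
  then have "hyperbolic_pairs (Suc m) (e(m := u)) (f(m := v))"
    using H u v unfolding hyperbolic_pairs_def less_Suc_eq by (auto simp: alternating)
  then show ?thesis using that by blast
qed

lemma add_eq_0_iff_vector: "(x::'v) + y = 0 \<longleftrightarrow> x = y"
  using add_self_vector[of y] by (metis add_right_cancel)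

lemma proj_0_iff: "proj m e f x = 0 \<longleftrightarrow> x = (\<Sum>i<m. form x (f i) *s e i + form x (e i) *s f i)"
  unfolding proj_def by (rule add_eq_0_iff_vector)

text \<open>The dimension is used from both sides: fewer than three pairs span less than 6
  dimensions and can be extended, whereas a fourth pair would produce eight independent
  vectors.\<close>

lemma pairs_3:
  obtains e f where "hyperbolic_pairs 3 e f" "\<And>x. proj 3 e f x = 0"
proof -
  have "\<exists>B. independent B \<and> span B = (UNIV::'v set) \<and> finite B"
  proof -
    obtain B where B: "B \<subseteq> (UNIV::'v set)" "independent B" "UNIV \<subseteq> span B" "card B = dim (UNIV::'v set)"
      using basis_exists by blast
    then have "finite B" using dim_6 card.infinite by fastforce
    then show ?thesis using B by blast
  qed
  then obtain B where B: "independent B" "span B = (UNIV::'v set)" "finite B" by blast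
  interpret fd: finite_dimensional_vector_space scale B using B by unfold_locales auto
  have not_all: "\<exists>x. proj m e f x \<noteq> 0" if "m < 3" for m e f
  proof (rule ccontr)
    assume "\<not> ?thesis"
    then have p: "x = (\<Sum>i<m. form x (f i) *s e i + form x (e i) *s f i)" for x by (simp add: proj_0_iff)
    let ?A = "e ` {..<m} \<union> f ` {..<m}"
    have "x \<in> span ?A" for x
      by (subst p) (intro span_sum span_add span_scale span_base; auto)
    then have "dim (UNIV::'v set) \<le> card ?A" by (intro dim_le_card) auto
    also have "\<dots> \<le> m + m"
      by (rule order_trans[OF card_Un_le]) (intro add_mono; use card_image_le[of "{..<m}"] in fastforce)
    finally show False using dim_6 that by simp
  qed
  have all: "proj 3 e f x = 0" if H3: "hyperbolic_pairs 3 e f" for e f x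
  proof (rule ccontr)
    assume "proj 3 e f x \<noteq> 0"
    then obtain e f where "hyperbolic_pairs (Suc 3) e f" using extend_pairs[OF H3] by blast
    then have H: "hyperbolic_pairs 4 e f" by simp
    let ?A = "e ` {..<4} \<union> f ` {..<4}"
    have val: "form (e i) (f j) = (if i = j then 1 else 0)" "form (f i) (e j) = (if i = j then 1 else 0)"
      "form (e i) (e j) = 0" "form (f i) (f j) = 0" if "i < 4" "j < 4" for i j
      using H that by (simp_all add: hyperbolic_pairs_def)
    have "independent ?A"
    proof (rule independent_if_scalars_zero)
      fix g y assume z: "(\<Sum>v\<in>?A. g v *s v) = 0" and y: "y \<in> ?A"
      have "0 = form (\<Sum>v\<in>?A. g v *s v) w" for w using z by simp
      then have z': "(\<Sum>v\<in>?A. g v * form v w) = 0" for w by (metis (no_types, lifting) form_scale(1) form_sum sum.cong)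
      obtain j where j: "j < 4" "y = e j \<or> y = f j" using y by auto
      \<comment> \<open>The partner of \<open>y\<close> in its pair is orthogonal to every other
        vector of the family, so pairing with it isolates the coefficient
        \<open>g y\<close>.\<close>
      then obtain w where w: "form y w = 1" "\<And>v. v \<in> ?A \<Longrightarrow> v \<noteq> y \<Longrightarrow> form v w = 0"
      proof (cases "y = e j")
        case True
        have "form v (f j) = 0" if "v \<in> ?A" "v \<noteq> y" for v
          using that True val[OF _ j(1)] by auto
        then show ?thesis using that[of "f j"] True val(1)[OF j(1) j(1)] by simp
      next
        case False
        then have "y = f j" using j by simp
        moreover have "form v (e j) = 0" if "v \<in> ?A" "v \<noteq> y" for v
          using that \<open>y = f j\<close> val[OF _ j(1)] by auto
        ultimately show ?thesis using that[of "e j"] val(2)[OF j(1) j(1)] by simp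
      qed
      have "(\<Sum>v\<in>?A. g v * form v w) = (\<Sum>v\<in>?A. if v = y then g y else 0)"
        using w by (intro sum.cong) auto
      then show "g y = 0" using z'[of w] y by simp
    qed auto
    then have "card ?A \<le> 6" using fd.independent_card_le_dim[of ?A UNIV] dim_6 by simp
    moreover have "card ?A = 4 + 4"
    proof -
      have "inj_on e {..<4}" "inj_on f {..<4}"
        by (auto intro!: inj_onI) (metis val(1,2) zero_neq_one)+
      moreover have "e ` {..<4} \<inter> f ` {..<4} = {}"
        by auto (metis val(1,4) zero_neq_one)
      ultimately show ?thesis by (simp add: card_Un_disjoint card_image)
    qed
    ultimately show False by simp
  qed
  have "\<exists>e f. hyperbolic_pairs m e f" if "m \<le> 3" for m
    using that
  proof (induction m)
    case 0
    show ?case by (simp add: hyperbolic_pairs_def)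
  next
    case (Suc m)
    then obtain e f where H: "hyperbolic_pairs m e f" by auto
    obtain x where "proj m e f x \<noteq> 0" using not_all Suc.prems by (metis Suc_le_lessD)
    then show ?case using extend_pairs[OF H] by blast
  qed
  then obtain e f where "hyperbolic_pairs 3 e f" by blast
  then show ?thesis using that all by blast
qed

end

subsection \<open>Maximal partial spreads from partial ovoids\<close>

context finite_char2_field
begin

text \<open>The form \<open>a\<^sub>1 c\<^sub>1 + a\<^sub>2 c\<^sub>2 + a\<^sub>3 c\<^sub>3\<close> on 6-space, evaluated at a difference of two vectors.\<close>

definition d6 :: "'k vec6 \<Rightarrow> 'k vec6 \<Rightarrow> 'k" where
  "d6 x y = (case (x, y) of ((a1, a2, a3, c1, c2, c3), (b1, b2, b3, d1, d2, d3)) \<Rightarrow>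
     (a1 + b1) * (c1 + d1) + (a2 + b2) * (c2 + d2) + (a3 + b3) * (c3 + d3))"

lemma d6_simp [simp]: "d6 (a1, a2, a3, c1, c2, c3) (b1, b2, b3, d1, d2, d3) =
    (a1 + b1) * (c1 + d1) + (a2 + b2) * (c2 + d2) + (a3 + b3) * (c3 + d3)"
  by (simp add: d6_def)

definition symdet :: "'k \<Rightarrow> 'k \<Rightarrow> 'k \<Rightarrow> 'k \<Rightarrow> 'k \<Rightarrow> 'k \<Rightarrow> 'k" where
  "symdet p q r u v w = p * q * r + p * u * u + q * v * v + r * w * w"

text \<open>The matrix with rows \<open>(p, w, v)\<close>, \<open>(w, q, u)\<close>, \<open>(v, u, r)\<close> has determinant \<open>symdet p q r u v w\<close>
  in characteristic 2, where the term \<open>2uvw\<close> vanishes.\<close>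

lemma symdet_kernel_trivial:
  assumes "symdet p q r u v w \<noteq> 0"
    and k: "p * a + w * b + v * c = 0" "w * a + q * b + u * c = 0" "v * a + u * b + r * c = 0"
  shows "a = 0 \<and> b = 0 \<and> c = 0"
proof -
  let ?d = "symdet p q r u v w"
  have "?d * a = (q * r + u * u) * (p * a + w * b + v * c) + (u * v + r * w) * (w * a + q * b + u * c)
      + (u * w + q * v) * (v * a + u * b + r * c)"
    by (simp add: symdet_def char2)
  moreover have "?d * b = (u * v + r * w) * (p * a + w * b + v * c) + (p * r + v * v) * (w * a + q * b + u * c)
      + (v * w + p * u) * (v * a + u * b + r * c)"
    by (simp add: symdet_def char2)
  moreover have "?d * c = (u * w + q * v) * (p * a + w * b + v * c) + (v * w + p * u) * (w * a + q * b + u * c)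
      + (p * q + w * w) * (v * a + u * b + r * c)"
    by (simp add: symdet_def char2)
  ultimately have "?d * a = 0" "?d * b = 0" "?d * c = 0" unfolding k by simp_all
  then show ?thesis using assms(1) by simp
qed

text \<open>Every column of the adjugate is a kernel vector. If the adjugate is zero, the matrix has
  rank at most 1: either it is zero, or some diagonal entry is nonzero and a kernel vector can be
  read off from that row.\<close>

lemma symdet_kernel_nontrivial:
  assumes "symdet p q r u v w = 0"
  shows "\<exists>a b c. (a \<noteq> 0 \<or> b \<noteq> 0 \<or> c \<noteq> 0) \<and>
    p * a + w * b + v * c = 0 \<and> w * a + q * b + u * c = 0 \<and> v * a + u * b + r * c = 0"
    (is "\<exists>a b c. ?K a b c")
proof -
  define A11 A22 A33 A12 A13 A23 where
    "A11 = q * r + u * u" and "A22 = p * r + v * v" and "A33 = p * q + w * w" and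
    "A12 = u * v + r * w" and "A13 = u * w + q * v" and "A23 = v * w + p * u"
  note A = A11_def A22_def A33_def A12_def A13_def A23_def
  let ?d = "symdet p q r u v w"
  have "p * A11 + w * A12 + v * A13 = ?d" "w * A11 + q * A12 + u * A13 = 0" "v * A11 + u * A12 + r * A13 = 0"
    by (simp_all add: A symdet_def char2)
  note col1 = this[unfolded assms]
  have "p * A12 + w * A22 + v * A23 = 0" "w * A12 + q * A22 + u * A23 = ?d" "v * A12 + u * A22 + r * A23 = 0"
    by (simp_all add: A symdet_def char2)
  note col2 = this[unfolded assms]
  have "p * A13 + w * A23 + v * A33 = 0" "w * A13 + q * A23 + u * A33 = 0" "v * A13 + u * A23 + r * A33 = ?d"
    by (simp_all add: A symdet_def char2)
  note col3 = this[unfolded assms]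
  show ?thesis
  proof (cases "A11 = 0 \<and> A12 = 0 \<and> A13 = 0 \<and> A22 = 0 \<and> A23 = 0 \<and> A33 = 0")
    case False
    then have "?K A11 A12 A13 \<or> ?K A12 A22 A23 \<or> ?K A13 A23 A33"
      using col1 col2 col3 by blast
    then show ?thesis by blast
  next
    case True
    then have eqs: "q * r = u * u" "p * r = v * v" "p * q = w * w" "u * v = r * w" "u * w = q * v" "v * w = p * u"
      by (simp_all add: A add_eq_0_iff2)
    show ?thesis
    proof (cases "p = 0 \<and> q = 0 \<and> r = 0")
      case True
      then have "u = 0" "v = 0" "w = 0" using eqs by auto
      then have "?K 1 0 0" using True by simp
      then show ?thesis by blast
    next
      case False
      then consider "p \<noteq> 0" | "q \<noteq> 0" | "r \<noteq> 0" by blast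
      then show ?thesis
      proof cases
        case 1
        moreover have "w * w + q * p = 0" "v * w + u * p = 0"
          unfolding add_eq_0_iff2 using eqs(3,6) by (metis mult.commute)+
        ultimately have "?K w p 0" by (simp add: mult.commute)
        then show ?thesis by blast
      next
        case 2
        moreover have "p * q + w * w = 0" "v * q + u * w = 0"
          unfolding add_eq_0_iff2 using eqs(3,5) by (metis mult.commute)+
        ultimately have "?K q w 0" by (simp add: mult.commute)
        then show ?thesis by blast
      next
        case 3
        moreover have "p * r + v * v = 0" "w * r + u * v = 0"
          unfolding add_eq_0_iff2 using eqs(2,4) by (metis mult.commute)+
        ultimately have "?K r 0 v" by (simp add: mult.commute)
        then show ?thesis by blast
      qed
    qed
  qed
qed

end

section \<open>Lagrangian subspaces as graphs of symmetric matrices\<close>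

locale Sp6_coordinates = Sp6_char2 scale form q
  for scale :: "'k::field \<Rightarrow> 'v::ab_group_add \<Rightarrow> 'v" (infixr "*s" 75) and form q +
  fixes e1 e2 e3 f1 f2 f3 :: 'v
  assumes pairs [simp]:
    "form e1 e1 = 0" "form e1 e2 = 0" "form e1 e3 = 0" "form e1 f1 = 1" "form e1 f2 = 0" "form e1 f3 = 0"
    "form e2 e1 = 0" "form e2 e2 = 0" "form e2 e3 = 0" "form e2 f1 = 0" "form e2 f2 = 1" "form e2 f3 = 0"
    "form e3 e1 = 0" "form e3 e2 = 0" "form e3 e3 = 0" "form e3 f1 = 0" "form e3 f2 = 0" "form e3 f3 = 1"
    "form f1 e1 = 1" "form f1 e2 = 0" "form f1 e3 = 0" "form f1 f1 = 0" "form f1 f2 = 0" "form f1 f3 = 0"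
    "form f2 e1 = 0" "form f2 e2 = 1" "form f2 e3 = 0" "form f2 f1 = 0" "form f2 f2 = 0" "form f2 f3 = 0"
    "form f3 e1 = 0" "form f3 e2 = 0" "form f3 e3 = 1" "form f3 f1 = 0" "form f3 f2 = 0" "form f3 f3 = 0"
    and expand: "\<And>x. x = form x f1 *s e1 + form x f2 *s e2 + form x f3 *s e3
      + form x e1 *s f1 + form x e2 *s f2 + form x e3 *s f3"
begin

definition vec :: "'k \<Rightarrow> 'k \<Rightarrow> 'k \<Rightarrow> 'k \<Rightarrow> 'k \<Rightarrow> 'k \<Rightarrow> 'v" where
  "vec a1 a2 a3 b1 b2 b3 = a1 *s e1 + a2 *s e2 + a3 *s e3 + b1 *s f1 + b2 *s f2 + b3 *s f3"

lemma form_vec [simp]: "form (vec a1 a2 a3 b1 b2 b3) (vec c1 c2 c3 d1 d2 d3) =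
    a1 * d1 + a2 * d2 + a3 * d3 + b1 * c1 + b2 * c2 + b3 * c3"
  unfolding vec_def by (simp add: algebra_simps)

lemma vec_eq_iff [simp]: "vec a1 a2 a3 b1 b2 b3 = vec c1 c2 c3 d1 d2 d3 \<longleftrightarrow>
    a1 = c1 \<and> a2 = c2 \<and> a3 = c3 \<and> b1 = d1 \<and> b2 = d2 \<and> b3 = d3"
proof
  assume eq: "vec a1 a2 a3 b1 b2 b3 = vec c1 c2 c3 d1 d2 d3"
  have "form (vec a1 a2 a3 b1 b2 b3) z = form (vec c1 c2 c3 d1 d2 d3) z" for z using eq by simp
  from this[of f1] this[of f2] this[of f3] this[of e1] this[of e2] this[of e3]
  show "a1 = c1 \<and> a2 = c2 \<and> a3 = c3 \<and> b1 = d1 \<and> b2 = d2 \<and> b3 = d3"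
    by (simp add: vec_def)
qed simp

lemma vec_add [simp]: "vec a1 a2 a3 b1 b2 b3 + vec c1 c2 c3 d1 d2 d3 =
    vec (a1 + c1) (a2 + c2) (a3 + c3) (b1 + d1) (b2 + d2) (b3 + d3)"
  by (simp add: vec_def algebra_simps)

lemma vec_scale [simp]: "k *s vec a1 a2 a3 b1 b2 b3 = vec (k * a1) (k * a2) (k * a3) (k * b1) (k * b2) (k * b3)"
  by (simp add: vec_def algebra_simps)

lemma vec_0: "0 = vec 0 0 0 0 0 0"
  by (simp add: vec_def)

lemma vec_cases: obtains a1 a2 a3 b1 b2 b3 where "x = vec a1 a2 a3 b1 b2 b3"
  using that expand[of x] unfolding vec_def by blast

definition lagr_inf :: "'v set" where
  "lagr_inf = {vec 0 0 0 a b c | a b c. True}"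

text \<open>The graph of the symmetric matrix with rows \<open>(p, w, v)\<close>,
  \<open>(w, m, u)\<close>, \<open>(v, u, r)\<close>, as a map from the span of the
  \<open>e\<close>-vectors to the span of the \<open>f\<close>-vectors.\<close>

definition lagr :: "'k \<Rightarrow> 'k \<Rightarrow> 'k \<Rightarrow> 'k \<Rightarrow> 'k \<Rightarrow> 'k \<Rightarrow> 'v set" where
  "lagr p m r u v w =
     {vec a b c (p * a + w * b + v * c) (w * a + m * b + u * c) (v * a + u * b + r * c) | a b c. True}"

definition lagrangian :: "'v set \<Rightarrow> bool" where
  "lagrangian W \<longleftrightarrow> subspace W \<and> dim W = 3 \<and> totally_isotropic W"

lemma lagrangian_lagr_inf: "lagrangian lagr_inf"
proof -
  let ?x = "vec 0 0 0 1 0 0" and ?y = "vec 0 0 0 0 1 0" and ?z = "vec 0 0 0 0 0 1"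
  have "lagr_inf = span {?x, ?y, ?z}" unfolding span_triple lagr_inf_def by simp
  moreover have "dim (span {?x, ?y, ?z}) = 3" by (rule dim_triple) (simp add: vec_0)
  moreover have "form x y = 0" if "x \<in> lagr_inf" "y \<in> lagr_inf" for x y
    using that by (auto simp: lagr_inf_def)
  ultimately show ?thesis by (simp add: lagrangian_def totally_isotropic_def)
qed

lemma lagrangian_lagr: "lagrangian (lagr p m r u v w)"
proof -
  let ?x = "vec 1 0 0 p w v" and ?y = "vec 0 1 0 w m u" and ?z = "vec 0 0 1 v u r"
  have "lagr p m r u v w = span {?x, ?y, ?z}" unfolding span_triple lagr_def by (simp add: ac_simps)
  moreover have "dim (span {?x, ?y, ?z}) = 3" by (rule dim_triple) (simp add: vec_0)
  moreover have "form x y = 0" if "x \<in> lagr p m r u v w" "y \<in> lagr p m r u v w" for x y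
    using that by (auto simp: lagr_def char2)
  ultimately show ?thesis by (simp add: lagrangian_def totally_isotropic_def)
qed

lemma lagr_inter_inf: "lagr p m r u v w \<inter> lagr_inf = {0}"
  by (auto simp: lagr_def lagr_inf_def vec_0)

text \<open>Disjointness makes the projection of \<open>W\<close> to its
  \<open>e\<close>-coordinates injective, hence bijective by finiteness, so \<open>W\<close> is the
  graph of a linear map. Isotropy makes the matrix symmetric.\<close>

lemma lagrangian_disjoint_inf:
  assumes W: "lagrangian W" and inf: "W \<inter> lagr_inf = {0}"
  obtains p m r u v w where "W = lagr p m r u v w"
proof -
  have sub: "subspace W" and ti: "\<And>x y. x \<in> W \<Longrightarrow> y \<in> W \<Longrightarrow> form x y = 0"
    using W by (auto simp: lagrangian_def totally_isotropic_def)
  obtain x y z where xyz: "W = span {x, y, z}"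
    and indep: "\<And>a b c. a *s x + b *s y + c *s z = 0 \<Longrightarrow> a = 0 \<and> b = 0 \<and> c = 0"
    using W dim_3_obtain_triple unfolding lagrangian_def by blast
  let ?s = "\<lambda>(a, b, c). a *s x + b *s y + c *s z"
  let ?g = "\<lambda>t. (form (?s t) f1, form (?s t) f2, form (?s t) f3)"
  have sW: "?s t \<in> W" for t unfolding xyz span_triple by (cases t) auto
  have zero: "t = 0" if "t \<in> W" "form t f1 = 0" "form t f2 = 0" "form t f3 = 0" for t
  proof -
    have "t \<in> lagr_inf" unfolding lagr_inf_def vec_def using expand[of t] that by auto
    then show ?thesis using inf that by blast
  qed
  have "inj ?g"
  proof (rule injI)
    fix t t' assume eq: "?g t = ?g t'"
    have "?s t + ?s t' = 0"
      using eq by (intro zero subspace_add[OF sub] sW) simp_all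
    moreover obtain a b c a' b' c' where t: "t = (a, b, c)" "t' = (a', b', c')" by (metis prod_cases3)
    ultimately have "(a + a') *s x + (b + b') *s y + (c + c') *s z = 0" by (simp add: algebra_simps)
    then show "t = t'" using indep t by (metis add_eq_0_iff2)
  qed
  moreover have "finite (UNIV :: ('k \<times> 'k \<times> 'k) set)" by (simp add: finite_Prod_UNIV)
  ultimately have "surj ?g" by (rule finite_UNIV_inj_surj[rotated])
  then have ex: "\<exists>g\<in>W. form g f1 = a \<and> form g f2 = b \<and> form g f3 = c" for a b c
  proof -
    assume "surj ?g"
    then obtain t where "(a, b, c) = ?g t" by (rule surjE)
    then show ?thesis using sW[of t] by auto
  qed
  have ex': "\<exists>b1 b2 b3. vec a b c b1 b2 b3 \<in> W" for a b c
  proof -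
    obtain g where g: "g \<in> W" "form g f1 = a" "form g f2 = b" "form g f3 = c" using ex by blast
    obtain a1 a2 a3 b1 b2 b3 where "g = vec a1 a2 a3 b1 b2 b3" by (rule vec_cases)
    then show ?thesis using g by (auto simp: vec_def)
  qed
  obtain p w v where g1: "vec 1 0 0 p w v \<in> W" using ex' by blast
  obtain w' m u where g2: "vec 0 1 0 w' m u \<in> W" using ex' by blast
  obtain v' u' r where g3: "vec 0 0 1 v' u' r \<in> W" using ex' by blast
  have eqs: "w' = w" "v' = v" "u' = u"
    using ti[OF g1 g2] ti[OF g1 g3] ti[OF g2 g3] by (simp_all add: add_eq_0_iff2)
  have comb: "vec a b c (p * a + w * b + v * c) (w * a + m * b + u * c) (v * a + u * b + r * c) \<in> W" for a b c
  proof -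
    have "a *s vec 1 0 0 p w v + b *s vec 0 1 0 w' m u + c *s vec 0 0 1 v' u' r \<in> W"
      by (intro subspace_add[OF sub] subspace_scale[OF sub] g1 g2 g3)
    then show ?thesis by (simp add: eqs ac_simps)
  qed
  have "W = lagr p m r u v w"
  proof
    show "lagr p m r u v w \<subseteq> W" using comb by (auto simp: lagr_def)
    show "W \<subseteq> lagr p m r u v w"
    proof
      fix t assume t: "t \<in> W"
      obtain a b c b1 b2 b3 where tv: "t = vec a b c b1 b2 b3" by (rule vec_cases)
      let ?t = "vec a b c (p * a + w * b + v * c) (w * a + m * b + u * c) (v * a + u * b + r * c)"
      have "t + ?t \<in> W" by (intro subspace_add[OF sub] t comb)
      moreover have "t + ?t \<in> lagr_inf" unfolding tv lagr_inf_def by auto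
      ultimately have "t + ?t = 0" using inf by blast
      then have "t = ?t" by (simp add: add_eq_0_iff_vector)
      then show "t \<in> lagr p m r u v w" unfolding lagr_def by blast
    qed
  qed
  then show ?thesis by (rule that)
qed

text \<open>Common vectors of two graphs correspond to the kernel of the difference of the matrices,
  which is their sum in characteristic 2.\<close>

lemma lagr_inter: "lagr p m r u v w \<inter> lagr p' m' r' u' v' w' = {0} \<longleftrightarrow>
    symdet (p + p') (m + m') (r + r') (u + u') (v + v') (w + w') \<noteq> 0"
proof -
  let ?L = "lagr p m r u v w" and ?L' = "lagr p' m' r' u' v' w'"
  have "(\<exists>a b c. (a \<noteq> 0 \<or> b \<noteq> 0 \<or> c \<noteq> 0) \<and>
    (p + p') * a + (w + w') * b + (v + v') * c = 0 \<and> (w + w') * a + (m + m') * b + (u + u') * c = 0 \<and>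
    (v + v') * a + (u + u') * b + (r + r') * c = 0) \<longleftrightarrow> (\<exists>x. x \<noteq> 0 \<and> x \<in> ?L \<inter> ?L')"
    (is "(\<exists>a b c. ?N a b c \<and> ?K a b c) \<longleftrightarrow> _")
  proof -
    have K: "?K a b c \<longleftrightarrow> p * a + w * b + v * c = p' * a + w' * b + v' * c \<and>
        w * a + m * b + u * c = w' * a + m' * b + u' * c \<and> v * a + u * b + r * c = v' * a + u' * b + r' * c" for a b c
    proof -
      have split: "(x + x') * a + (y + y') * b + (z + z') * c = (x * a + y * b + z * c) + (x' * a + y' * b + z' * c)"
        for x x' y y' z z' by (simp add: char2)
      show ?thesis unfolding split add_eq_0_iff2 ..
    qed
    show ?thesis
    proof
      assume "\<exists>a b c. ?N a b c \<and> ?K a b c"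
      then obtain a b c where abc: "?N a b c" "?K a b c" by blast
      let ?x = "vec a b c (p * a + w * b + v * c) (w * a + m * b + u * c) (v * a + u * b + r * c)"
      have "?x \<noteq> 0" unfolding vec_0 vec_eq_iff using abc(1) by blast
      moreover have "?x \<in> ?L" unfolding lagr_def by blast
      moreover have "?x = vec a b c (p' * a + w' * b + v' * c) (w' * a + m' * b + u' * c) (v' * a + u' * b + r' * c)"
        using abc(2) unfolding K by simp
      then have "?x \<in> ?L'" unfolding lagr_def by blast
      ultimately show "\<exists>x. x \<noteq> 0 \<and> x \<in> ?L \<inter> ?L'" by blast
    next
      assume "\<exists>x. x \<noteq> 0 \<and> x \<in> ?L \<inter> ?L'"
      then obtain a b c where ne: "vec a b c (p * a + w * b + v * c) (w * a + m * b + u * c) (v * a + u * b + r * c) \<noteq> 0"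
        and in': "vec a b c (p * a + w * b + v * c) (w * a + m * b + u * c) (v * a + u * b + r * c) \<in> ?L'"
        unfolding lagr_def by blast
      have "?K a b c" unfolding K using in' unfolding lagr_def by auto
      moreover have "?N a b c" using ne unfolding vec_0 vec_eq_iff by auto
      ultimately show "\<exists>a b c. ?N a b c \<and> ?K a b c" by blast
    qed
  qed
  moreover have "0 \<in> ?L \<inter> ?L'" unfolding vec_0 lagr_def by auto
  ultimately have "?L \<inter> ?L' = {0} \<longleftrightarrow> \<not> (\<exists>a b c. ?N a b c \<and> ?K a b c)" by blast
  then show ?thesis using symdet_kernel_trivial symdet_kernel_nontrivial by metis
qed

text \<open>\<open>lagr6 (a1, a2, a3, c1, c2, c3)\<close> is given by the symmetric matrix with diagonal \<open>(a1, a2, a3)\<close>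
  whose adjugate has diagonal \<open>(c1, c2, c3)\<close>.\<close>

definition lagr6 :: "'k vec6 \<Rightarrow> 'v set" where
  "lagr6 x = (case x of (a1, a2, a3, c1, c2, c3) \<Rightarrow>
     lagr a1 a2 a3 (rt (c1 + a2 * a3)) (rt (c2 + a1 * a3)) (rt (c3 + a1 * a2)))"

text \<open>Since \<open>rt\<close> is additive, the squared off-diagonal entries of the sum are
  linear in the \<open>c\<close>-coordinates and the products of diagonal entries. These products
  cancel the cubic term of the determinant modulo 2 and leave the quadratic form.\<close>

lemma lagr6_inter: "lagr6 x \<inter> lagr6 y = {0} \<longleftrightarrow> d6 x y \<noteq> 0"
proof -
  obtain a1 a2 a3 c1 c2 c3 b1 b2 b3 d1 d2 d3
    where xy: "x = (a1, a2, a3, c1, c2, c3)" "y = (b1, b2, b3, d1, d2, d3)" by (metis surj_pair)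
  have sq: "t * (rt s + rt s') * (rt s + rt s') = t * (s + s')" for t s s'
    by (metis mult.assoc rt_add rt_square)
  show ?thesis unfolding xy lagr6_def prod.case lagr_inter symdet_def sq
    by (simp add: char2)
qed

lemma lagr_eq_lagr6: "lagr p m r u v w = lagr6 (p, m, r, u * u + m * r, v * v + p * r, w * w + p * m)"
  unfolding lagr6_def by (simp add: rt_unique add.assoc)

text \<open>The additional 1 counts \<open>lagr_inf\<close>. Because \<open>lagr_inf\<close> belongs
  to the spread, any further member is disjoint from it and so equals some \<open>lagr6 z\<close>;
  maximality need only be tested on such \<open>z\<close>.\<close>

lemma maximal_from_d6:
  assumes ne: "\<And>x y. x \<in> M \<Longrightarrow> y \<in> M \<Longrightarrow> x \<noteq> y \<Longrightarrow> d6 x y \<noteq> 0"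
    and max: "\<And>z. \<exists>x\<in>M. d6 z x = 0"
  shows "has_maximal_spread_of_size (int (card M) + 1)"
proof -
  let ?S = "insert lagr_inf (lagr6 ` M)"
  have lag: "lagrangian (lagr6 x)" for x
    unfolding lagr6_def by (cases x) (auto simp: lagrangian_lagr)
  have inter_inf: "lagr6 x \<inter> lagr_inf = {0}" for x
    unfolding lagr6_def by (cases x) (auto simp: lagr_inter_inf)
  have "dim {0 :: 'v} = 0" using dim_span_eq_card_independent[OF independent_empty] by simp
  then have ne0: "W \<noteq> {0}" if "lagrangian W" for W
    using that by (auto simp: lagrangian_def)
  have "finite M" by (rule finite_subset[of _ UNIV]) (simp_all add: finite_Prod_UNIV)
  have inj: "inj_on lagr6 M"
    by (rule inj_onI) (metis Int_absorb lag lagr6_inter ne ne0)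
  have sp: "symplectic_partial_spread ?S"
    unfolding symplectic_partial_spread_def
  proof
    show "\<forall>W\<in>?S. subspace W \<and> dim W = 3 \<and> totally_isotropic W"
      using lag lagrangian_lagr_inf unfolding lagrangian_def by blast
    show "pairwise (\<lambda>U W. U \<inter> W = {0}) ?S"
    proof (rule pairwiseI)
      fix U W assume UW: "U \<in> ?S" "W \<in> ?S" "U \<noteq> W"
      then consider x where "U = lagr_inf" "W = lagr6 x" | x where "U = lagr6 x" "W = lagr_inf"
        | x y where "U = lagr6 x" "W = lagr6 y" "x \<in> M" "y \<in> M" by blast
      then show "U \<inter> W = {0}"
      proof cases
        case 3
        then have "d6 x y \<noteq> 0" using ne UW(3) by blast
        then show ?thesis using 3 lagr6_inter by blast
      qed (use inter_inf in blast)+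
    qed
  qed
  have "\<not> (\<exists>T. symplectic_partial_spread T \<and> ?S \<subset> T)"
  proof
    assume "\<exists>T. symplectic_partial_spread T \<and> ?S \<subset> T"
    then obtain T W where T: "symplectic_partial_spread T" "?S \<subseteq> T" "W \<in> T" "W \<notin> ?S" by blast
    then have "lagrangian W" unfolding symplectic_partial_spread_def lagrangian_def by blast
    have disj: "W \<inter> U = {0}" if "U \<in> ?S" for U
      using T that unfolding symplectic_partial_spread_def pairwise_def by blast
    obtain p m r u v w where "W = lagr p m r u v w"
      using lagrangian_disjoint_inf[OF \<open>lagrangian W\<close>] disj[of lagr_inf] by blast
    then obtain z where "W = lagr6 z" unfolding lagr_eq_lagr6 by blast
    moreover obtain x where "x \<in> M" "d6 z x = 0" using max[of z] by blast
    ultimately show False using disj[of "lagr6 x"] lagr6_inter[of z x] by blast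
  qed
  then have "maximal_symplectic_partial_spread ?S"
    using sp unfolding maximal_symplectic_partial_spread_def by blast
  moreover have "lagr_inf \<notin> lagr6 ` M"
    using inter_inf ne0[OF lagrangian_lagr_inf] by (metis Int_absorb imageE)
  then have "card ?S = Suc (card M)" using \<open>finite M\<close> inj by (simp add: card_image)
  ultimately show ?thesis unfolding has_maximal_spread_of_size_def using \<open>finite M\<close>
    by (intro exI[of _ ?S]) simp
qed

end

context Sp6_char2
begin

lemma maximal_spread_from_d6:
  assumes "\<And>x y. x \<in> M \<Longrightarrow> y \<in> M \<Longrightarrow> x \<noteq> y \<Longrightarrow> d6 x y \<noteq> 0"
    and "\<And>z. \<exists>x\<in>M. d6 z x = 0"
  shows "has_maximal_spread_of_size (int (card M) + 1)"
proof -
  obtain e f where H: "hyperbolic_pairs 3 e f" and z: "\<And>x. proj 3 e f x = 0" by (rule pairs_3) blast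
  have H': "form (e i) (f j) = (if i = j then 1 else 0)" "form (f i) (e j) = (if i = j then 1 else 0)"
      "form (e i) (e j) = 0" "form (f i) (f j) = 0" if "i < 3" "j < 3" for i j
    using H that by (simp_all add: hyperbolic_pairs_def)
  interpret Sp6_coordinates scale form q "e 0" "e 1" "e 2" "f 0" "f 1" "f 2"
  proof
    show "x = form x (f 0) *s e 0 + form x (f 1) *s e 1 + form x (f 2) *s e 2
      + form x (e 0) *s f 0 + form x (e 1) *s f 1 + form x (e 2) *s f 2" for x
      using z[of x] unfolding proj_0_iff by (simp add: eval_nat_numeral algebra_simps)
  qed (simp_all add: H')
  show ?thesis by (rule maximal_from_d6[OF assms])
qed

end

section \<open>Singular points of the hyperbolic quadric in 8-space\<close>

context finite_char2_field
begin

definition q8 :: "'k vec8 \<Rightarrow> 'k" where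
  "q8 x = (case x of (a1, a2, a3, a4, c1, c2, c3, c4) \<Rightarrow> a1 * c1 + a2 * c2 + a3 * c3 + a4 * c4)"

definition b8 :: "'k vec8 \<Rightarrow> 'k vec8 \<Rightarrow> 'k" where
  "b8 x y = (case (x, y) of ((a1, a2, a3, a4, c1, c2, c3, c4), (b1, b2, b3, b4, d1, d2, d3, d4)) \<Rightarrow>
     a1 * d1 + a2 * d2 + a3 * d3 + a4 * d4 + b1 * c1 + b2 * c2 + b3 * c3 + b4 * c4)"

lemma q8_simp [simp]: "q8 (a1, a2, a3, a4, c1, c2, c3, c4) = a1 * c1 + a2 * c2 + a3 * c3 + a4 * c4"
  by (simp add: q8_def)

lemma b8_simp [simp]: "b8 (a1, a2, a3, a4, c1, c2, c3, c4) (b1, b2, b3, b4, d1, d2, d3, d4) =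
    a1 * d1 + a2 * d2 + a3 * d3 + a4 * d4 + b1 * c1 + b2 * c2 + b3 * c3 + b4 * c4"
  by (simp add: b8_def)

text \<open>\<open>last8 x\<close> is the value of the polar form at \<open>x\<close> and the singular point \<open>(0, 0, 0, 1, 0, 0, 0, 0)\<close>, which
  plays the role of the spread element at infinity.  The singular points not perpendicular to it form the
  affine 6-space with chart \<open>chart8\<close>.\<close>

definition last8 :: "'k vec8 \<Rightarrow> 'k" where
  "last8 x = (case x of (a1, a2, a3, a4, c1, c2, c3, c4) \<Rightarrow> c4)"

lemma last8_simp [simp]: "last8 (a1, a2, a3, a4, c1, c2, c3, c4) = c4"
  by (simp add: last8_def)

definition chart8 :: "'k vec8 \<Rightarrow> 'k vec6" where
  "chart8 x = (case x of (a1, a2, a3, a4, c1, c2, c3, c4) \<Rightarrow> (a1 / c4, a2 / c4, a3 / c4, c1 / c4, c2 / c4, c3 / c4))"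

text \<open>Scale both last coordinates to 1. For singular vectors the polar form equals the
  quadratic form of the sum, and the sum has last coordinate 0, so only the six chart coordinates
  contribute.\<close>

lemma d6_chart8:
  assumes "q8 x = 0" "last8 x \<noteq> 0" "q8 y = 0" "last8 y \<noteq> 0"
  shows "d6 (chart8 x) (chart8 y) = b8 x y / (last8 x * last8 y)"
proof -
  obtain a1 a2 a3 a4 c1 c2 c3 c4 b1 b2 b3 b4 d1 d2 d3 d4
    where xy: "x = (a1, a2, a3, a4, c1, c2, c3, c4)" "y = (b1, b2, b3, b4, d1, d2, d3, d4)" by (metis surj_pair)
  have nz: "c4 \<noteq> 0" "d4 \<noteq> 0" using assms by (simp_all add: xy)
  have qx: "a1 * c1 + a2 * c2 + a3 * c3 = a4 * c4" "b1 * d1 + b2 * d2 + b3 * d3 = b4 * d4"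
    using assms by (simp_all add: xy add_eq_0_iff2)
  have "d6 (chart8 x) (chart8 y) * (c4 * d4) * (c4 * d4) =
    (a1 * d4 + b1 * c4) * (c1 * d4 + d1 * c4) + (a2 * d4 + b2 * c4) * (c2 * d4 + d2 * c4)
      + (a3 * d4 + b3 * c4) * (c3 * d4 + d3 * c4)"
    using nz by (simp add: xy chart8_def add_divide_eq_iff divide_add_eq_iff)
  also have "\<dots> = (a1 * c1 + a2 * c2 + a3 * c3) * (d4 * d4) + (b1 * d1 + b2 * d2 + b3 * d3) * (c4 * c4)
      + (a1 * d1 + a2 * d2 + a3 * d3 + b1 * c1 + b2 * c2 + b3 * c3) * (c4 * d4)"
    by (simp add: char2)
  also have "\<dots> = b8 x y * (c4 * d4)" unfolding qx by (simp add: xy char2)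
  finally have "d6 (chart8 x) (chart8 y) * (c4 * d4) = b8 x y" using nz by simp
  then show ?thesis using nz by (simp add: xy eq_divide_eq del: d6_simp b8_simp)
qed

end

context Sp6_char2
begin

lemma maximal_spread_from_b8:
  assumes P: "\<And>x. x \<in> P \<Longrightarrow> q8 x = 0 \<and> last8 x \<noteq> 0"
    and ne: "\<And>x y. x \<in> P \<Longrightarrow> y \<in> P \<Longrightarrow> x \<noteq> y \<Longrightarrow> b8 x y \<noteq> 0"
    and max: "\<And>z. q8 z = 0 \<Longrightarrow> last8 z \<noteq> 0 \<Longrightarrow> \<exists>x\<in>P. b8 z x = 0"
  shows "has_maximal_spread_of_size (int (card P) + 1)"
proof -
  have self: "b8 x x = 0" for x by (simp add: b8_def char2 split: prod.split)
  have d: "d6 (chart8 x) (chart8 y) = 0 \<longleftrightarrow> b8 x y = 0" if "x \<in> P" "y \<in> P" for x y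
    using d6_chart8[of x y] P that by auto
  have inj: "inj_on chart8 P"
    by (rule inj_onI) (metis d ne self)
  have "has_maximal_spread_of_size (int (card (chart8 ` P)) + 1)"
  proof (rule maximal_spread_from_d6)
    fix x y assume "x \<in> chart8 ` P" "y \<in> chart8 ` P" "x \<noteq> y"
    moreover from this obtain x' y' where "x = chart8 x'" "y = chart8 y'" "x' \<in> P" "y' \<in> P" by blast
    ultimately show "d6 x y \<noteq> 0" using d[of x' y'] ne[of x' y'] by metis
  next
    fix z :: "'k vec6"
    obtain a1 a2 a3 c1 c2 c3 where z: "z = (a1, a2, a3, c1, c2, c3)" by (metis surj_pair)
    \<comment> \<open>The fourth coordinate is forced by singularity once the last one is 1.\<close>
    let ?z = "(a1, a2, a3, a1 * c1 + a2 * c2 + a3 * c3, c1, c2, c3, 1)"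
    have "q8 ?z = 0" "last8 ?z \<noteq> 0" "chart8 ?z = z" by (simp_all add: z chart8_def)
    moreover from this obtain x where "x \<in> P" "b8 ?z x = 0" using max by blast
    ultimately show "\<exists>x\<in>chart8 ` P. d6 z x = 0"
      using d6_chart8[of ?z x] P[of x] by (metis div_0 imageI)
  qed
  then show ?thesis using inj by (simp add: card_image)
qed

end

subsection \<open>Elliptic quadrics\<close>

locale artin_schreier = finite_char2_field K for K :: "'k::field itself" +
  fixes d :: 'k
  assumes not_artin_schreier: "u * u + u \<noteq> d"
begin

text \<open>The norm form of the quadratic extension generated by a root of
  \<open>u * u + u = d\<close>, hence anisotropic.\<close>

definition nrm :: "'k \<Rightarrow> 'k \<Rightarrow> 'k" where "nrm x y = x * (x + y) + d * (y * y)"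

lemma nrm_eq_0_iff [simp]: "nrm x y = 0 \<longleftrightarrow> x = 0 \<and> y = 0"
proof (cases "y = 0")
  case False
  define u where "u = x / y"
  have x: "x = u * y" using False by (simp add: u_def)
  have "nrm x y = (u * u + u + d) * (y * y)" by (simp add: nrm_def x char2)
  moreover have "u * u + u + d \<noteq> 0" using not_artin_schreier[of u] by (simp add: add_eq_0_iff2)
  ultimately show ?thesis using False by simp
qed (simp add: nrm_def)

text \<open>A plane on which the form of the 6-space restricts to \<open>nrm\<close>. With the base
  point at infinity it represents an elliptic quadric.\<close>

definition ell :: "'k \<times> 'k \<Rightarrow> 'k vec6" where
  "ell = (\<lambda>(x, y). (x, y, 0, x + y, d * y, 0))"

text \<open>The points of an elliptic quadric in the orthogonal complement of \<open>range ell\<close>, except \<open>(0, 0, 0, 0, 0, 1)\<close>.\<close>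

definition cone :: "'k \<times> 'k \<Rightarrow> 'k vec6" where
  "cone = (\<lambda>(a, b). (a, b, 1, a, a + d * b, nrm a b))"

lemma inj_ell: "inj ell" and inj_cone: "inj cone"
  by (auto simp: inj_def ell_def cone_def)

lemma d6_ell: "d6 (ell (x, y)) (ell (x', y')) = nrm (x + x') (y + y')"
  by (simp add: ell_def nrm_def char2)

lemma d6_cone: "d6 (cone (x, y)) (cone (x', y')) = nrm (x + x') (y + y')"
  by (simp add: cone_def nrm_def char2)

text \<open>Points of the cone are singular and orthogonal to \<open>range ell\<close>, so only the
  norm of the \<open>ell\<close> part survives. It vanishes at the zero vector alone, the one point
  of \<open>range ell\<close> that \<open>ell_cone\<close> omits.\<close>

lemma d6_cone_ell: "d6 (cone (a, b)) (ell (x, y)) = nrm x y" "d6 (ell (x, y)) (cone (a, b)) = nrm x y"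
  by (simp_all add: cone_def ell_def nrm_def char2)

lemma d6_vertex: "d6 (0, 0, 0, 0, 0, 1) (ell (x, y)) = nrm x y" "d6 (ell (x, y)) (0, 0, 0, 0, 0, 1) = nrm x y"
   "d6 (0, 0, 0, 0, 0, 1) (cone (a, b)) = 1" "d6 (cone (a, b)) (0, 0, 0, 0, 0, 1) = 1"
  by (simp_all add: cone_def ell_def nrm_def char2)

text \<open>Orthogonal decomposition of the 6-space along the anisotropic plane \<open>range ell\<close>.\<close>

lemma d6_ell_decompose:
  "d6 (a1, a2, a3, c1, c2, c3) (ell (x, y)) = nrm (c2 + a1 + d * a2 + x) (a1 + c1 + y)
    + (nrm (c2 + d * a2) (a2 + a1 + c1) + a3 * c3)"
  by (simp add: ell_def nrm_def char2)

text \<open>The arguments of the norm in the decomposition are arbitrary, and \<open>nrm x 0\<close>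
  is a square, so it attains every residual value.\<close>

lemma maximal_ell: "\<exists>x\<in>range ell. d6 z x = 0"
proof -
  obtain a1 a2 a3 c1 c2 c3 where z: "z = (a1, a2, a3, c1, c2, c3)" by (metis surj_pair)
  let ?k = "nrm (c2 + d * a2) (a2 + a1 + c1) + a3 * c3"
  have "d6 z (ell (c2 + a1 + d * a2 + rt ?k, a1 + c1)) = nrm (rt ?k) 0 + ?k"
    unfolding z d6_ell_decompose by simp
  also have "\<dots> = 0" by (simp add: nrm_def)
  finally show ?thesis by blast
qed

definition ell_cone :: "'k vec6 set" where
  "ell_cone = ell ` (UNIV - {(0, 0)}) \<union> insert (0, 0, 0, 0, 0, 1) (range cone)"

lemma ell_cone_clique:
  assumes "x \<in> ell_cone" "y \<in> ell_cone" "x \<noteq> y"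
  shows "d6 x y \<noteq> 0"
proof -
  have cases: "(\<exists>a b. z = ell (a, b) \<and> (a, b) \<noteq> (0, 0)) \<or> (\<exists>a b. z = cone (a, b)) \<or> z = (0, 0, 0, 0, 0, 1)"
    if "z \<in> ell_cone" for z
  proof -
    have "z \<in> ell ` (UNIV - {(0, 0)}) \<or> z \<in> range cone \<or> z = (0, 0, 0, 0, 0, 1)"
      using that unfolding ell_cone_def Un_iff insert_iff by blast
    then show ?thesis
    proof (elim disjE)
      assume "z \<in> ell ` (UNIV - {(0, 0)})"
      then obtain p where p: "z = ell p" "p \<noteq> (0, 0)" by (metis DiffE imageE singletonI)
      obtain a b where "p = (a, b)" by (rule prod.exhaust)
      then show ?thesis using p by blast
    next
      assume "z \<in> range cone"
      then obtain p where p: "z = cone p" by blast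
      obtain a b where "p = (a, b)" by (rule prod.exhaust)
      then show ?thesis using p by blast
    qed blast
  qed
  show ?thesis
    using cases[OF assms(1)] cases[OF assms(2)] assms(3)
    by (elim disjE exE conjE) (auto simp del: d6_simp simp: d6_ell d6_cone d6_cone_ell d6_vertex add_eq_0_iff2)
qed

text \<open>The omitted zero vector is the only obstacle. If \<open>k\<close> is nonzero,
  \<open>nrm x y = k\<close> has two different solutions, one of which avoids it. If
  \<open>k = 0\<close> and the solution is the omitted vector, then \<open>z\<close> is singular and
  orthogonal to the plane, hence a multiple of one of the points chosen on the cone, and the form
  vanishes on their difference.\<close>

lemma ell_cone_maximal: "\<exists>x\<in>ell_cone. d6 z x = 0"
proof -
  obtain a1 a2 a3 c1 c2 c3 where z: "z = (a1, a2, a3, c1, c2, c3)" by (metis surj_pair)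
  define k where "k = nrm (c2 + d * a2) (a2 + a1 + c1) + a3 * c3"
  define x0 y0 where "x0 = c2 + a1 + d * a2" and "y0 = a1 + c1"
  have dz: "d6 z (ell (x0 + x, y0 + y)) = nrm x y + k" for x y
    unfolding z d6_ell_decompose k_def x0_def y0_def by (simp add: add.assoc)
  have "d \<noteq> 0" using not_artin_schreier[of 0] by simp
  have ex_ell: ?thesis if "nrm x y = k" "(x0 + x, y0 + y) \<noteq> (0, 0)" for x y
    using that dz[of x y] unfolding ell_cone_def by (auto simp del: d6_simp)
  show ?thesis
  proof (cases "k = 0")
    case True
    show ?thesis
    proof (cases "x0 = 0 \<and> y0 = 0")
      case False
      then show ?thesis using ex_ell[of 0 0] True by simp
    next
      case 0: True
      then have c: "c1 = a1" "c2 = a1 + d * a2"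
        unfolding x0_def y0_def by (simp_all add: add_eq_0_iff2 add.assoc)
      have n: "nrm a1 a2 = a3 * c3"
        using True unfolding k_def c by (simp add: add_eq_0_iff2 add.assoc)
      show ?thesis
      proof (cases "a3 = 0")
        case True
        then have "z = (0, 0, 0, 0, 0, c3)" using n c by (simp add: z)
        then have "d6 z (0, 0, 0, 0, 0, 1) = 0" by simp
        then show ?thesis unfolding ell_cone_def by blast
      next
        case False
        define a b where "a = a1 / a3" and "b = a2 / a3"
        have ab: "a1 = a3 * a" "a2 = a3 * b" using False by (simp_all add: a_def b_def)
        have "a3 * (a3 * nrm a b) = a3 * c3" unfolding n[symmetric] ab by (simp add: nrm_def char2)
        then have c3: "c3 = a3 * nrm a b" using False by simp
        have "d6 z (cone (a, b)) = 0"
          unfolding z c c3 ab by (simp add: cone_def nrm_def char2)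
        then show ?thesis unfolding ell_cone_def by blast
      qed
    qed
  next
    case False
    show ?thesis
    proof (cases "(x0 + rt k, y0) = (0, 0)")
      case False
      then show ?thesis using ex_ell[of "rt k" 0] by (simp add: nrm_def)
    next
      case True
      have "nrm 0 (rt (k / d)) = k" using \<open>d \<noteq> 0\<close> by (simp add: nrm_def)
      moreover have "rt (k / d) \<noteq> 0"
        using \<open>k \<noteq> 0\<close> \<open>d \<noteq> 0\<close> by (metis divide_eq_0_iff mult_zero_left rt_square)
      ultimately show ?thesis using ex_ell[of 0 "rt (k / d)"] True by simp
    qed
  qed
qed

lemma card_ell: "card (range ell) = card (UNIV :: 'k set) ^ 2"
  using inj_ell by (simp add: card_image power2_eq_square flip: UNIV_Times_UNIV)

lemma card_ell_cone: "card ell_cone = 2 * card (UNIV :: 'k set) ^ 2"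
proof -
  have fin: "finite (UNIV :: ('k \<times> 'k) set)" by (simp add: finite_Prod_UNIV)
  have c: "card (UNIV :: ('k \<times> 'k) set) = card (UNIV :: 'k set) ^ 2"
    by (simp add: power2_eq_square flip: UNIV_Times_UNIV)
  then have pos: "card (UNIV :: 'k set) ^ 2 > 0" using fin by (metis finite_UNIV_card_ge_0)
  have "inj_on ell (UNIV - {(0, 0)})" using inj_ell by (rule inj_on_subset) simp
  then have 1: "card (ell ` (UNIV - {(0, 0)})) = card (UNIV :: 'k set) ^ 2 - 1"
    using fin by (simp add: card_image c card_Diff_subset)
  have "(0, 0, 0, 0, 0, 1) \<notin> range cone" by (auto simp: cone_def)
  then have 2: "card (insert (0, 0, 0, 0, 0, 1) (range cone)) = Suc (card (UNIV :: 'k set) ^ 2)"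
    using fin inj_cone by (simp add: card_image c)
  have "ell ` (UNIV - {(0, 0)}) \<inter> insert (0, 0, 0, 0, 0, 1) (range cone) = {}"
    by (auto simp: ell_def cone_def)
  then show ?thesis unfolding ell_cone_def using fin 1 2 pos by (subst card_Un_disjoint) auto
qed

end

context Sp6_char2
begin

lemma maximal_spread_quadric: "has_maximal_spread_of_size (int q ^ 2 + 1)"
  and maximal_spread_two_quadrics: "has_maximal_spread_of_size (2 * int q ^ 2 + 1)"
proof -
  obtain d :: 'k where "\<And>u. u * u + u \<noteq> d" using ex_artin_schreier by blast
  then interpret artin_schreier "TYPE('k)" d by unfold_locales
  have "has_maximal_spread_of_size (int (card (range ell)) + 1)"
  proof (rule maximal_spread_from_d6)
    fix x y assume "x \<in> range ell" "y \<in> range ell" "x \<noteq> y"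
    then obtain a b a' b' where "x = ell (a, b)" "y = ell (a', b')" "(a, b) \<noteq> (a', b')" by (metis imageE surj_pair)
    then show "d6 x y \<noteq> 0" by (auto simp: d6_ell add_eq_0_iff2 simp del: d6_simp)
  qed (rule maximal_ell)
  then show "has_maximal_spread_of_size (int q ^ 2 + 1)" by (simp add: card_ell card_field)
  have "has_maximal_spread_of_size (int (card ell_cone) + 1)"
    by (rule maximal_spread_from_d6[OF ell_cone_clique ell_cone_maximal])
  then show "has_maximal_spread_of_size (2 * int q ^ 2 + 1)" by (simp add: card_ell_cone card_field)
qed

end

subsection \<open>Desarguesian ovoids and their hyperplane sections\<close>

locale cubic_extension = finite_char2_field K for K :: "'k::field itself" +
  fixes t :: 'k
  assumes no_root: "s * s * s + s \<noteq> t"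
begin

lemma t_nonzero: "t \<noteq> 0" using no_root[of 0] by auto

text \<open>\<open>norm3 k u v\<close> is the norm of \<open>k + u x + v x\<^sup>2\<close>, where \<open>x\<^sup>3 + x + t = 0\<close>; the elements with \<open>k = 0\<close> are those
  of trace 0.  The gradient \<open>(ad1, ad2, ad3)\<close> of the norm represents the adjoint map.\<close>

definition f0 :: "'k \<Rightarrow> 'k \<Rightarrow> 'k" where
  "f0 u v = u * u * u + u * v * v + t * (v * v * v)"

definition norm3 :: "'k \<Rightarrow> 'k \<Rightarrow> 'k \<Rightarrow> 'k" where
  "norm3 k u v = k * k * k + k * (u * u + t * u * v + v * v) + t * f0 u v"

lemma f0_eq_0_iff [simp]: "f0 u v = 0 \<longleftrightarrow> u = 0 \<and> v = 0"
proof (cases "v = 0")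
  case False
  define s where "s = u / v"
  have u: "u = s * v" using False by (simp add: s_def)
  have "f0 u v = (s * s * s + s + t) * (v * v * v)" by (simp add: f0_def u char2)
  moreover have "s * s * s + s + t \<noteq> 0" using no_root by (simp add: add_eq_0_iff2)
  ultimately show ?thesis using False by simp
qed (simp add: f0_def)

text \<open>\<open>r1 * x + r0\<close> is the remainder of x^3 + x + t modulo x^2 + u x + k, and the
  norm is the resultant. For \<open>r1 \<noteq> 0\<close> it is, up to a square factor, the
  quadratic at the root \<open>s\<close> of the remainder, and there the quadratic divides a nonzero
  value of the cubic. For \<open>r1 = 0\<close> the remainder is a nonzero constant, since the cubic
  has no quadratic factor.\<close>

lemma norm3_nonzero_1: "norm3 k u 1 \<noteq> 0"
proof -
  define r0 r1 where "r0 = t + k * u" and "r1 = 1 + k + u * u"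
  have N: "norm3 k u 1 = r0 * r0 + u * r0 * r1 + k * r1 * r1"
    by (simp add: norm3_def f0_def r0_def r1_def char2)
  show ?thesis
  proof (cases "r1 = 0")
    case True
    have "r0 \<noteq> 0"
    proof
      assume "r0 = 0"
      then have "t = k * u" by (simp add: r0_def add_eq_0_iff2)
      moreover have "1 + k = u * u" using True by (simp add: r1_def add_eq_0_iff2)
      then have "1 + (1 + k) = 1 + u * u" by (rule arg_cong)
      then have "k = 1 + u * u" by simp
      ultimately show False using no_root[of u] by (simp add: char2)
    qed
    then show ?thesis unfolding N True by simp
  next
    case False
    define s where "s = r0 / r1"
    have r0: "r0 = s * r1" using False by (simp add: s_def)
    have "(s * s + u * s + k) * (s + u) = s * s * s + s + t + (r0 + s * r1)"
      by (simp add: r0_def r1_def char2)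
    then have "(s * s + u * s + k) * (s + u) \<noteq> 0" using no_root by (simp add: r0 add_eq_0_iff2)
    moreover have "norm3 k u 1 = (s * s + u * s + k) * (r1 * r1)" unfolding N r0 by (simp add: char2)
    ultimately show ?thesis using False by auto
  qed
qed

lemma norm3_eq_0_iff [simp]: "norm3 k u v = 0 \<longleftrightarrow> k = 0 \<and> u = 0 \<and> v = 0"
proof -
  consider "v = 0" "u = 0" | "v = 0" "u \<noteq> 0" | "v \<noteq> 0" by blast
  then show ?thesis
  proof cases
    case 2
    define s where "s = k / u"
    have k: "k = s * u" using 2 by (simp add: s_def)
    have "norm3 k u v = (s * s * s + s + t) * (u * u * u)" by (simp add: norm3_def f0_def k 2 char2)
    moreover have "s * s * s + s + t \<noteq> 0" using no_root by (simp add: add_eq_0_iff2)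
    ultimately show ?thesis using 2 by simp
  next
    case 3
    define k' u' where "k' = k / v" and "u' = u / v"
    have "k = k' * v" "u = u' * v" using 3 by (simp_all add: k'_def u'_def)
    then have "norm3 k u v = norm3 k' u' 1 * (v * v * v)" by (simp add: norm3_def f0_def char2)
    then show ?thesis using 3 norm3_nonzero_1 by simp
  qed (auto simp: norm3_def f0_def)
qed

definition ad1 :: "'k \<Rightarrow> 'k \<Rightarrow> 'k \<Rightarrow> 'k" where
  "ad1 k u v = k * k + u * u + t * u * v + v * v"

definition ad2 :: "'k \<Rightarrow> 'k \<Rightarrow> 'k \<Rightarrow> 'k" where
  "ad2 k u v = t * (k * v + u * u + v * v)"

definition ad3 :: "'k \<Rightarrow> 'k \<Rightarrow> 'k \<Rightarrow> 'k" where
  "ad3 k u v = t * (k * u + t * v * v)"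

lemmas norm3_defs = norm3_def f0_def ad1_def ad2_def ad3_def

text \<open>\<open>ovoid\<close> lists the affine points of the ovoid; its remaining point \<open>(0, 0, 0, 0, 1, 0, 0, 0)\<close> is
  perpendicular to all points \<open>extra s g\<close> and is always removed.\<close>

definition ovoid :: "'k \<Rightarrow> 'k \<Rightarrow> 'k \<Rightarrow> 'k vec8" where
  "ovoid k u v = (1, k, u, v, norm3 k u v, ad1 k u v, ad2 k u v, ad3 k u v)"

text \<open>These points lie in a coordinate 4-space orthogonal to the subline
  \<open>ovoid k 0 0\<close>, which explains why all their sections share it. In that 4-space they
  form part of a hyperbolic quadric whose two rulings are given by \<open>s\<close> and
  \<open>g\<close>, so two of them are perpendicular iff they agree in one parameter.\<close>

definition extra :: "'k \<Rightarrow> 'k \<Rightarrow> 'k vec8" where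
  "extra s g = (0, 0, g, 1, 0, 0, s * t, s * t * g)"

definition sect :: "'k \<Rightarrow> 'k \<Rightarrow> 'k \<Rightarrow> 'k \<Rightarrow> 'k \<Rightarrow> 'k" where
  "sect s g k u v = g * ((k + s) * v + u * u + v * v) + (k + s) * u + t * v * v"

lemma q8_ovoid: "q8 (ovoid k u v) = 0"
  by (simp add: ovoid_def norm3_defs char2)

lemma q8_extra: "q8 (extra s g) = 0"
  by (simp add: extra_def char2)

lemma b8_ovoid: "b8 (ovoid k u v) (ovoid k' u' v') = norm3 (k + k') (u + u') (v + v')"
  by (simp add: ovoid_def norm3_defs char2)

lemma b8_extra_ovoid: "b8 (extra s g) (ovoid k u v) = t * sect s g k u v"
  by (simp add: ovoid_def extra_def sect_def norm3_defs char2)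

lemma b8_extra: "b8 (extra s g) (extra s' g') = t * (s + s') * (g + g')"
  by (simp add: extra_def char2)

lemma last8_ovoid: "last8 (ovoid k u v) = t * sect 0 0 k u v"
  by (simp add: ovoid_def sect_def ad3_def)

lemma last8_extra: "last8 (extra s g) = s * t * g"
  by (simp add: extra_def)

definition secs :: "'k \<Rightarrow> 'k \<Rightarrow> ('k \<times> 'k \<times> 'k) set" where
  "secs s g = {(k, u, v). sect s g k u v = 0}"

definition axis :: "('k \<times> 'k \<times> 'k) set" where "axis = {(k, u, v). u = 0 \<and> v = 0}"

definition tau :: "'k \<Rightarrow> 'k" where "tau g = g * g * g + g + t"

lemma tau_nonzero: "tau g \<noteq> 0"
  using no_root[of g] by (simp add: tau_def add_eq_0_iff2)

text \<open>The section is a cone with vertex \<open>(s, 0, 0)\<close>; \<open>u + g v\<close> is the coordinate vanishing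
  only on the axis.\<close>

lemma sect_eq: "sect s g k u v = (k + s) * (u + g * v) + g * ((u + g * v) * (u + g * v)) + tau g * (v * v)"
  by (simp add: sect_def tau_def char2)

lemma secs_iff: "(k, u, v) \<in> secs s g \<longleftrightarrow>
    (k + s) * (u + g * v) = g * ((u + g * v) * (u + g * v)) + tau g * (v * v)"
  unfolding secs_def sect_eq by (simp add: add.assoc add_eq_0_iff2)

lemma finite_triples [simp]: "finite (X :: ('k \<times> 'k \<times> 'k) set)"
  by (rule finite_subset[of _ UNIV]) (simp_all add: finite_Prod_UNIV)

lemma axis_subset_secs: "axis \<subseteq> secs s g"
  by (auto simp: axis_def secs_def sect_def)

lemma secs_off_axis: "(k, u, v) \<in> secs s g \<Longrightarrow> (k, u, v) \<notin> axis \<Longrightarrow> u + g * v \<noteq> 0"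
  using tau_nonzero[of g] unfolding secs_def axis_def sect_eq by (auto simp: add_eq_0_iff2)

lemma card_axis: "card (axis :: ('k \<times> 'k \<times> 'k) set) = card (UNIV :: 'k set)"
proof -
  have eq: "(axis :: ('k \<times> 'k \<times> 'k) set) = (\<lambda>k. (k, 0, 0)) ` UNIV" by (auto simp: axis_def)
  have "card ((\<lambda>k :: 'k. (k, 0 :: 'k, 0 :: 'k)) ` UNIV) = card (UNIV :: 'k set)"
    by (rule card_image) (auto intro: injI)
  then show ?thesis unfolding eq .
qed

lemma card_nonzero: "card (UNIV - {0 :: 'k}) = card (UNIV :: 'k set) - 1"
  by (simp add: card_Diff_subset)

text \<open>Off the axis the equation is linear in \<open>k\<close> with nonzero coefficient
  \<open>y = u + g * v\<close>, so \<open>v\<close> and \<open>y\<close> are free and determine the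
  point.\<close>

lemma card_secs_off_axis: "card (secs s g - axis) = card (UNIV :: 'k set) * (card (UNIV :: 'k set) - 1)"
proof -
  let ?h = "\<lambda>(v, y). (s + g * y + tau g * (v * v) / y, y + g * v, v)"
  have "secs s g - axis = ?h ` (UNIV \<times> (UNIV - {0}))"
  proof
    show "secs s g - axis \<subseteq> ?h ` (UNIV \<times> (UNIV - {0}))"
    proof
      fix x assume x: "x \<in> secs s g - axis"
      obtain k u v where xk: "x = (k, u, v)" by (metis surj_pair)
      define y where "y = u + g * v"
      have y: "y \<noteq> 0" using x secs_off_axis xk by (auto simp: y_def)
      have "(k + s) * y = g * (y * y) + tau g * (v * v)"
        using x xk secs_iff y_def by blast
      then have "k + s = g * y + tau g * (v * v) / y" using y by (simp add: field_simps)
      then have "k = s + g * y + tau g * (v * v) / y" by (metis add.assoc add.commute add_self_left)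
      moreover have "u = y + g * v" by (simp add: y_def add.assoc)
      ultimately have "x = ?h (v, y)" by (simp add: xk)
      then show "x \<in> ?h ` (UNIV \<times> (UNIV - {0}))" using y by blast
    qed
    show "?h ` (UNIV \<times> (UNIV - {0})) \<subseteq> secs s g - axis"
    proof (rule image_subsetI)
      fix p :: "'k \<times> 'k" assume "p \<in> UNIV \<times> (UNIV - {0})"
      then obtain v y where p: "p = (v, y)" and y: "y \<noteq> 0" by blast
      have "(s + g * y + tau g * (v * v) / y + s) * y = g * (y * y) + tau g * (v * v)"
        using y by (simp add: char2)
      then have "sect s g (s + g * y + tau g * (v * v) / y) (y + g * v) v = 0"
        unfolding sect_eq by (simp add: add.assoc)
      then show "?h p \<in> secs s g - axis"
        using y by (auto simp: p secs_def axis_def)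
    qed
  qed
  moreover have "inj_on ?h (UNIV \<times> (UNIV - {0}))" by (auto intro!: inj_onI)
  ultimately show ?thesis by (simp add: card_image card_cartesian_product card_nonzero)
qed

text \<open>This combination eliminates \<open>k\<close>. What remains equates a quadratic form in
  \<open>u, v\<close> with the anisotropic cubic \<open>f0\<close>, so each direction carries at
  most one common point off the axis.\<close>

lemma sect_pair: "(u + g2 * v) * sect s1 g1 k u v + (u + g1 * v) * sect s2 g2 k u v =
    (s1 + s2) * (u + g1 * v) * (u + g2 * v) + (g1 + g2) * f0 u v"
  by (simp add: sect_def f0_def char2)

lemma secs_second:
  assumes "(k, u, v) \<in> secs s1 g1 - axis"
  shows "(k, u, v) \<in> secs s2 g2 \<longleftrightarrow> (g1 + g2) * f0 u v = (s1 + s2) * (u + g1 * v) * (u + g2 * v)"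
proof -
  have "sect s1 g1 k u v = 0" "u + g1 * v \<noteq> 0" using assms secs_off_axis by (auto simp: secs_def)
  then show ?thesis using sect_pair[of u g2 v s1 g1 k s2]
    by (auto simp: secs_def add_eq_0_iff2)
qed

definition ratio :: "'k \<Rightarrow> 'k \<Rightarrow> 'k \<times> 'k \<times> 'k \<Rightarrow> 'k" where
  "ratio g1 g2 = (\<lambda>(k, u, v). (u + g2 * v) / (u + g1 * v))"

text \<open>The ratio encodes the direction of \<open>(u, v)\<close>. It fixes the scale
  \<open>y\<close>, because a cubic is equated with a quadratic, and the first section then fixes
  \<open>k\<close>. Of the q + 1 directions only the zeros of the two linear factors are
  excluded.\<close>

lemma bij_ratio:
  assumes s: "s1 \<noteq> s2" and g: "g1 \<noteq> g2"
  shows "bij_betw (ratio g1 g2) (secs s1 g1 \<inter> secs s2 g2 - axis) (UNIV - {0})"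
proof (rule bij_betwI')
  have s0: "s1 + s2 \<noteq> 0" and g0: "g1 + g2 \<noteq> 0" using s g by (simp_all add: add_eq_0_iff2)
  have fact: "\<exists>y v. y \<noteq> 0 \<and> x = (s1 + g1 * y + tau g1 * (v * v) * y, (1 + g1 * v) * y, v * y)
      \<and> v = (1 + ratio g1 g2 x) / (g1 + g2) \<and> ratio g1 g2 x \<noteq> 0 \<and>
      y * ((g1 + g2) * f0 (1 + g1 * v) v) = (s1 + s2) * ratio g1 g2 x"
    if x: "x \<in> secs s1 g1 \<inter> secs s2 g2 - axis" for x
  proof -
    obtain k u v where xk: "x = (k, u, v)" by (metis surj_pair)
    define y v' where "y = u + g1 * v" and "v' = v / y"
    have y: "y \<noteq> 0" using x secs_off_axis xk by (auto simp: y_def)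
    have y2: "u + g2 * v \<noteq> 0" using x secs_off_axis xk by auto
    have v: "v = v' * y" using y by (simp add: v'_def)
    have "u = y + g1 * v" by (simp add: y_def add.assoc)
    then have u: "u = (1 + g1 * v') * y" by (simp add: v distrib_right mult.assoc)
    have "(k + s1) * y = g1 * (y * y) + tau g1 * (v * v)"
      using x xk secs_iff y_def by blast
    also have "\<dots> = (g1 * y + tau g1 * (v' * v') * y) * y" by (simp add: v char2)
    finally have "k + s1 = g1 * y + tau g1 * (v' * v') * y" using y by simp
    then have k: "k = s1 + g1 * y + tau g1 * (v' * v') * y" by (metis add.assoc add.commute add_self_left)
    have r: "ratio g1 g2 x * y = u + g2 * v" using y by (simp add: ratio_def xk y_def)
    then have r0: "ratio g1 g2 x \<noteq> 0" using y2 by auto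
    have "(1 + ratio g1 g2 x) * y = (g1 + g2) * v' * y"
      unfolding distrib_right[of 1] r by (simp add: u v char2)
    then have "1 + ratio g1 g2 x = (g1 + g2) * v'" using y by (metis mult_right_cancel)
    then have v'r: "v' = (1 + ratio g1 g2 x) / (g1 + g2)" using g0 by (simp add: nonzero_eq_divide_eq mult.commute)
    have "(g1 + g2) * f0 u v = (s1 + s2) * (u + g1 * v) * (u + g2 * v)"
      using secs_second[of k u v s1 g1 s2 g2] x xk by blast
    also have "\<dots> = (s1 + s2) * ratio g1 g2 x * (y * y)" unfolding r[symmetric] y_def[symmetric] by simp
    finally have "(g1 + g2) * f0 u v = (s1 + s2) * ratio g1 g2 x * (y * y)" .
    moreover have "f0 u v = f0 (1 + g1 * v') v' * y * (y * y)" by (simp add: f0_def u v char2)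
    ultimately have "y * ((g1 + g2) * f0 (1 + g1 * v') v') * (y * y) = (s1 + s2) * ratio g1 g2 x * (y * y)"
      by (simp add: ac_simps)
    then have "y * ((g1 + g2) * f0 (1 + g1 * v') v') = (s1 + s2) * ratio g1 g2 x" using y by simp
    then show ?thesis using y k u v v'r r0 xk by blast
  qed
  show "ratio g1 g2 x \<in> UNIV - {0}" if "x \<in> secs s1 g1 \<inter> secs s2 g2 - axis" for x
    using fact[OF that] by blast
  have f0nz: "f0 (1 + g1 * v) v \<noteq> 0" for v by auto
  show "ratio g1 g2 x = ratio g1 g2 x' \<longleftrightarrow> x = x'"
    if x: "x \<in> secs s1 g1 \<inter> secs s2 g2 - axis" and x': "x' \<in> secs s1 g1 \<inter> secs s2 g2 - axis" for x x'
  proof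
    assume eq: "ratio g1 g2 x = ratio g1 g2 x'"
    obtain y v where 1: "x = (s1 + g1 * y + tau g1 * (v * v) * y, (1 + g1 * v) * y, v * y)"
      "v = (1 + ratio g1 g2 x) / (g1 + g2)" "y * ((g1 + g2) * f0 (1 + g1 * v) v) = (s1 + s2) * ratio g1 g2 x"
      using fact[OF x] by blast
    obtain y' v' where 2: "x' = (s1 + g1 * y' + tau g1 * (v' * v') * y', (1 + g1 * v') * y', v' * y')"
      "v' = (1 + ratio g1 g2 x') / (g1 + g2)" "y' * ((g1 + g2) * f0 (1 + g1 * v') v') = (s1 + s2) * ratio g1 g2 x'"
      using fact[OF x'] by blast
    have v: "v' = v" using 1(2) 2(2) unfolding eq by (simp only:)
    have "y * ((g1 + g2) * f0 (1 + g1 * v) v) = y' * ((g1 + g2) * f0 (1 + g1 * v) v)"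
      using 1(3) 2(3) unfolding eq v by (simp only:)
    moreover have "(g1 + g2) * f0 (1 + g1 * v) v \<noteq> 0" using g0 f0nz[of v] by (metis mult_eq_0_iff)
    ultimately have "y = y'" by (metis mult_right_cancel)
    then show "x = x'" using 1(1) 2(1) v by (simp only:)
  qed simp
  show "\<exists>x\<in>secs s1 g1 \<inter> secs s2 g2 - axis. r = ratio g1 g2 x" if "r \<in> UNIV - {0}" for r
  proof -
    define v where "v = (1 + r) / (g1 + g2)"
    define y where "y = (s1 + s2) * r / ((g1 + g2) * f0 (1 + g1 * v) v)"
    have y: "y \<noteq> 0" using that s0 g0 f0nz by (simp add: y_def)
    have ye: "y * ((g1 + g2) * f0 (1 + g1 * v) v) = (s1 + s2) * r" using g0 f0nz by (simp add: y_def)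
    have "(g1 + g2) * v = 1 + r" using g0 by (simp add: v_def)
    then have r: "r = 1 + g1 * v + g2 * v" by (metis add.assoc add_self_left distrib_right)
    define k where "k = s1 + g1 * y + tau g1 * (v * v) * y"
    let ?x = "(k, (1 + g1 * v) * y, v * y)"
    have e1: "(1 + g1 * v) * y + g1 * (v * y) = y" by (simp add: char2)
    have e2: "(1 + g1 * v) * y + g2 * (v * y) = r * y" by (simp add: r char2)
    have "sect s1 g1 k ((1 + g1 * v) * y) (v * y) = 0"
      unfolding sect_eq e1 k_def by (simp add: char2)
    moreover have "?x \<notin> axis" using y e1 by (auto simp: axis_def)
    ultimately have x1: "?x \<in> secs s1 g1 - axis" by (simp add: secs_def)
    have "(g1 + g2) * f0 ((1 + g1 * v) * y) (v * y) = y * ((g1 + g2) * f0 (1 + g1 * v) v) * (y * y)"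
      by (simp add: f0_def char2)
    also have "\<dots> = (s1 + s2) * y * (r * y)" unfolding ye by (simp add: ac_simps)
    finally have "?x \<in> secs s2 g2" unfolding secs_second[OF x1] e1 e2 .
    moreover have "ratio g1 g2 ?x = r" unfolding ratio_def prod.case e1 e2 using y by simp
    ultimately show ?thesis using x1 by blast
  qed
qed

lemma card_pair:
  assumes "s1 \<noteq> s2" "g1 \<noteq> g2"
  shows "card (secs s1 g1 \<inter> secs s2 g2 - axis) = card (UNIV :: 'k set) - 1"
  using bij_betw_same_card[OF bij_ratio[OF assms]] by (simp add: card_nonzero)

text \<open>Comparing the relation between the first and second section with that between the first
  and third eliminates \<open>f0\<close>; the rest is linear in the ratio and has the single
  solution \<open>r0\<close>.\<close>

lemma card_triple:
  assumes s: "s1 \<noteq> s2" "s1 \<noteq> s3" "s2 \<noteq> s3" and g: "g1 \<noteq> g2" "g1 \<noteq> g3" "g2 \<noteq> g3"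
  shows "card (secs s1 g1 \<inter> secs s2 g2 \<inter> secs s3 g3 - axis) = 1"
proof -
  have nz: "s1 + s2 \<noteq> 0" "s1 + s3 \<noteq> 0" "s2 + s3 \<noteq> 0" "g1 + g2 \<noteq> 0" "g1 + g3 \<noteq> 0" "g2 + g3 \<noteq> 0"
    using s g by (simp_all add: add_eq_0_iff2)
  define r0 where "r0 = (s1 + s3) * (g2 + g3) / ((s2 + s3) * (g1 + g3))"
  have r0: "r0 \<noteq> 0" using nz by (simp add: r0_def)
  let ?E = "secs s1 g1 \<inter> secs s2 g2 - axis"
  have iff: "x \<in> secs s3 g3 \<longleftrightarrow> ratio g1 g2 x = r0" if x: "x \<in> ?E" for x
  proof -
    obtain k u v where xk: "x = (k, u, v)" by (metis surj_pair)
    define y1 y2 y3 where "y1 = u + g1 * v" and "y2 = u + g2 * v" and "y3 = u + g3 * v"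
    have y: "y1 \<noteq> 0" "y2 \<noteq> 0" using x secs_off_axis xk by (auto simp: y1_def y2_def)
    have f12: "(g1 + g2) * f0 u v = (s1 + s2) * y1 * y2"
      using secs_second[of k u v s1 g1 s2 g2] x xk by (simp add: y1_def y2_def)
    have "x \<in> secs s3 g3 \<longleftrightarrow> (g1 + g3) * f0 u v = (s1 + s3) * y1 * y3"
      using secs_second[of k u v s1 g1 s3 g3] x xk by (simp add: y1_def y3_def)
    also have "\<dots> \<longleftrightarrow> (g1 + g3) * ((g1 + g2) * f0 u v) = (g1 + g2) * ((s1 + s3) * y1 * y3)"
      using nz by (metis (no_types, lifting) mult.left_commute mult_left_cancel)
    also have "\<dots> \<longleftrightarrow> y1 * ((g1 + g3) * (s1 + s2) * y2) = y1 * ((s1 + s3) * ((g1 + g2) * y3))"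
      unfolding f12 by (simp add: ac_simps)
    also have "\<dots> \<longleftrightarrow> (g1 + g3) * (s1 + s2) * y2 = (s1 + s3) * ((g1 + g2) * y3)"
      using y by simp
    also have "(g1 + g2) * y3 = (g2 + g3) * y1 + (g1 + g3) * y2"
      by (simp add: y1_def y2_def y3_def char2)
    also have "(g1 + g3) * (s1 + s2) * y2 = (s1 + s3) * ((g2 + g3) * y1 + (g1 + g3) * y2) \<longleftrightarrow>
        (g1 + g3) * (s1 + s2) * y2 + (s1 + s3) * ((g2 + g3) * y1 + (g1 + g3) * y2) = 0"
      by (simp only: add_eq_0_iff2)
    also have "(g1 + g3) * (s1 + s2) * y2 + (s1 + s3) * ((g2 + g3) * y1 + (g1 + g3) * y2) =
        (s2 + s3) * (g1 + g3) * y2 + (s1 + s3) * (g2 + g3) * y1"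
      by (simp add: char2)
    also have "\<dots> = 0 \<longleftrightarrow> y2 / y1 = r0"
      unfolding add_eq_0_iff2 r0_def using y nz by (simp add: divide_simps ac_simps)
    finally show ?thesis by (simp add: ratio_def xk y1_def y2_def)
  qed
  have bij: "bij_betw (ratio g1 g2) ?E (UNIV - {0})" by (rule bij_ratio[OF s(1) g(1)])
  then obtain x where x: "x \<in> ?E" "ratio g1 g2 x = r0" using r0 unfolding bij_betw_def by (metis DiffI UNIV_I imageE singletonD)
  have "secs s1 g1 \<inter> secs s2 g2 \<inter> secs s3 g3 - axis = {x}"
  proof
    show "secs s1 g1 \<inter> secs s2 g2 \<inter> secs s3 g3 - axis \<subseteq> {x}"
      using iff x bij unfolding bij_betw_def inj_on_def by blast
    show "{x} \<subseteq> secs s1 g1 \<inter> secs s2 g2 \<inter> secs s3 g3 - axis" using iff x by blast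
  qed
  then show ?thesis by simp
qed

end

section \<open>Maximality of the derived partial ovoids\<close>

context cubic_extension
begin

lemma card_triples: "card (UNIV :: ('k \<times> 'k \<times> 'k) set) = card (UNIV :: 'k set) ^ 3"
  by (simp add: card_cartesian_product power3_eq_cube flip: UNIV_Times_UNIV)

lemma card_field_pos: "card (UNIV :: 'k set) > 0"
  by (simp add: finite_UNIV_card_ge_0)

text \<open>The hypothesis says that \<open>S\<close> meets every line in direction \<open>(w1, w2, w3)\<close>.\<close>

lemma card_transversal:
  fixes S :: "('k \<times> 'k \<times> 'k) set"
  assumes "\<And>k u v. (k + G k u v * w1, u + G k u v * w2, v + G k u v * w3) \<in> S"
  shows "card (UNIV :: 'k set) ^ 2 \<le> card S"
proof -
  let ?f = "\<lambda>((k, u, v), l). (k + l * w1, u + l * w2, v + l * w3)"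
  have "(UNIV :: ('k \<times> 'k \<times> 'k) set) \<subseteq> ?f ` (S \<times> UNIV)"
  proof
    fix x :: "'k \<times> 'k \<times> 'k"
    obtain k u v where x: "x = (k, u, v)" by (metis surj_pair)
    have "x = ?f ((k + G k u v * w1, u + G k u v * w2, v + G k u v * w3), G k u v)"
      by (simp add: x add.assoc)
    then show "x \<in> ?f ` (S \<times> UNIV)" using assms[of k u v] by blast
  qed
  then have "card (UNIV :: ('k \<times> 'k \<times> 'k) set) \<le> card (S \<times> (UNIV :: 'k set))"
    by (intro surj_card_le) (auto simp: finite_cartesian_product)
  then have "card (UNIV :: 'k set) * card (UNIV :: 'k set) ^ 2 \<le> card (UNIV :: 'k set) * card S"
    by (simp add: card_triples card_cartesian_product power3_eq_cube power2_eq_square mult.commute)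
  then show ?thesis using card_field_pos by simp
qed

definition zeros :: "'k vec8 \<Rightarrow> ('k \<times> 'k \<times> 'k) set" where
  "zeros z = {(k, u, v). b8 z (ovoid k u v) = 0}"

text \<open>At affine ovoid points the polar form with \<open>z\<close> is a polynomial of degree 3,
  2 or 1. In the cubic case a translation removes the quadratic terms and singularity of
  \<open>z\<close> the constant one; if the linear part also vanishes, \<open>z\<close> is a
  multiple of an ovoid point. In the quadratic case singularity removes the linear term along
  \<open>(zk, zu, zv)\<close>. Only square roots remain to be taken.\<close>

lemma zeros_lower:
  assumes "q8 z = 0" "last8 z \<noteq> 0"
  shows "(\<exists>c k u v. \<forall>y. b8 z y = c * b8 (ovoid k u v) y) \<or> card (UNIV :: 'k set) ^ 2 \<le> card (zeros z)"
proof -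
  obtain z0 zk zu zv zd ck cu cv where z: "z = (z0, zk, zu, zv, zd, ck, cu, cv)" by (metis surj_pair)
  have Q: "z0 * zd + zk * ck + zu * cu + zv * cv = 0" and cv: "cv \<noteq> 0" using assms by (simp_all add: z)
  define H where "H k u v = z0 * norm3 k u v + zk * ad1 k u v + zu * ad2 k u v + zv * ad3 k u v
    + zd + ck * k + cu * u + cv * v" for k u v
  have H: "b8 z (ovoid k u v) = H k u v" for k u v
    by (simp add: z ovoid_def H_def ac_simps)
  consider "z0 \<noteq> 0" | "z0 = 0" "\<not> (zk = 0 \<and> zu = 0 \<and> zv = 0)" | "z0 = 0" "zk = 0" "zu = 0" "zv = 0" by blast
  then show ?thesis
  proof cases
    case 1
    define k0 u0 v0 where "k0 = zk / z0" and "u0 = zu / z0" and "v0 = zv / z0"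
    have zs: "zk = z0 * k0" "zu = z0 * u0" "zv = z0 * v0" using 1 by (simp_all add: k0_def u0_def v0_def)
    define dk du dv where "dk = ck / z0 + ad1 k0 u0 v0" and "du = cu / z0 + ad2 k0 u0 v0" and "dv = cv / z0 + ad3 k0 u0 v0"
    have cs: "ck = z0 * (dk + ad1 k0 u0 v0)" "cu = z0 * (du + ad2 k0 u0 v0)" "cv = z0 * (dv + ad3 k0 u0 v0)"
      using 1 by (simp_all add: dk_def du_def dv_def add.assoc)
    have "z0 * zd = z0 * (k0 * ck + u0 * cu + v0 * cv)"
      using Q by (simp add: zs add_eq_0_iff2 add.assoc distrib_left mult.assoc)
    then have "zd = k0 * ck + u0 * cu + v0 * cv" using 1 by simp
    also have "\<dots> = z0 * (k0 * dk + u0 * du + v0 * dv + norm3 k0 u0 v0)"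
      unfolding cs by (simp add: norm3_defs char2)
    finally have zde: "zd = z0 * (k0 * dk + u0 * du + v0 * dv + norm3 k0 u0 v0)" .
    have Hs: "H (k0 + k) (u0 + u) (v0 + v) = z0 * (norm3 k u v + (dk * k + du * u + dv * v))" for k u v
      unfolding H_def zs cs zde by (simp add: norm3_defs char2)
    show ?thesis
    proof (cases "dk = 0 \<and> du = 0 \<and> dv = 0")
      case True
      then have zz: "z = (z0, z0 * k0, z0 * u0, z0 * v0, z0 * norm3 k0 u0 v0, z0 * ad1 k0 u0 v0, z0 * ad2 k0 u0 v0, z0 * ad3 k0 u0 v0)"
        unfolding z zs cs zde by simp
      have "b8 z y = z0 * b8 (ovoid k0 u0 v0) y" for y
      proof -
        obtain y1 y2 y3 y4 y5 y6 y7 y8 where y: "y = (y1, y2, y3, y4, y5, y6, y7, y8)" by (metis surj_pair)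
        show ?thesis by (simp add: y zz ovoid_def distrib_left ac_simps)
      qed
      then show ?thesis by blast
    next
      case False
      have "\<exists>w1 w2 w3. dk * w1 + du * w2 + dv * w3 = 1"
      proof -
        consider "dk \<noteq> 0" | "du \<noteq> 0" | "dv \<noteq> 0" using False by blast
        then show ?thesis
        proof cases
          case 1 then show ?thesis by (intro exI[of _ "1 / dk"] exI[of _ 0]) simp
        next
          case 2 then show ?thesis by (intro exI[of _ 0] exI[of _ "1 / du"] exI[of _ 0]) simp
        next
          case 3 then show ?thesis by (intro exI[of _ 0] exI[of _ "1 / dv"]) simp
        qed
      qed
      then obtain w1 w2 w3 where w: "dk * w1 + du * w2 + dv * w3 = 1" by blast
      define W where "W = {(k, u, v). dk * k + du * u + dv * v = 1}"
      have "card (UNIV :: 'k set) ^ 2 \<le> card W"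
      proof (rule card_transversal)
        fix k u v
        let ?G = "dk * k + du * u + dv * v + 1"
        have "dk * (k + ?G * w1) + du * (u + ?G * w2) + dv * (v + ?G * w3)
          = dk * k + du * u + dv * v + ?G * (dk * w1 + du * w2 + dv * w3)"
          by (simp only: distrib_left distrib_right ac_simps)
        also have "\<dots> = 1" unfolding w by (simp add: add.assoc)
        finally show "(k + ?G * w1, u + ?G * w2, v + ?G * w3) \<in> W" by (simp add: W_def)
      qed
      also have "card W \<le> card (zeros z)"
      proof -
        \<comment> \<open>Scaling a vector of \<open>W\<close> by \<open>l\<close> multiplies its
          norm by \<open>l * l * l\<close> and its linear value 1 by \<open>l\<close>. The choice of
          \<open>l\<close> makes the two equal, so they cancel. Multiples of different vectors of
          \<open>W\<close> are different because the linear form recovers \<open>l\<close>.\<close>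
        define l where "l = (\<lambda>(k, u, v). 1 / rt (norm3 k u v))"
        define h where "h = (\<lambda>(k, u, v). (k0 + l (k, u, v) * k, u0 + l (k, u, v) * u, v0 + l (k, u, v) * v))"
        have nz: "norm3 k u v \<noteq> 0" if "(k, u, v) \<in> W" for k u v using that by (auto simp: W_def)
        have rtnz: "rt (norm3 k u v) \<noteq> 0" if "(k, u, v) \<in> W" for k u v
          using nz[OF that] by (metis mult_zero_left rt_square)
        have lsq: "l (k, u, v) * l (k, u, v) * norm3 k u v = 1" if "(k, u, v) \<in> W" for k u v
          using rtnz[OF that] nz[OF that] by (simp add: l_def)
        have "inj_on h W"
        proof (rule inj_onI)
          fix x x' assume x: "x \<in> W" "x' \<in> W" and eq: "h x = h x'"
          obtain k u v k' u' v' where xk: "x = (k, u, v)" "x' = (k', u', v')" by (metis surj_pair)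
          have e: "l x * k = l x' * k'" "l x * u = l x' * u'" "l x * v = l x' * v'"
            using eq by (simp_all add: h_def xk)
          have dx: "dk * k + du * u + dv * v = 1" "dk * k' + du * u' + dv * v' = 1"
            using x by (simp_all add: xk W_def)
          have "l x * (dk * k + du * u + dv * v) = dk * (l x * k) + du * (l x * u) + dv * (l x * v)"
            by (simp add: distrib_left ac_simps)
          also have "\<dots> = l x' * (dk * k' + du * u' + dv * v')" unfolding e by (simp add: distrib_left ac_simps)
          finally have "l x = l x'" unfolding dx by simp
          moreover have "l x' \<noteq> 0" using lsq[of k' u' v'] x xk by auto
          ultimately show "x = x'" using e unfolding xk by simp
        qed
        moreover have "h ` W \<subseteq> zeros z"
        proof (rule image_subsetI)
          fix x assume x: "x \<in> W"
          obtain k u v where xk: "x = (k, u, v)" by (metis surj_pair)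
          let ?l = "l (k, u, v)"
          have dx: "dk * k + du * u + dv * v = 1" using x by (simp add: xk W_def)
          have "H (k0 + ?l * k) (u0 + ?l * u) (v0 + ?l * v) =
              z0 * (?l * (?l * ?l * norm3 k u v + (dk * k + du * u + dv * v)))"
            unfolding Hs by (simp add: norm3_defs char2)
          also have "\<dots> = 0" using lsq x unfolding xk dx by simp
          finally show "h x \<in> zeros z" by (simp add: zeros_def h_def xk H)
        qed
        ultimately show ?thesis by (intro card_inj_on_le) auto
      qed
      finally show ?thesis by blast
    qed
  next
    case 2
    let ?N = "norm3 zk zu zv"
    have N: "?N \<noteq> 0" using 2 by simp
    have cw: "zk * ck + zu * cu + zv * cv = 0" using Q 2 by simp
    have Hs: "H (k + l * zk) (u + l * zu) (v + l * zv) = H k u v + (l * l) * ?N + l * (zk * ck + zu * cu + zv * cv)" for k u v l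
      unfolding H_def 2(1) by (simp add: norm3_defs char2)
    have "card (UNIV :: 'k set) ^ 2 \<le> card (zeros z)"
    proof (rule card_transversal)
      fix k u v
      let ?l = "rt (H k u v / ?N)"
      have "H (k + ?l * zk) (u + ?l * zu) (v + ?l * zv) = 0"
        unfolding Hs cw rt_square using N by simp
      then show "(k + ?l * zk, u + ?l * zu, v + ?l * zv) \<in> zeros z" by (simp add: zeros_def H)
    qed
    then show ?thesis by blast
  next
    case 3
    have "card (UNIV :: 'k set) ^ 2 \<le> card (zeros z)"
    proof (rule card_transversal)
      fix k u v
      have "H (k + H k u v * 0) (u + H k u v * 0) (v + H k u v * (1 / cv)) = H k u v + H k u v"
        using cv by (simp add: H_def 3 distrib_left ac_simps)
      then show "(k + H k u v * 0, u + H k u v * 0, v + H k u v * (1 / cv)) \<in> zeros z" by (simp add: zeros_def H)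
    qed
    then show ?thesis by blast
  qed
qed

text \<open>The section is covered by q + 1 generators through the vertex, and on each of them the
  equation of \<open>z\<close> is at most cubic. If the vertex is not a zero, there are at most
  three zeros per generator. If it is, each generator has at most two further zeros for
  \<open>z0 \<noteq> 0\<close>, and at most one for \<open>z0 = 0\<close> apart from at most two
  exceptional generators.\<close>

lemma zeros_secs_upper:
  assumes "b8 z (extra s g) \<noteq> 0"
  shows "card (secs s g \<inter> zeros z) \<le> 3 * card (UNIV :: 'k set) + 3"
proof -
  obtain z0 zk zu zv zd ck cu cv where z: "z = (z0, zk, zu, zv, zd, ck, cu, cv)" by (metis surj_pair)
  define c1 c2 where "c1 = t * s * zv + cu" and "c2 = t * s * zu + cv"
  define b where "b = g * c1 + c2"
  have b: "b \<noteq> 0" using assms by (simp add: z extra_def b_def c1_def c2_def char2)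
  \<comment> \<open>Directions of the generators: \<open>None\<close> is the axis, and
    \<open>Some v\<close> is normalised by \<open>u + g * v = 1\<close>.\<close>
  define d1 d2 d3 where "d1 p = (case p of None \<Rightarrow> 1 | Some v \<Rightarrow> g + tau g * (v * v))"
    and "d2 p = (case p of None \<Rightarrow> 0 | Some v \<Rightarrow> g * v + 1)"
    and "d3 p = (case p of None \<Rightarrow> 0 | Some v \<Rightarrow> v)" for p :: "'k option"
  define e3 e2 e1 where "e3 p = z0 * norm3 (d1 p) (d2 p) (d3 p)"
    and "e2 p = (z0 * s + zk) * ad1 (d1 p) (d2 p) (d3 p) + zu * ad2 (d1 p) (d2 p) (d3 p) + zv * ad3 (d1 p) (d2 p) (d3 p)"
    and "e1 p = (z0 * s * s + ck) * d1 p + c1 * d2 p + c2 * d3 p" for p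
  define e0 where "e0 = z0 * (s * s * s) + zk * (s * s) + ck * s + zd"
  define pt where "pt p x = (s + x * d1 p, x * d2 p, x * d3 p)" for p x
  have Hpt: "pt p x \<in> zeros z \<longleftrightarrow> e0 + x * e1 p + x * x * e2 p + x * x * x * e3 p = 0" for p x
  proof -
    have "b8 z (ovoid (s + x * d1 p) (x * d2 p) (x * d3 p)) = e0 + x * e1 p + x * x * e2 p + x * x * x * e3 p"
      by (simp add: z ovoid_def e0_def e1_def e2_def e3_def c1_def c2_def norm3_defs char2)
    then show ?thesis by (simp add: zeros_def pt_def)
  qed
  have param: "\<exists>p x. y = pt p x" if "y \<in> secs s g" for y
  proof -
    obtain k u v where y: "y = (k, u, v)" by (metis surj_pair)
    define w where "w = u + g * v"
    have eq: "(k + s) * w = g * (w * w) + tau g * (v * v)" using that by (simp add: y secs_iff w_def)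
    have u: "u = w + g * v" by (simp add: w_def add.assoc)
    show ?thesis
    proof (cases "w = 0")
      case True
      then have "v = 0" using eq tau_nonzero by simp
      then have "y = pt None (k + s)" using u True by (simp add: y pt_def d1_def d2_def d3_def add.left_commute[of s])
      then show ?thesis by blast
    next
      case False
      define v' where "v' = v / w"
      have v: "v = w * v'" using False by (simp add: v'_def)
      have "(k + s) * w = (w * (g + tau g * (v' * v'))) * w" unfolding eq by (simp add: v char2)
      then have "k + s = w * (g + tau g * (v' * v'))" using False by simp
      then have "k = s + w * (g + tau g * (v' * v'))" by (metis add.commute add_self_left)
      then have "y = pt (Some v') w" by (simp add: y pt_def d1_def d2_def d3_def u v distrib_left ac_simps)
      then show ?thesis by blast
    qed
  qed
  have cardopt: "card (UNIV :: 'k option set) = card (UNIV :: 'k set) + 1"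
    by (simp add: UNIV_option_conv card_image)
  have finopt: "finite (UNIV :: 'k option set)" by simp
  have bound: "card (X :: ('k \<times> 'k \<times> 'k) set) \<le> (\<Sum>p\<in>UNIV. card (R p))" if "X \<subseteq> (\<Union>p\<in>UNIV. pt p ` R p)" for X R
  proof -
    have "card X \<le> card (\<Union>p\<in>UNIV. pt p ` R p)" using that by (intro card_mono) auto
    also have "\<dots> \<le> (\<Sum>p\<in>UNIV. card (pt p ` R p))" by (rule card_UN_le[OF finopt])
    also have "\<dots> \<le> (\<Sum>p\<in>UNIV. card (R p))" by (intro sum_mono card_image_le) simp
    finally show ?thesis .
  qed
  show ?thesis
  proof (cases "e0 = 0")
    case False
    define R where "R p = {x. e0 + x * e1 p + x * x * e2 p + x * x * x * e3 p = 0}" for p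
    have "card (R p) \<le> 3" for p
    proof -
      let ?p = "[:e0, e1 p, e2 p, e3 p:]"
      have "?p \<noteq> 0" using False by simp
      then have "card {x. poly ?p x = 0} \<le> degree ?p" by (rule card_poly_roots_bound)
      also have "\<dots> \<le> 3" by simp
      also have "{x. poly ?p x = 0} = R p" by (simp add: R_def distrib_left mult.assoc add.assoc)
      finally show ?thesis .
    qed
    moreover have "secs s g \<inter> zeros z \<subseteq> (\<Union>p\<in>UNIV. pt p ` R p)"
      using param Hpt by (fastforce simp: R_def)
    ultimately have "card (secs s g \<inter> zeros z) \<le> (\<Sum>p\<in>(UNIV :: 'k option set). 3)"
      by (intro order_trans[OF bound] sum_mono)
    then show ?thesis by (simp add: cardopt)
  next
    case e0: True
    define R where "R p = {x. x \<noteq> 0 \<and> e1 p + x * e2 p + x * x * e3 p = 0}" for p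
    have "secs s g \<inter> zeros z - {(s, 0, 0)} \<subseteq> (\<Union>p\<in>UNIV. pt p ` R p)"
    proof
      fix y assume y: "y \<in> secs s g \<inter> zeros z - {(s, 0, 0)}"
      then obtain p x where px: "y = pt p x" using param by blast
      then have "x \<noteq> 0" using y by (auto simp: pt_def)
      have "e0 + x * e1 p + x * x * e2 p + x * x * x * e3 p = 0" using Hpt y px by blast
      then have "x * (e1 p + x * e2 p + x * x * e3 p) = 0" by (simp add: e0 distrib_left mult.assoc)
      then have "x \<in> R p" using \<open>x \<noteq> 0\<close> by (simp add: R_def)
      then show "y \<in> (\<Union>p\<in>UNIV. pt p ` R p)" using px by blast
    qed
    then have "card (secs s g \<inter> zeros z - {(s, 0, 0)}) \<le> (\<Sum>p\<in>UNIV. card (R p))" by (rule bound)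
    moreover have "card (secs s g \<inter> zeros z) \<le> card (insert (s, 0, 0) (secs s g \<inter> zeros z - {(s, 0, 0)}))"
      by (intro card_mono) auto
    ultimately have le: "card (secs s g \<inter> zeros z) \<le> (\<Sum>p\<in>UNIV. card (R p)) + 1"
      by (simp add: card_insert_if split: if_splits)
    show ?thesis
    proof (cases "z0 = 0")
      case False
      have "card (R p) \<le> 2" for p
      proof -
        let ?p = "[:e1 p, e2 p, e3 p:]"
        have "norm3 (d1 p) (d2 p) (d3 p) \<noteq> 0" by (cases p) (auto simp: d1_def d2_def d3_def)
        then have "e3 p \<noteq> 0" using False by (simp add: e3_def)
        then have "card {x. poly ?p x = 0} \<le> 2" by (intro card_roots_le) (simp_all add: numeral_2_eq_2)
        moreover have "R p \<subseteq> {x. poly ?p x = 0}" by (auto simp: R_def distrib_left mult.assoc add.assoc)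
        ultimately show ?thesis by (meson card_mono finite_set order_trans)
      qed
      then have "(\<Sum>p\<in>UNIV. card (R p)) \<le> (\<Sum>p\<in>(UNIV :: 'k option set). 2)" by (intro sum_mono)
      then show ?thesis using le by (simp add: cardopt)
    next
      case True
      have e3: "e3 p = 0" for p by (simp add: e3_def True)
      \<comment> \<open>A generator with vanishing linear coefficient may consist of zeros only. As
        a polynomial in the direction, \<open>e1\<close> has middle coefficient \<open>b\<close>,
        which is the value assumed nonzero in the hypothesis, so at most two generators are of this
        kind.\<close>
      define bad where "bad = {p. e1 p = 0}"
      have R1: "card (R p) \<le> 1 + (if p \<in> bad then card (UNIV :: 'k set) - 1 else 0)" for p
      proof (cases "p \<in> bad")
        case True
        have "card (R p) \<le> card (UNIV :: 'k set)" by (intro card_mono) auto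
        then show ?thesis using True by simp
      next
        case False
        then have "card {x. poly [:e1 p, e2 p:] x = 0} \<le> degree [:e1 p, e2 p:]"
          by (intro card_poly_roots_bound) (simp add: bad_def)
        also have "\<dots> \<le> 1" by simp
        also have "{x. poly [:e1 p, e2 p:] x = 0} = {x. e1 p + x * e2 p = 0}" by simp
        finally have "card {x. e1 p + x * e2 p = 0} \<le> 1" .
        moreover have "R p \<subseteq> {x. e1 p + x * e2 p = 0}" by (auto simp: R_def e3)
        ultimately have "card (R p) \<le> 1" by (meson card_mono finite_set order_trans)
        then show ?thesis using False by simp
      qed
      let ?B = "{v. poly [:ck * g + c1, b, ck * tau g:] v = 0}"
      have e1s: "e1 (Some v) = poly [:ck * g + c1, b, ck * tau g:] v" for v
        by (simp add: e1_def d1_def d2_def d3_def True b_def char2)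
      have "card bad \<le> 2"
      proof (cases "ck = 0")
        case True
        have "card ?B \<le> 1" using True b by (intro card_roots_le) simp_all
        moreover have "bad \<subseteq> insert None (Some ` ?B)"
        proof
          fix p assume "p \<in> bad"
          then show "p \<in> insert None (Some ` ?B)" using e1s by (cases p) (auto simp: bad_def)
        qed
        then have "card bad \<le> card (insert None (Some ` ?B))" by (intro card_mono) auto
        ultimately show ?thesis by (simp add: card_insert_if card_image split: if_splits)
      next
        case False
        have "card ?B \<le> 2" using False tau_nonzero by (intro card_roots_le) (simp_all add: numeral_2_eq_2)
        moreover have "bad \<subseteq> Some ` ?B"
        proof
          fix p assume p: "p \<in> bad"
          have "e1 None = ck" by (simp add: e1_def d1_def d2_def d3_def \<open>z0 = 0\<close>)
          then show "p \<in> Some ` ?B" using e1s p False by (cases p) (auto simp: bad_def)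
        qed
        then have "card bad \<le> card (Some ` ?B)" by (intro card_mono) auto
        ultimately show ?thesis by (simp add: card_image)
      qed
      have "(\<Sum>p\<in>UNIV. card (R p)) \<le> (\<Sum>p\<in>UNIV. 1 + (if p \<in> bad then card (UNIV :: 'k set) - 1 else 0))"
        by (intro sum_mono R1)
      also have "\<dots> = card (UNIV :: 'k set) + 1 + card bad * (card (UNIV :: 'k set) - 1)"
        by (subst sum.distrib) (simp add: cardopt sum.If_cases)
      also have "\<dots> \<le> card (UNIV :: 'k set) + 1 + 2 * (card (UNIV :: 'k set) - 1)"
        using \<open>card bad \<le> 2\<close> by (intro add_left_mono mult_right_mono) auto
      finally show ?thesis using le by linarith
    qed
  qed
qed


text \<open>By the formula \<open>b8_extra\<close> this makes the points \<open>extra\<close> with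
  these parameters pairwise nonperpendicular.\<close>

definition general_pairs :: "('k \<times> 'k) set \<Rightarrow> bool" where
  "general_pairs I \<longleftrightarrow> (\<forall>i\<in>I. \<forall>j\<in>I. i \<noteq> j \<longrightarrow> fst i \<noteq> fst j \<and> snd i \<noteq> snd j)"

definition union_secs :: "('k \<times> 'k) set \<Rightarrow> ('k \<times> 'k \<times> 'k) set" where
  "union_secs I = (\<Union>i\<in>I. secs (fst i) (snd i))"

text \<open>The point \<open>extra 0 0\<close> is left out because it is the point at infinity of the chart.\<close>

definition derived :: "('k \<times> 'k) set \<Rightarrow> 'k vec8 set" where
  "derived I = (\<lambda>(k, u, v). ovoid k u v) ` (- union_secs I) \<union> (\<lambda>i. extra (fst i) (snd i)) ` (I - {(0, 0)})"

lemma finite_pairs [simp]: "finite (I :: ('k \<times> 'k) set)"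
  by (rule finite_subset[of _ UNIV]) (simp_all add: finite_Prod_UNIV)

lemma b8_commute: "b8 x y = b8 y x"
proof -
  obtain a1 a2 a3 a4 c1 c2 c3 c4 b1 b2 b3 b4 d1 d2 d3 d4
    where "x = (a1, a2, a3, a4, c1, c2, c3, c4)" "y = (b1, b2, b3, b4, d1, d2, d3, d4)" by (metis surj_pair)
  then show ?thesis by (simp add: ac_simps)
qed

lemma derived_cases:
  assumes "x \<in> derived I"
  obtains k u v where "x = ovoid k u v" "(k, u, v) \<notin> union_secs I"
  | s g where "x = extra s g" "(s, g) \<in> I" "(s, g) \<noteq> (0, 0)"
proof -
  consider p where "p \<notin> union_secs I" "x = (\<lambda>(k, u, v). ovoid k u v) p"
    | i where "i \<in> I" "i \<noteq> (0, 0)" "x = extra (fst i) (snd i)"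
    using assms unfolding derived_def by blast
  then show ?thesis
  proof cases
    case (1 p)
    obtain k u v where "p = (k, u, v)" by (metis surj_pair)
    then show ?thesis using 1 that(1) by simp
  next
    case (2 i)
    then show ?thesis using that(2)[of "fst i" "snd i"] by simp
  qed
qed

lemma not_in_union_secs:
  "(k, u, v) \<notin> union_secs I \<longleftrightarrow> (\<forall>s g. (s, g) \<in> I \<longrightarrow> b8 (extra s g) (ovoid k u v) \<noteq> 0)"
  unfolding union_secs_def b8_extra_ovoid using t_nonzero by (auto simp: secs_def)

lemma derived_singular:
  assumes I: "general_pairs I" "(0, 0) \<in> I" and x: "x \<in> derived I"
  shows "q8 x = 0 \<and> last8 x \<noteq> 0"
  using x
proof (cases rule: derived_cases)
  case (1 k u v)
  then have "b8 (extra 0 0) (ovoid k u v) \<noteq> 0" using I(2) not_in_union_secs by blast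
  then show ?thesis using 1 by (simp add: q8_ovoid last8_ovoid b8_extra_ovoid)
next
  case (2 s g)
  then have "s \<noteq> 0" "g \<noteq> 0" using I unfolding general_pairs_def by force+
  then show ?thesis using 2 t_nonzero by (simp add: q8_extra last8_extra)
qed

lemma derived_clique:
  assumes I: "general_pairs I" and xy: "x \<in> derived I" "y \<in> derived I" "x \<noteq> y"
  shows "b8 x y \<noteq> 0"
  using xy(1)
proof (cases rule: derived_cases)
  case x: (1 k u v)
  show ?thesis using xy(2)
  proof (cases rule: derived_cases)
    case (1 k' u' v')
    then show ?thesis using x xy(3) by (auto simp: b8_ovoid add_eq_0_iff2)
  next
    case (2 s g)
    then show ?thesis using x not_in_union_secs b8_commute by metis
  qed
next
  case x: (2 s g)
  show ?thesis using xy(2)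
  proof (cases rule: derived_cases)
    case (1 k u v)
    then show ?thesis using x not_in_union_secs by metis
  next
    case (2 s' g')
    then have "(s, g) \<noteq> (s', g')" using x xy(3) by auto
    then have "s \<noteq> s'" "g \<noteq> g'" using I x 2 unfolding general_pairs_def by force+
    then show ?thesis using x 2 t_nonzero by (simp add: b8_extra add_eq_0_iff2)
  qed
qed

text \<open>A counterexample proportional to an ovoid point would come from a point on no removed
  section, hence from a member of the set, to which it is perpendicular. For any other
  counterexample the lower bound for its zeros exceeds what the removed sections can hold.\<close>

lemma derived_maximal:
  assumes I: "(0, 0) \<in> I" "card I * (3 * card (UNIV :: 'k set) + 3) < card (UNIV :: 'k set) ^ 2"
    and z: "q8 z = 0" "last8 z \<noteq> 0"
  shows "\<exists>x\<in>derived I. b8 z x = 0"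
proof (rule ccontr)
  assume no: "\<not> ?thesis"
  have ex: "b8 z (extra s g) \<noteq> 0" if "(s, g) \<in> I" for s g
  proof (cases "(s, g) = (0, 0)")
    case True
    \<comment> \<open>\<open>extra 0 0\<close> is not in \<open>derived I\<close>;
      nonperpendicularity to it is the condition that \<open>z\<close> lies in the chart.\<close>
    obtain a1 a2 a3 a4 c1 c2 c3 c4 where "z = (a1, a2, a3, a4, c1, c2, c3, c4)" by (metis surj_pair)
    then show ?thesis using True z(2) by (simp add: extra_def)
  next
    case False
    then have "extra s g \<in> derived I" using that unfolding derived_def
      by (intro UnI2 image_eqI[of _ _ "(s, g)"]) simp_all
    then show ?thesis using no by blast
  qed
  have ov: "b8 z (ovoid k u v) \<noteq> 0" if "(k, u, v) \<notin> union_secs I" for k u v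
  proof -
    have "ovoid k u v \<in> derived I" using that unfolding derived_def
      by (intro UnI1 image_eqI[of _ _ "(k, u, v)"]) simp_all
    then show ?thesis using no by blast
  qed
  from zeros_lower[OF z] show False
  proof
    assume "\<exists>c k u v. \<forall>y. b8 z y = c * b8 (ovoid k u v) y"
    then obtain c k u v where c: "\<And>y. b8 z y = c * b8 (ovoid k u v) y" by blast
    have "b8 (extra s g) (ovoid k u v) \<noteq> 0" if "(s, g) \<in> I" for s g
      using ex[OF that] unfolding c by (simp add: b8_commute)
    then have "(k, u, v) \<notin> union_secs I" using not_in_union_secs by blast
    then have "b8 z (ovoid k u v) \<noteq> 0" by (rule ov)
    then show False unfolding c b8_ovoid by (simp add: norm3_defs)
  next
    assume le: "card (UNIV :: 'k set) ^ 2 \<le> card (zeros z)"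
    have "zeros z \<subseteq> union_secs I" using ov unfolding zeros_def by blast
    then have "zeros z \<subseteq> (\<Union>i\<in>I. secs (fst i) (snd i) \<inter> zeros z)" unfolding union_secs_def by blast
    then have "card (zeros z) \<le> card (\<Union>i\<in>I. secs (fst i) (snd i) \<inter> zeros z)" by (intro card_mono) auto
    also have "\<dots> \<le> (\<Sum>i\<in>I. card (secs (fst i) (snd i) \<inter> zeros z))" by (rule card_UN_le) simp
    also have "\<dots> \<le> (\<Sum>i\<in>I. 3 * card (UNIV :: 'k set) + 3)" by (intro sum_mono zeros_secs_upper ex) simp
    finally show False using le I(2) by simp
  qed
qed

lemma card_derived:
  assumes I: "general_pairs I" "(0, 0) \<in> I"
  shows "int (card (derived I)) + 1 = int (card (UNIV :: 'k set)) ^ 3 - int (card (union_secs I)) + int (card I)"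
proof -
  have "inj_on (\<lambda>(k, u, v). ovoid k u v) (- union_secs I)" by (auto intro!: inj_onI simp: ovoid_def)
  then have 1: "card ((\<lambda>(k, u, v). ovoid k u v) ` (- union_secs I)) = card (- union_secs I)" by (rule card_image)
  have 2: "int (card (- union_secs I)) = int (card (UNIV :: 'k set)) ^ 3 - int (card (union_secs I))"
  proof -
    have "card (UNIV :: ('k \<times> 'k \<times> 'k) set) = card (union_secs I) + card (- union_secs I)"
      by (subst card_Un_disjoint[symmetric]) auto
    then show ?thesis by (simp add: card_triples flip: of_nat_power)
  qed
  have "inj_on (\<lambda>i. extra (fst i) (snd i)) (I - {(0, 0)})"
  proof (rule inj_onI)
    fix i j assume ij: "i \<in> I - {(0, 0)}" "j \<in> I - {(0, 0)}" "extra (fst i) (snd i) = extra (fst j) (snd j)"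
    then have "snd i = snd j" by (simp add: extra_def)
    then show "i = j" using ij I(1) unfolding general_pairs_def by blast
  qed
  then have 3: "card ((\<lambda>i. extra (fst i) (snd i)) ` (I - {(0, 0)})) = card I - 1"
    using I(2) by (simp add: card_image)
  have "card I \<ge> 1" using I(2) by (metis One_nat_def Suc_leI card_gt_0_iff empty_iff finite_pairs)
  moreover have "(\<lambda>(k, u, v). ovoid k u v) ` (- union_secs I) \<inter> (\<lambda>i. extra (fst i) (snd i)) ` (I - {(0, 0)}) = {}"
    by (auto simp: ovoid_def extra_def)
  ultimately show ?thesis unfolding derived_def using 1 2 3 by (subst card_Un_disjoint) auto
qed

section \<open>Inclusion-exclusion for the removed sections\<close>

definition off :: "'k \<times> 'k \<Rightarrow> ('k \<times> 'k \<times> 'k) set" where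
  "off i = secs (fst i) (snd i) - axis"

lemma card_union_secs:
  assumes "I \<noteq> {}"
  shows "card (union_secs I) = card (UNIV :: 'k set) + card (\<Union>i\<in>I. off i)"
proof -
  have "union_secs I = axis \<union> (\<Union>i\<in>I. off i)"
    using assms axis_subset_secs unfolding union_secs_def off_def by blast
  moreover have "axis \<inter> (\<Union>i\<in>I. off i) = {}" unfolding off_def by blast
  ultimately show ?thesis by (simp add: card_Un_disjoint card_axis)
qed

lemma card_off: "card (off i) = card (UNIV :: 'k set) * (card (UNIV :: 'k set) - 1)"
  unfolding off_def by (rule card_secs_off_axis)

lemma card_off_pair:
  assumes "fst i \<noteq> fst j" "snd i \<noteq> snd j"
  shows "card (off i \<inter> off j) = card (UNIV :: 'k set) - 1"
proof -
  have "off i \<inter> off j = secs (fst i) (snd i) \<inter> secs (fst j) (snd j) - axis" unfolding off_def by blast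
  then show ?thesis using card_pair[OF assms] by simp
qed

lemma card_off_triple:
  assumes "fst i \<noteq> fst j" "fst i \<noteq> fst l" "fst j \<noteq> fst l" "snd i \<noteq> snd j" "snd i \<noteq> snd l" "snd j \<noteq> snd l"
  shows "card (off i \<inter> off j \<inter> off l) = 1"
proof -
  have "off i \<inter> off j \<inter> off l = secs (fst i) (snd i) \<inter> secs (fst j) (snd j) \<inter> secs (fst l) (snd l) - axis"
    unfolding off_def by blast
  then show ?thesis using card_triple[OF assms] by simp
qed

lemma common_point: "(0, 1, 0) \<in> off (s, g) \<longleftrightarrow> g = s"
  by (auto simp: off_def secs_def sect_def axis_def add_eq_0_iff2)

text \<open>All sections on the diagonal contain \<open>(0, 1, 0)\<close>, so this is the only point off the axis
  lying on three of them.\<close>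

lemma card_diagonal:
  assumes "finite S" "S \<noteq> {}" "card (UNIV :: 'k set) \<ge> 2"
  shows "int (card (\<Union>s\<in>S. off (s, s))) = int (card S) * (int (card (UNIV :: 'k set)) * (int (card (UNIV :: 'k set)) - 1))
    - (int (card S) - 1) - int (card S choose 2) * (int (card (UNIV :: 'k set)) - 2)"
  using assms(1,2)
proof (induction S rule: finite_ne_induct)
  case (singleton x)
  then show ?case using assms(3) by (simp add: card_off of_nat_diff)
next
  case (insert s S)
  let ?q = "card (UNIV :: 'k set)"
  let ?w = "(0, 1, 0) :: 'k \<times> 'k \<times> 'k"
  have E: "card (off (s, s) \<inter> off (s', s') - {?w}) = ?q - 2" if "s' \<in> S" for s'
  proof -
    have "card (off (s, s) \<inter> off (s', s')) = ?q - 1" using that insert by (intro card_off_pair) auto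
    then show ?thesis using common_point by (simp add: card_Diff_subset)
  qed
  have disj: "(off (s, s) \<inter> off (s', s') - {?w}) \<inter> (off (s, s) \<inter> off (s'', s'') - {?w}) = {}"
    if "s' \<in> S" "s'' \<in> S" "s' \<noteq> s''" for s' s''
  proof -
    have "card (off (s, s) \<inter> off (s', s') \<inter> off (s'', s'')) = 1" using that insert by (intro card_off_triple) auto
    then obtain y where "off (s, s) \<inter> off (s', s') \<inter> off (s'', s'') = {y}" by (rule card_1_singletonE)
    moreover have "?w \<in> off (s, s) \<inter> off (s', s') \<inter> off (s'', s'')" by (simp add: common_point)
    ultimately have "off (s, s) \<inter> off (s', s') \<inter> off (s'', s'') = {?w}" by (metis singletonD)
    then show ?thesis by blast
  qed
  \<comment> \<open>Once the common point is split off, the intersections of the new section with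
    the earlier ones are disjoint sets of \<open>?q - 2\<close> points and simply add up.\<close>
  have X: "off (s, s) \<inter> (\<Union>s'\<in>S. off (s', s')) = insert ?w (\<Union>s'\<in>S. off (s, s) \<inter> off (s', s') - {?w})"
    using insert(2) common_point by blast
  have "card (off (s, s) \<inter> (\<Union>s'\<in>S. off (s', s'))) = Suc (card (\<Union>s'\<in>S. off (s, s) \<inter> off (s', s') - {?w}))"
    unfolding X by (rule card_insert_disjoint[OF finite_triples]) blast
  also have "card (\<Union>s'\<in>S. off (s, s) \<inter> off (s', s') - {?w}) = (\<Sum>s'\<in>S. ?q - 2)"
    using insert(1) disj E by (subst card_UN_disjoint) auto
  finally have i: "int (card (off (s, s) \<inter> (\<Union>s'\<in>S. off (s', s')))) = 1 + int (card S) * (int ?q - 2)"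
    using assms(3) by (simp add: of_nat_diff)
  have "card (off (s, s)) + card (\<Union>s'\<in>S. off (s', s')) =
      card (off (s, s) \<union> (\<Union>s'\<in>S. off (s', s'))) + card (off (s, s) \<inter> (\<Union>s'\<in>S. off (s', s')))"
    by (rule card_Un_Int) auto
  then have "int (card (\<Union>s'\<in>insert s S. off (s', s'))) = int (card (off (s, s))) + int (card (\<Union>s'\<in>S. off (s', s')))
      - int (card (off (s, s) \<inter> (\<Union>s'\<in>S. off (s', s'))))"
    by simp
  also have "int (card (off (s, s))) = int ?q * (int ?q - 1)"
    using assms(3) by (simp add: card_off of_nat_diff)
  finally show ?case using insert i by (simp add: numeral_2_eq_2 algebra_simps)
qed

lemma card_off_diagonal:
  assumes "finite S" "S \<noteq> {}" "card (UNIV :: 'k set) \<ge> 2"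
  shows "int (card (union_secs ((\<lambda>s. (s, s)) ` S))) = int (card (UNIV :: 'k set))
    + int (card S) * (int (card (UNIV :: 'k set)) * (int (card (UNIV :: 'k set)) - 1))
    - (int (card S) - 1) - int (card S choose 2) * (int (card (UNIV :: 'k set)) - 2)"
  using card_diagonal[OF assms] assms(2) by (simp add: card_union_secs)

text \<open>With a fourth section off the diagonal every triple of sections still shares a point off the
  axis, but these four points differ, which makes the union larger by one.\<close>

lemma card_off_four:
  assumes abc: "a \<noteq> b" "a \<noteq> c" "b \<noteq> c" and s: "s \<noteq> a" "s \<noteq> b" "s \<noteq> c" and g: "g \<noteq> a" "g \<noteq> b" "g \<noteq> c" and "g \<noteq> s"
    and q: "card (UNIV :: 'k set) \<ge> 2"
  shows "int (card (union_secs {(s, g), (a, a), (b, b), (c, c)})) = 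
    4 * int (card (UNIV :: 'k set)) ^ 2 - 9 * int (card (UNIV :: 'k set)) + 10"
proof -
  let ?q = "card (UNIV :: 'k set)"
  let ?D = "off (s, g)" and ?A = "off (a, a)" and ?B = "off (b, b)" and ?C = "off (c, c)"
  have "(\<Union>x\<in>{a, b, c}. off (x, x)) = ?A \<union> ?B \<union> ?C" by auto
  moreover have "card {a, b, c} = 3" using abc by simp
  moreover have "(3::nat) choose 2 = 3" by (simp add: numeral_eq_Suc)
  ultimately have U3: "int (card (?A \<union> ?B \<union> ?C)) = 3 * (int ?q * (int ?q - 1)) - 2 - 3 * (int ?q - 2)"
    using card_diagonal[of "{a, b, c}"] q by simp
  have p: "card (?D \<inter> ?A) = ?q - 1" "card (?D \<inter> ?B) = ?q - 1" "card (?D \<inter> ?C) = ?q - 1"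
    using s g by (intro card_off_pair; simp)+
  have t: "card (?D \<inter> ?A \<inter> ?B) = 1" "card (?D \<inter> ?A \<inter> ?C) = 1" "card (?D \<inter> ?B \<inter> ?C) = 1" "card (?A \<inter> ?B \<inter> ?C) = 1"
    using s g abc by (intro card_off_triple; simp)+
  obtain y where "?A \<inter> ?B \<inter> ?C = {y}" using t(4) by (rule card_1_singletonE)
  moreover have "(0, 1, 0) \<in> ?A \<inter> ?B \<inter> ?C" by (simp add: common_point)
  ultimately have "?A \<inter> ?B \<inter> ?C = {(0, 1, 0)}" by (metis singletonD)
  moreover have "(0, 1, 0) \<notin> ?D" using \<open>g \<noteq> s\<close> by (simp add: common_point)
  moreover have "(?D \<inter> ?A \<inter> ?C) \<inter> (?D \<inter> ?B \<inter> ?C) = ?D \<inter> (?A \<inter> ?B \<inter> ?C)" by blast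
  ultimately have e: "(?D \<inter> ?A \<inter> ?C) \<inter> (?D \<inter> ?B \<inter> ?C) = {}" by simp
  have "card (?D \<inter> ?A) + card (?D \<inter> ?B) = card (?D \<inter> ?A \<union> ?D \<inter> ?B) + card ((?D \<inter> ?A) \<inter> (?D \<inter> ?B))"
    by (rule card_Un_Int) auto
  moreover have "(?D \<inter> ?A) \<inter> (?D \<inter> ?B) = ?D \<inter> ?A \<inter> ?B" by blast
  ultimately have 1: "int (card (?D \<inter> ?A \<union> ?D \<inter> ?B)) = 2 * (int ?q - 1) - 1" using p t q by (simp add: of_nat_diff)
  have "card (?D \<inter> ?A \<union> ?D \<inter> ?B) + card (?D \<inter> ?C) = card (?D \<inter> ?A \<union> ?D \<inter> ?B \<union> ?D \<inter> ?C)
      + card ((?D \<inter> ?A \<union> ?D \<inter> ?B) \<inter> (?D \<inter> ?C))"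
    by (rule card_Un_Int) auto
  moreover have "(?D \<inter> ?A \<union> ?D \<inter> ?B) \<inter> (?D \<inter> ?C) = (?D \<inter> ?A \<inter> ?C) \<union> (?D \<inter> ?B \<inter> ?C)" by blast
  moreover have "card ((?D \<inter> ?A \<inter> ?C) \<union> (?D \<inter> ?B \<inter> ?C)) = 2"
    using e t by (subst card_Un_disjoint) auto
  moreover have "?D \<inter> (?A \<union> ?B \<union> ?C) = ?D \<inter> ?A \<union> ?D \<inter> ?B \<union> ?D \<inter> ?C" by blast
  ultimately have 2: "int (card (?D \<inter> (?A \<union> ?B \<union> ?C))) = 3 * (int ?q - 1) - 3"
    using p 1 q by (simp add: of_nat_diff)
  have "card ?D + card (?A \<union> ?B \<union> ?C) = card (?D \<union> (?A \<union> ?B \<union> ?C)) + card (?D \<inter> (?A \<union> ?B \<union> ?C))"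
    by (rule card_Un_Int) auto
  moreover have "int (card ?D) = int ?q * (int ?q - 1)" using q by (simp add: card_off of_nat_diff)
  moreover have "(\<Union>i\<in>{(s, g), (a, a), (b, b), (c, c)}. off i) = ?D \<union> (?A \<union> ?B \<union> ?C)" by auto
  ultimately show ?thesis using U3 2 by (subst card_union_secs) (simp_all add: algebra_simps power2_eq_square)
qed

end

context Sp6_char2
begin

lemma maximal_spread_derived:
  assumes t: "\<And>s. s * s * s + s \<noteq> (t :: 'k)" and I: "cubic_extension.general_pairs I" "(0, 0) \<in> I"
    and small: "card I * (3 * q + 3) < q ^ 2"
  shows "has_maximal_spread_of_size (int q ^ 3 - int (card (cubic_extension.union_secs t I)) + int (card I))"
proof -
  interpret cubic_extension "TYPE('k)" t by unfold_locales (rule t)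
  have "has_maximal_spread_of_size (int (card (derived I)) + 1)"
    by (rule maximal_spread_from_b8[OF derived_singular[OF I] derived_clique[OF I(1)] derived_maximal[OF I(2)]])
       (use small card_field in simp_all)
  then show ?thesis using card_derived[OF I] by (simp add: card_field)
qed

lemma maximal_spread_diagonal:
  assumes r: "r \<ge> 1" "r * (3 * q + 3) < q ^ 2"
  shows "has_maximal_spread_of_size (int q ^ 3 - int r * int q ^ 2 + (int r - 1) * (int q + 2)
    + int (r choose 2) * (int q - 2) + 1)"
proof -
  obtain t :: 'k where t: "\<And>s. s * s * s + s \<noteq> t" using ex_irreducible_cubic by blast
  interpret cubic_extension "TYPE('k)" t by unfold_locales (rule t)
  have "r \<le> q"
  proof (rule ccontr)
    assume "\<not> r \<le> q"
    then have "q * q \<le> r * (3 * q + 3)" by (intro mult_mono) auto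
    then show False using r(2) by (simp add: power2_eq_square)
  qed
  then have "r - 1 \<le> card (UNIV - {0 :: 'k})" using card_field by (simp add: card_nonzero)
  then obtain T where T: "T \<subseteq> UNIV - {0 :: 'k}" "card T = r - 1" by (metis obtain_subset_with_card_n)
  \<comment> \<open>The parameter 0 has to occur, since \<open>extra 0 0\<close> is the base point
    of the chart.\<close>
  define S where "S = insert 0 T"
  have "0 \<notin> T" using T(1) by blast
  then have S: "card S = r" "0 \<in> S" using T(2) r(1) by (simp_all add: S_def)
  have cI: "card ((\<lambda>s. (s, s)) ` S) = r" using S(1) by (simp add: card_image inj_on_def)
  have "has_maximal_spread_of_size (int q ^ 3 - int (card (union_secs ((\<lambda>s. (s, s)) ` S))) + int (card ((\<lambda>s. (s, s)) ` S)))"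
    using S r by (intro maximal_spread_derived t) (auto simp: general_pairs_def cI)
  moreover have "card (UNIV :: 'k set) \<ge> 2"
    using card_mono[of UNIV "{0, 1 :: 'k}"] by simp
  then have "int (card (union_secs ((\<lambda>s. (s, s)) ` S))) =
      int q + int r * (int q * (int q - 1)) - (int r - 1) - int (r choose 2) * (int q - 2)"
    using card_off_diagonal[of S] S card_field by auto
  ultimately show ?thesis unfolding cI by (simp add: algebra_simps power2_eq_square)
qed

text \<open>The bound on \<open>q\<close> comes from the maximality count for four sections: 4(3q +
  3) < q^2 holds from 16 on and fails for 8.\<close>

lemma maximal_spread_four:
  assumes q: "q \<ge> 16"
  shows "has_maximal_spread_of_size (int q ^ 3 - 4 * int q ^ 2 + 3 * (int q + 2) + 6 * (int q - 2))"
proof -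
  obtain t :: 'k where t: "\<And>s. s * s * s + s \<noteq> t" using ex_irreducible_cubic by blast
  interpret cubic_extension "TYPE('k)" t by unfold_locales (rule t)
  have new: "\<exists>x. x \<notin> set xs" if "length xs < 16" for xs :: "'k list"
    using that q card_field card_length[of xs] by (metis UNIV_eq_I le_less_trans not_less)
  obtain a :: 'k where a: "a \<notin> set [0, 1]" using new[of "[0, 1]"] by auto
  obtain s where s: "s \<notin> set [0, 1, a]" using new[of "[0, 1, a]"] by auto
  obtain g where g: "g \<notin> set [0, 1, a, s]" using new[of "[0, 1, a, s]"] by auto
  let ?I = "{(s, g), (0, 0), (1, 1), (a, a)}"
  have cI: "card ?I = 4" using a s g by auto
  have "4 * (3 * q + 3) < q ^ 2"
  proof -
    have "4 * (3 * q + 3) < 16 * q" using q by simp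
    also have "\<dots> \<le> q * q" using q by (intro mult_right_mono) auto
    finally show ?thesis by (simp only: power2_eq_square)
  qed
  then have "has_maximal_spread_of_size (int q ^ 3 - int (card (union_secs ?I)) + int (card ?I))"
    using a s g by (intro maximal_spread_derived t) (auto simp: general_pairs_def cI)
  moreover have "int (card (union_secs ?I)) = 4 * int q ^ 2 - 9 * int q + 10"
    using card_off_four[of 0 1 a s g] a s g q card_field by auto
  ultimately show ?thesis unfolding cI by (simp add: algebra_simps)
qed

end

subsection \<open>Tits ovoids\<close>

locale tits_field = finite_char2_field K for K :: "'k::field itself" +
  fixes e :: nat
  assumes card_tits: "card (UNIV :: 'k set) = 2 ^ (2 * e + 1)" and e_pos: "e \<ge> 1"
begin

definition tau :: nat where "tau = 2 ^ e"

text \<open>\<open>S\<close> is the Tits endomorphism, whose square is the Frobenius map, and \<open>T\<close> is its inverse.\<close>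

definition T :: "'k \<Rightarrow> 'k" where "T x = x ^ tau"

definition S :: "'k \<Rightarrow> 'k" where "S x = T x * T x"

lemma tau_ge: "tau \<ge> 2"
  using power_increasing[OF e_pos, of "2::nat"] by (simp add: tau_def)

lemma card_tau: "card (UNIV :: 'k set) = 2 * tau * tau"
  by (simp add: card_tits tau_def power_add mult_2 distrib_right)

lemma power_add_char2: "(x + y) ^ (2 ^ n) = (x::'k) ^ (2 ^ n) + y ^ (2 ^ n)"
proof (induction n)
  case (Suc n)
  have sq: "z ^ (2 ^ Suc n) = z ^ (2 ^ n) * z ^ (2 ^ n)" for z :: 'k
    by (simp add: mult_2 power_add)
  show ?case unfolding sq Suc.IH by (simp add: char2)
qed simp

lemma T_add: "T (x + y) = T x + T y"
  unfolding T_def tau_def by (rule power_add_char2)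

lemma T_mult: "T (x * y) = T x * T y"
  by (simp add: T_def power_mult_distrib)

lemma T_divide: "T (x / y) = T x / T y"
  by (simp add: T_def power_divide)

lemma T_0 [simp]: "T 0 = 0" and T_1 [simp]: "T 1 = 1"
  using tau_ge by (simp_all add: T_def)

lemma T_eq_0_iff [simp]: "T x = 0 \<longleftrightarrow> x = 0"
  using tau_ge by (simp add: T_def)

lemma TT: "T (T x) * T (T x) = x"
proof -
  have "T (T x) * T (T x) = x ^ (tau * tau + tau * tau)"
    by (simp add: T_def power_add power_mult)
  also have "tau * tau + tau * tau = card (UNIV :: 'k set)" by (simp add: card_tau)
  finally show ?thesis by (simp add: finite_field_power_card)
qed

lemma S_add: "S (x + y) = S x + S y"
  by (simp add: S_def T_add char2)

lemma S_mult: "S (x * y) = S x * S y"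
  by (simp add: S_def T_mult ac_simps)

lemma S_divide: "S (x / y) = S x / S y"
  by (simp add: S_def T_divide)

lemma S_0 [simp]: "S 0 = 0" and S_1 [simp]: "S 1 = 1"
  by (simp_all add: S_def)

lemma S_eq_0_iff [simp]: "S x = 0 \<longleftrightarrow> x = 0"
  by (simp add: S_def)

lemma S_T [simp]: "S (T x) = x"
  unfolding S_def by (rule TT)

lemma T_S [simp]: "T (S x) = x"
  unfolding S_def T_mult by (rule TT)

lemma S_S [simp]: "S (S x) = x * x"
  unfolding S_def[of "S x"] T_S ..

lemma S_eq_iff [simp]: "S x = S y \<longleftrightarrow> x = y"
  by (metis T_S)

lemma S_power: "S x = x ^ (2 * tau)"
  by (simp add: S_def T_def mult_2 power_add)

text \<open>The inverse of \<open>x * T x\<close>: for \<open>m = x * T x\<close> one has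
  \<open>m * m = x * x * S x\<close> and \<open>S m = x * S x\<close>.\<close>

definition root_T :: "'k \<Rightarrow> 'k" where "root_T m = m * m / S m"

lemma root_T: "root_T m * T (root_T m) = m"
proof (cases "m = 0")
  case False
  have "T (root_T m) = S m / m" unfolding root_T_def T_divide T_mult T_S by (simp add: S_def)
  then show ?thesis using False by (simp add: root_T_def)
qed (simp add: root_T_def)

lemma root_T_eq_0_iff [simp]: "root_T m = 0 \<longleftrightarrow> m = 0"
  by (simp add: root_T_def)

lemma root_T_unique: "root_T (x * T x) = x"
proof (cases "x = 0")
  case False
  have "S (x * T x) = S x * x" by (simp add: S_mult)
  then show ?thesis using False unfolding root_T_def by (simp add: S_def ac_simps)
qed (simp add: root_T_def)

section \<open>The trace-zero subgroup and its character\<close>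

lemma fibres_kernel_01:
  fixes f :: "'k \<Rightarrow> 'k"
  assumes add: "\<And>x y. f (x + y) = f x + f y" and ker: "\<And>x. f x = 0 \<longleftrightarrow> x = 0 \<or> x = 1"
  shows "card {y. f y = z} = (if z \<in> range f then 2 else 0)" "2 * card (range f) = card (UNIV :: 'k set)"
proof -
  have fib: "{y. f y = f y0} = {y0, y0 + 1}" for y0
  proof -
    have "f y = f y0 \<longleftrightarrow> y = y0 \<or> y = y0 + 1" for y
    proof -
      have "f y = f y0 \<longleftrightarrow> y + y0 = 0 \<or> y + y0 = 1" by (metis add ker add_eq_0_iff2)
      also have "y + y0 = 0 \<longleftrightarrow> y = y0" by (rule add_eq_0_iff2)
      also have "y + y0 = 1 \<longleftrightarrow> y = y0 + 1" by (metis add.commute add_self_left)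
      finally show ?thesis .
    qed
    then show ?thesis by blast
  qed
  have two: "card {y0, y0 + 1 :: 'k} = 2" for y0 by simp
  show "card {y. f y = z} = (if z \<in> range f then 2 else 0)"
  proof (cases "z \<in> range f")
    case True
    then obtain y0 where "z = f y0" by blast
    then show ?thesis using fib[of y0] two[of y0] by simp
  next
    case False
    then have "{y. f y = z} = {}" by blast
    then show ?thesis using False by simp
  qed
  have "card (\<Union>z\<in>range f. {y. f y = z}) = (\<Sum>z\<in>range f. card {y. f y = z})"
    by (rule card_UN_disjoint) auto
  also have "(\<Union>z\<in>range f. {y. f y = z}) = UNIV" by blast
  also have "(\<Sum>z\<in>range f. card {y. f y = z}) = (\<Sum>z\<in>range f. 2)"
    by (rule sum.cong) (use fib two in auto)
  finally show "2 * card (range f) = card (UNIV :: 'k set)" by simp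
qed

text \<open>The elements of absolute trace 0, obtained without the trace: an additive subgroup of
  index 2 that is also the image of \<open>z * z + z\<close>. Accordingly \<open>chi\<close> is -1
  to the power of the trace.\<close>

definition I0 :: "'k set" where "I0 = range (\<lambda>y. T y + y)"

lemma square_eq_self: "(y::'k) * y = y \<longleftrightarrow> y = 0 \<or> y = 1"
  by auto

lemma T_eq_self: "T y = y \<longleftrightarrow> y = 0 \<or> y = 1"
proof
  assume "T y = y"
  then have "y * y = y" by (metis S_T S_def)
  then show "y = 0 \<or> y = 1" by (simp add: square_eq_self)
qed auto

lemma I0_map: "T (x + y) + (x + y) = (T x + x) + (T y + y)" "T x + x = 0 \<longleftrightarrow> x = 0 \<or> x = 1"
  by (simp add: T_add ac_simps) (simp only: add_eq_0_iff2 T_eq_self)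

lemma square_map: "(x + y) * (x + y) + (x + y) = (x * x + x) + (y * y + (y::'k))" "x * x + x = 0 \<longleftrightarrow> x = 0 \<or> x = (1::'k)"
  by (simp add: char2) (simp only: add_eq_0_iff2 square_eq_self)

lemmas I0_fibre = fibres_kernel_01(1)[of "\<lambda>y. T y + y", OF I0_map, folded I0_def]
  and card_I0 = fibres_kernel_01(2)[of "\<lambda>y. T y + y", OF I0_map, folded I0_def]

lemma I0_add: "x \<in> I0 \<Longrightarrow> y \<in> I0 \<Longrightarrow> x + y \<in> I0"
proof -
  assume "x \<in> I0" "y \<in> I0"
  then obtain a b where "x = T a + a" "y = T b + b" unfolding I0_def by blast
  then have "x + y = T (a + b) + (a + b)" by (simp add: T_add ac_simps)
  then show ?thesis unfolding I0_def by blast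
qed

lemma T_I0: "T y + y \<in> I0"
  unfolding I0_def by blast

lemma S_I0: "S y + y \<in> I0"
  using T_I0[of "S y"] by (simp add: add.commute)

lemma square_I0: "y * y + y \<in> I0"
proof -
  have "(S (S y) + S y) + (S y + y) \<in> I0" by (intro I0_add S_I0)
  then show ?thesis by (simp add: add.assoc)
qed

text \<open>The trace of 1 is the odd degree of the field. Concretely, applying \<open>S\<close> to
  \<open>T y = y + 1\<close> gives \<open>y * y = y\<close>, which forces
  \<open>T y = y\<close>.\<close>

lemma one_notin_I0: "1 \<notin> I0"
proof
  assume "1 \<in> I0"
  then obtain y where y: "1 = T y + y" unfolding I0_def by blast
  have "y + 1 = y + (y + T y)" unfolding y by (simp add: add.commute)
  then have Ty: "T y = y + 1" by simp
  have "y = S (T y)" by simp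
  also have "\<dots> = S y + 1" unfolding Ty S_add by simp
  also have "S y = y * y + 1" unfolding S_def Ty by (simp add: char2)
  finally have "y * y = y" by (simp add: add.assoc)
  then have "T y = y" by (simp add: square_eq_self T_eq_self)
  then show False using y by simp
qed

lemma I0_index_2: "x \<notin> I0 \<Longrightarrow> x + 1 \<in> I0"
proof -
  assume x: "x \<notin> I0"
  have inj: "inj_on (\<lambda>y. y + (1::'k)) I0" by (auto intro: inj_onI)
  have "I0 \<inter> (\<lambda>y. y + 1) ` I0 = {}"
  proof (rule ccontr)
    assume "\<not> ?thesis"
    then obtain y where "y \<in> I0" "y + 1 \<in> I0" by blast
    then have "y + (y + 1) \<in> I0" by (rule I0_add)
    then show False using one_notin_I0 by simp
  qed
  then have "card (I0 \<union> (\<lambda>y. y + 1) ` I0) = card (UNIV :: 'k set)"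
    using inj card_I0 by (simp add: card_Un_disjoint card_image)
  then have "I0 \<union> (\<lambda>y. y + 1) ` I0 = UNIV" by (intro card_subset_eq) auto
  then obtain y where "y \<in> I0" "x = y + 1" using x by blast
  then show ?thesis by (simp add: add.assoc)
qed

lemma square_range: "range (\<lambda>z. z * z + z) = I0"
proof -
  have "2 * card (range (\<lambda>z::'k. z * z + z)) = card (UNIV :: 'k set)"
    by (rule fibres_kernel_01(2)[OF square_map])
  then have "card (range (\<lambda>z::'k. z * z + z)) = card I0" using card_I0 by simp
  moreover have "range (\<lambda>z::'k. z * z + z) \<subseteq> I0" using square_I0 by blast
  ultimately show ?thesis by (intro card_subset_eq) auto
qed

lemma square_fibre: "card {y. y * y + y = z} = (if z \<in> I0 then 2 else 0)"
proof -
  have "card {y. y * y + y = z} = (if z \<in> range (\<lambda>z::'k. z * z + z) then 2 else 0)"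
    by (rule fibres_kernel_01(1)[OF square_map])
  then show ?thesis by (simp only: square_range)
qed

definition chi :: "'k \<Rightarrow> int" where "chi x = (if x \<in> I0 then 1 else - 1)"

lemma chi_add: "chi (x + y) = chi x * chi y"
proof -
  have "x + y \<in> I0 \<longleftrightarrow> (x \<in> I0 \<longleftrightarrow> y \<in> I0)"
  proof (cases "x \<in> I0"; cases "y \<in> I0")
    assume "x \<in> I0" "y \<notin> I0"
    then show ?thesis using I0_add[of x "x + y"] by auto
  next
    assume "x \<notin> I0" "y \<in> I0"
    then show ?thesis using I0_add[of y "x + y"] by (auto simp: ac_simps)
  next
    assume "x \<notin> I0" "y \<notin> I0"
    then show ?thesis using I0_add[OF I0_index_2 I0_index_2, of x y] by (simp add: ac_simps)
  qed (auto intro: I0_add)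
  then show ?thesis by (simp add: chi_def)
qed

lemma chi_cases: "chi x = 1 \<or> chi x = - 1"
  by (simp add: chi_def)

lemma chi_mult_self [simp]: "chi x * chi x = 1"
  using chi_cases[of x] by auto

lemma chi_0 [simp]: "chi 0 = 1"
  using I0_add[of "T 0 + 0"] T_I0[of 0] by (simp add: chi_def)

lemma chi_1 [simp]: "chi 1 = - 1"
  using one_notin_I0 by (simp add: chi_def)

lemma chi_T: "chi (T x) = chi x"
proof -
  have "chi (T x + x) = 1" using T_I0 by (simp add: chi_def)
  then show ?thesis using chi_cases[of x] chi_cases[of "T x"] unfolding chi_add by auto
qed

lemma chi_square: "chi (x * x) = chi x"
proof -
  have "chi (x * x + x) = 1" using square_I0 by (simp add: chi_def)
  then show ?thesis using chi_cases[of x] chi_cases[of "x * x"] unfolding chi_add by auto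
qed

section \<open>Character sums\<close>

lemma sum_chi: "(\<Sum>x\<in>UNIV. chi (x * a)) = (if a = 0 then int (card (UNIV :: 'k set)) else 0)"
proof (cases "a = 0")
  case False
  have "(\<Sum>x\<in>UNIV. chi (x * a)) = (\<Sum>x\<in>UNIV. chi ((x + 1 / a) * a))"
    by (rule sum.reindex_bij_witness[of _ "\<lambda>x. x + 1 / a" "\<lambda>x. x + 1 / a"]) (simp_all add: add.assoc)
  also have "\<dots> = (\<Sum>x\<in>UNIV. - chi (x * a))"
  proof (rule sum.cong)
    fix x
    have "(x + 1 / a) * a = x * a + 1" using False by (simp add: distrib_right)
    then show "chi ((x + 1 / a) * a) = - chi (x * a)" by (simp add: chi_add)
  qed simp
  finally show ?thesis using False by (simp add: sum_negf)
qed simp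

text \<open>As \<open>x * T x\<close> is quadratic over the prime field,
  \<open>?f x + ?f (x + h)\<close> is \<open>?f h\<close> plus an additive function of
  \<open>x\<close>. Invariance of \<open>chi\<close> under \<open>T\<close> turns the latter into a
  multiple of \<open>x\<close>, so the inner sum vanishes unless the multiplier
  \<open>k * T h + S k * S h\<close> is 0, which happens for at most two \<open>h\<close>.\<close>

lemma char_sum_square:
  assumes "k \<noteq> 0"
  shows "(\<Sum>x\<in>UNIV. chi (k * x * T x + b * x)) ^ 2 \<le> 2 * int (card (UNIV :: 'k set))"
proof -
  let ?f = "\<lambda>x. k * x * T x + b * x"
  have "(\<Sum>x\<in>UNIV. chi (?f x)) ^ 2 = (\<Sum>x\<in>UNIV. \<Sum>y\<in>UNIV. chi (?f x) * chi (?f y))"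
    by (simp add: power2_eq_square sum_product)
  also have "\<dots> = (\<Sum>x\<in>UNIV. \<Sum>h\<in>UNIV. chi (?f x) * chi (?f (x + h)))"
  proof (rule sum.cong[OF refl])
    fix x
    show "(\<Sum>y\<in>UNIV. chi (?f x) * chi (?f y)) = (\<Sum>h\<in>UNIV. chi (?f x) * chi (?f (x + h)))"
      by (rule sum.reindex_bij_witness[of _ "\<lambda>h. x + h" "\<lambda>y. x + y"]) simp_all
  qed
  also have "\<dots> = (\<Sum>x\<in>UNIV. \<Sum>h\<in>UNIV. chi (?f h) * chi (x * (k * T h + S k * S h)))"
  proof (intro sum.cong refl)
    fix x h
    have "chi (?f x) * chi (?f (x + h)) = chi (?f x + ?f (x + h))" by (simp add: chi_add)
    also have "?f x + ?f (x + h) = ?f h + (x * (k * T h) + k * h * T x)" by (simp add: T_add char2)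
    also have "chi \<dots> = chi (?f h) * (chi (x * (k * T h)) * chi (k * h * T x))" by (simp only: chi_add)
    also have "chi (k * h * T x) = chi (T (S k * S h * x))" by (simp add: T_mult)
    also have "\<dots> = chi (x * (S k * S h))" unfolding chi_T by (simp add: ac_simps)
    also have "chi (x * (k * T h)) * chi (x * (S k * S h)) = chi (x * (k * T h + S k * S h))"
      by (simp add: chi_add distrib_left)
    finally show "chi (?f x) * chi (?f (x + h)) = chi (?f h) * chi (x * (k * T h + S k * S h))" .
  qed
  also have "\<dots> = (\<Sum>h\<in>UNIV. \<Sum>x\<in>UNIV. chi (?f h) * chi (x * (k * T h + S k * S h)))"
    by (rule sum.swap)
  also have "\<dots> = (\<Sum>h\<in>UNIV. chi (?f h) * (if k * T h + S k * S h = 0 then int (card (UNIV :: 'k set)) else 0))"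
    by (simp only: sum_distrib_left[symmetric] sum_chi)
  also have "\<dots> \<le> (\<Sum>h\<in>UNIV. if k * T h + S k * S h = 0 then int (card (UNIV :: 'k set)) else 0)"
  proof (rule sum_mono)
    fix h
    show "chi (?f h) * (if k * T h + S k * S h = 0 then int (card (UNIV :: 'k set)) else 0)
      \<le> (if k * T h + S k * S h = 0 then int (card (UNIV :: 'k set)) else 0)"
      using chi_cases[of "?f h"] by auto
  qed
  also have "\<dots> = int (card {h. k * T h + S k * S h = 0}) * int (card (UNIV :: 'k set))"
    by (simp add: sum.If_cases)
  also have "\<dots> \<le> 2 * int (card (UNIV :: 'k set))"
  proof -
    have "{h. k * T h + S k * S h = 0} \<subseteq> {0, S (k / S k)}"
    proof
      fix h assume "h \<in> {h. k * T h + S k * S h = 0}"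
      then have "(k + S k * T h) * T h = 0" by (simp add: S_def char2)
      then have "h = 0 \<or> k = S k * T h" by (auto simp: add_eq_0_iff2)
      moreover have "h = S (k / S k)" if "k = S k * T h"
      proof -
        have "T h = k / S k" using that assms by (metis S_eq_0_iff nonzero_mult_div_cancel_left)
        then show ?thesis by (metis S_T)
      qed
      ultimately show "h \<in> {0, S (k / S k)}" by blast
    qed
    then have "card {h. k * T h + S k * S h = 0} \<le> card {0, S (k / S k)}" by (intro card_mono) auto
    also have "\<dots> \<le> 2" by (simp add: card_insert_if)
    finally show ?thesis by (intro mult_right_mono) auto
  qed
  finally show ?thesis .
qed

lemma char_sum_bound:
  assumes "k \<noteq> 0"
  shows "\<bar>\<Sum>x\<in>UNIV. chi (k * x * T x + b * x)\<bar> \<le> 2 * int tau"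
proof -
  have "\<bar>\<Sum>x\<in>UNIV. chi (k * x * T x + b * x)\<bar> ^ 2 \<le> (2 * int tau) ^ 2"
    using char_sum_square[OF assms, of b] by (simp add: card_tau power2_eq_square)
  then show ?thesis by (rule power2_le_imp_le) simp
qed

section \<open>The Tits ovoid and its hyperplane sections\<close>

definition tt :: "'k \<Rightarrow> 'k \<Rightarrow> 'k" where "tt x y = x * T x + T y"

text \<open>Writing \<sigma> for \<open>S\<close>, this is x y + x^(\<sigma>+2) + y^\<sigma>, whose
  graph is the affine part of the Tits ovoid in 3-space. Since
  \<open>nn x y = x * y + tt x y * tt x y\<close>, the coordinate \<open>tt\<close> lifts it to a
  quadric in a 5-dimensional vector space.\<close>

definition nn :: "'k \<Rightarrow> 'k \<Rightarrow> 'k" where "nn x y = x * y + x * x * S x + S y"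

lemma nn_tt: "nn x y = x * y + tt x y * tt x y"
  by (simp add: nn_def tt_def S_def char2)

text \<open>The substitution is the regular action of a Sylow 2-subgroup of the Suzuki group on the
  affine ovoid points. It moves \<open>(a, b)\<close> to the origin and absorbs the linear terms of
  a section.\<close>

lemma nn_translate: "nn (x + a) (y + b + S a * (x + a)) = nn x y + nn a b + x * b + y * a"
  by (simp add: nn_def S_add S_mult char2)

lemma tt_translate: "tt (x + a) (y + b + S a * (x + a)) = tt x y + x * T a + T b"
  by (simp add: tt_def T_add T_mult char2)

lemma nn_translate': "nn x y = nn (x + a) (y + b + S a * (x + a)) + nn a b + x * b + y * a"
  unfolding nn_translate by (simp add: ac_simps)

lemma nn_scale: "nn (l * x) (l * S l * y) = l * l * S l * nn x y"
  by (simp add: nn_def S_mult char2)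

lemma tt_scale: "tt (l * x) (l * S l * y) = l * T l * tt x y"
  by (simp add: tt_def T_mult char2)

lemma S_add_ne_1: "1 + u + S u \<noteq> 0"
  using one_notin_I0 S_I0[of u] by (metis add_eq_0_iff2 add.assoc add.commute)

text \<open>Dividing by \<open>x * x * S x\<close> would leave \<open>S u + u = 1\<close>, which the
  trace excludes.\<close>

lemma nn_eq_0_iff [simp]: "nn x y = 0 \<longleftrightarrow> x = 0 \<and> y = 0"
proof (cases "x = 0")
  case False
  define u where "u = y / (x * S x)"
  have y: "y = x * S x * u" using False by (simp add: u_def)
  have "nn x y = x * x * S x * (1 + u + S u)" by (simp add: nn_def y S_mult char2)
  then show ?thesis using False S_add_ne_1 by simp
qed (simp add: nn_def)

lemma nn_difference: "nn x y + nn a b + x * b + y * a = 0 \<longleftrightarrow> x = a \<and> y = b"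
  unfolding nn_translate[symmetric] by (auto simp: add_eq_0_iff2)

lemma finite_points [simp]: "finite (X :: ('k \<times> 'k) set)"
  by (rule finite_subset[of _ UNIV]) (simp_all add: finite_Prod_UNIV)

lemma card_pairs_sum:
  fixes R :: "'k \<Rightarrow> 'k \<Rightarrow> bool"
  shows "card {(x, y). R x y} = (\<Sum>x\<in>UNIV. card {y. R x y})"
proof -
  have "{(x, y). R x y} = (SIGMA x:UNIV. {y. R x y})" by auto
  then show ?thesis by (simp add: card_SigmaI)
qed

text \<open>With \<open>u = y / (x * S x)\<close> the equation is
  \<open>x * x * S x * (1 + u + S u) = k\<close>. As \<open>x * x * S x\<close> is the square of
  \<open>x * T x\<close>, it is a bijective function of \<open>x\<close>, and every \<open>u\<close>
  gives a point.\<close>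

lemma card_level:
  assumes "k \<noteq> 0"
  shows "card (UNIV :: 'k set) \<le> card {(x, y). nn x y = k}"
proof -
  define X where "X u = root_T (rt (k / (1 + u + S u)))" for u
  have XT: "X u * T (X u) = rt (k / (1 + u + S u))" for u unfolding X_def by (rule root_T)
  have Xk: "X u * X u * S (X u) * (1 + u + S u) = k" for u
  proof -
    have "X u * X u * S (X u) = (X u * T (X u)) * (X u * T (X u))" by (simp add: S_def ac_simps)
    also have "\<dots> = k / (1 + u + S u)" unfolding XT by simp
    finally show ?thesis using S_add_ne_1[of u] by simp
  qed
  have X0: "X u \<noteq> 0" for u using Xk[of u] assms by auto
  let ?h = "\<lambda>u. (X u, X u * S (X u) * u)"
  have "inj ?h"
  proof (rule injI)
    fix u u' assume "?h u = ?h u'"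
    then have "X u' * S (X u') * u = X u' * S (X u') * u'" by (metis prod.inject)
    moreover have "X u' * S (X u') \<noteq> 0" using X0[of u'] by simp
    ultimately show "u = u'" by (metis mult_left_cancel)
  qed
  moreover have "range ?h \<subseteq> {(x, y). nn x y = k}"
  proof (rule image_subsetI)
    fix u
    have "nn (X u) (X u * S (X u) * u) = X u * X u * S (X u) * (1 + u + S u)"
      by (simp add: nn_def S_mult char2)
    then show "?h u \<in> {(x, y). nn x y = k}" using Xk by simp
  qed
  ultimately show ?thesis by (intro card_inj_on_le) auto
qed

text \<open>Without a \<open>tt\<close> term the hyperplane passes through the nucleus, and
  translation makes it a level set of \<open>nn\<close>. The excluded case is a tangent hyperplane
  with a single affine point.\<close>

lemma card_planar_section:
  assumes "nn c a + k \<noteq> 0"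
  shows "card (UNIV :: 'k set) \<le> card {(x, y). nn x y + a * x + c * y + k = 0}"
proof -
  have "card (UNIV :: 'k set) \<le> card {(x, y). nn x y = nn c a + k}" by (rule card_level[OF assms])
  also have "\<dots> \<le> card {(x, y). nn x y + a * x + c * y + k = 0}"
  proof (rule card_inj_on_le)
    let ?h = "\<lambda>(x, y). (x + c, y + a + S c * x)"
    show "inj_on ?h {(x, y). nn x y = nn c a + k}" by (auto intro: inj_onI)
    show "?h ` {(x, y). nn x y = nn c a + k} \<subseteq> {(x, y). nn x y + a * x + c * y + k = 0}"
    proof clarify
      fix x y assume xy: "nn x y = nn c a + k"
      have "nn (x + c) (y + a + S c * x) + a * (x + c) + c * (y + a + S c * x) = nn x y + nn c a"
        unfolding nn_translate'[of "x + c" "y + a + S c * x" c a] by (simp add: char2)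
      then show "nn (x + c) (y + a + S c * x) + a * (x + c) + c * (y + a + S c * x) + k = 0"
        unfolding xy by (simp add: ac_simps)
    qed
  qed simp
  finally show ?thesis .
qed

text \<open>Without an \<open>nn\<close> term the equation is additive in \<open>y\<close> up to a
  constant. Each \<open>x\<close> then contributes \<open>1 + chi\<close> of a quadratic expression,
  and the error is the bounded character sum.\<close>

lemma card_section_infinity:
  assumes g: "g \<noteq> 0"
  shows "int (card (UNIV :: 'k set)) - 2 * int tau \<le> int (card {(x, y). tt x y + b * x + g * y + c = 0})"
proof -
  \<comment> \<open>The nonzero solution of \<open>T y0 = g * y0\<close>: replacing \<open>y\<close>
    by \<open>y0 * y\<close> turns \<open>T y + g * y\<close> into a multiple of
    \<open>T y + y\<close>, whose fibres are known.\<close>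
  define y0 where "y0 = 1 / ((g * T g) * (g * T g))"
  have y0: "y0 \<noteq> 0" using g by (simp add: y0_def)
  have Ty0: "T y0 = g * y0"
  proof -
    have "T y0 = 1 / ((T g * T g) * (T (T g) * T (T g)))" by (simp add: y0_def T_divide T_mult ac_simps)
    also have "\<dots> = g * y0" unfolding TT using g by (simp add: y0_def ac_simps)
    finally show ?thesis .
  qed
  define k where "k = 1 / (g * y0)"
  have k: "k \<noteq> 0" using g y0 by (simp add: k_def)
  have "int (card {y. tt x y + b * x + g * y + c = 0}) = 1 + chi (k * c) * chi (k * x * T x + (k * b) * x)" for x
  proof -
    have "card {y. tt x y + b * x + g * y + c = 0} = card {y. T y + y = k * (x * T x + b * x + c)}"
    proof (rule bij_betw_same_card[of "\<lambda>y. y / y0"], rule bij_betw_byWitness[of _ "\<lambda>y. y0 * y"])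
      have iff: "tt x (y0 * y) + b * x + g * (y0 * y) + c = 0 \<longleftrightarrow> T y + y = k * (x * T x + b * x + c)" for y
      proof -
        have "tt x (y0 * y) + b * x + g * (y0 * y) + c = (g * y0) * (T y + y) + (x * T x + b * x + c)"
          by (simp add: tt_def T_mult Ty0 char2)
        also have "\<dots> = 0 \<longleftrightarrow> (g * y0) * (T y + y) = x * T x + b * x + c" by (rule add_eq_0_iff2)
        also have "\<dots> \<longleftrightarrow> T y + y = k * (x * T x + b * x + c)"
          using g y0 by (simp add: k_def eq_divide_eq mult.commute)
        finally show ?thesis .
      qed
      show "(\<lambda>y. y / y0) ` {y. tt x y + b * x + g * y + c = 0} \<subseteq> {y. T y + y = k * (x * T x + b * x + c)}"
        using iff[of "_ / y0"] y0 by auto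
      show "(\<lambda>y. y0 * y) ` {y. T y + y = k * (x * T x + b * x + c)} \<subseteq> {y. tt x y + b * x + g * y + c = 0}"
        using iff by auto
    qed (use y0 in auto)
    also have "int \<dots> = 1 + chi (k * (x * T x + b * x + c))" unfolding I0_fibre by (simp add: chi_def)
    also have "k * (x * T x + b * x + c) = k * c + (k * x * T x + (k * b) * x)" by (simp add: distrib_left ac_simps)
    also have "chi \<dots> = chi (k * c) * chi (k * x * T x + (k * b) * x)" by (rule chi_add)
    finally show ?thesis .
  qed
  then have "int (card {(x, y). tt x y + b * x + g * y + c = 0}) =
      int (card (UNIV :: 'k set)) + chi (k * c) * (\<Sum>x\<in>UNIV. chi (k * x * T x + (k * b) * x))"
    unfolding card_pairs_sum by (simp add: sum.distrib sum_distrib_left)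
  moreover have "\<bar>chi (k * c) * (\<Sum>x\<in>UNIV. chi (k * x * T x + (k * b) * x))\<bar> \<le> 2 * int tau"
    using char_sum_bound[OF k, of "k * b"] chi_cases[of "k * c"] by auto
  ultimately show ?thesis by linarith
qed

end

context tits_field
begin

text \<open>Substituting \<open>w = 1 / (r * r * S r)\<close> gives
  \<open>S w / (w * w) = r * r\<close>, while \<open>1 / w\<close> is the square of
  \<open>r * T r\<close>. Because \<open>chi\<close> is invariant under squaring, square roots may
  be taken inside it, which leads to the exponent handled by \<open>char_sum_bound\<close>.\<close>

lemma sum_chi_quotient:
  assumes "A \<noteq> 0"
  shows "(\<Sum>w\<in>UNIV - {0}. chi (A * (S w + 1 + w * w) / (w * w))) =
    chi A * (\<Sum>r\<in>UNIV - {0}. chi (rt (rt A) * r * T r + rt A * r))"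
proof -
  have "(\<Sum>w\<in>UNIV - {0}. chi (A * (S w + 1 + w * w) / (w * w))) =
      (\<Sum>w\<in>UNIV - {0}. chi A * (chi (A * (S w / (w * w))) * chi (A / (w * w))))"
  proof (rule sum.cong)
    fix w :: 'k assume "w \<in> UNIV - {0}"
    then have "A * (S w + 1 + w * w) / (w * w) = A + (A * (S w / (w * w)) + A / (w * w))"
      by (simp add: distrib_left add_divide_distrib ac_simps)
    then show "chi (A * (S w + 1 + w * w) / (w * w)) = chi A * (chi (A * (S w / (w * w))) * chi (A / (w * w)))"
      by (simp only: chi_add)
  qed simp
  also have "\<dots> = chi A * (\<Sum>w\<in>UNIV - {0}. chi (A * (S w / (w * w))) * chi (A / (w * w)))"
    by (simp only: sum_distrib_left)
  also have "(\<Sum>w\<in>UNIV - {0}. chi (A * (S w / (w * w))) * chi (A / (w * w))) =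
      (\<Sum>r\<in>UNIV - {0}. chi (rt (rt A) * r * T r + rt A * r))"
  proof (rule sum.reindex_bij_witness[of _ "\<lambda>r. 1 / (r * r * S r)" "\<lambda>w. root_T (rt (1 / w))"])
    fix w :: 'k assume w: "w \<in> UNIV - {0}"
    define x where "x = root_T (rt (1 / w))"
    have xT: "x * T x = rt (1 / w)" unfolding x_def by (rule root_T)
    have sq: "x * x * S x = (x * T x) * (x * T x)" by (simp add: S_def ac_simps)
    have xxS: "x * x * S x = 1 / w" unfolding sq xT by simp
    then show "1 / (root_T (rt (1 / w)) * root_T (rt (1 / w)) * S (root_T (rt (1 / w)))) = w"
      unfolding x_def[symmetric] using w by simp
    have x0: "x \<noteq> 0" using xxS w by auto
    then show "root_T (rt (1 / w)) \<in> UNIV - {0}" unfolding x_def by simp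
    have w': "w = 1 / (x * x * S x)" using xxS w by simp
    have 1: "A * (S w / (w * w)) = (rt A * x) * (rt A * x)"
    proof -
      have "S w = 1 / (S x * S x * (x * x))" unfolding w' by (simp add: S_divide S_mult)
      then have "S w / (w * w) = x * x" unfolding w' using x0 by (simp add: field_simps)
      moreover have "(rt A * x) * (rt A * x) = (rt A * rt A) * (x * x)" by (simp only: ac_simps)
      ultimately show ?thesis by simp
    qed
    have 2: "A / (w * w) = (rt A * (x * x * S x)) * (rt A * (x * x * S x))"
    proof -
      have "(rt A * (x * x * S x)) * (rt A * (x * x * S x)) = (rt A * rt A) * ((x * x * S x) * (x * x * S x))"
        by (simp only: ac_simps)
      also have "\<dots> = A * ((1 / w) * (1 / w))" unfolding xxS by simp
      finally show ?thesis by simp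
    qed
    have 3: "rt A * (x * x * S x) = (rt (rt A) * x * T x) * (rt (rt A) * x * T x)"
    proof -
      have "(rt (rt A) * x * T x) * (rt (rt A) * x * T x) = (rt (rt A) * rt (rt A)) * ((x * T x) * (x * T x))"
        by (simp only: ac_simps)
      then show ?thesis unfolding sq by simp
    qed
    show "chi (rt (rt A) * root_T (rt (1 / w)) * T (root_T (rt (1 / w))) + rt A * root_T (rt (1 / w))) =
      chi (A * (S w / (w * w))) * chi (A / (w * w))"
      unfolding x_def[symmetric] 1 2 chi_square 3 chi_add by (simp add: mult.commute)
  next
    fix r :: 'k assume r: "r \<in> UNIV - {0}"
    have "rt (r * r * S r) = r * T r" by (rule rt_unique) (simp add: S_def ac_simps)
    then show "root_T (rt (1 / (1 / (r * r * S r)))) = r" by (simp add: root_T_unique)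
    show "1 / (r * r * S r) \<in> UNIV - {0}" using r by simp
  qed
  finally show ?thesis .
qed

lemma nucleus_form_nonzero: "S w + 1 + w * w \<noteq> 0"
proof
  assume "S w + 1 + w * w = 0"
  moreover have "(T w + w + 1) * (T w + w + 1) = S w + 1 + w * w" by (simp add: S_def char2)
  ultimately have "T w + w + 1 = 0" by simp
  then have "T w + w = 1" by (simp add: add_eq_0_iff2)
  then show False using T_I0[of w] one_notin_I0 by simp
qed

text \<open>For \<open>w \<noteq> 0\<close>, with \<open>D\<close> the coefficient of
  \<open>X * X\<close>, the substitution \<open>X = Z * w / D\<close> yields the Artin-Schreier
  equation \<open>Z * Z + Z = A * D / (w * w)\<close> with \<open>1 + chi\<close> solutions. The
  value \<open>w = 0\<close> contributes the single square root of \<open>A\<close>.\<close>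

lemma card_conic_pairs:
  assumes "A \<noteq> 0"
  shows "int (card {(w, X). X \<noteq> 0 \<and> X * X * (S w + 1 + w * w) + X * w = A}) =
    int (card (UNIV :: 'k set)) + (\<Sum>w\<in>UNIV - {0}. chi (A * (S w + 1 + w * w) / (w * w)))"
proof -
  let ?D = "\<lambda>w. S w + 1 + w * w"
  have w0: "card {X. X \<noteq> 0 \<and> X * X * ?D 0 + X * 0 = A} = 1"
  proof -
    have "X * X = A \<longleftrightarrow> X = rt A" for X using rt_unique by auto
    moreover have "rt A \<noteq> 0" using assms by (metis mult_zero_left rt_square)
    ultimately have "{X. X \<noteq> 0 \<and> X * X * ?D 0 + X * 0 = A} = {rt A}" by auto
    then show ?thesis by simp
  qed
  have w1: "int (card {X. X \<noteq> 0 \<and> X * X * ?D w + X * w = A}) = 1 + chi (A * ?D w / (w * w))" if w: "w \<in> UNIV - {0}" for w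
  proof -
    define D where "D = S w + 1 + w * w"
    have D: "D \<noteq> 0" unfolding D_def by (rule nucleus_form_nonzero)
    have w': "w \<noteq> 0" using w by simp
    have iff: "(Z * w / D) * (Z * w / D) * D + (Z * w / D) * w = A \<longleftrightarrow> Z * Z + Z = A * D / (w * w)" for Z
    proof -
      have e: "(Z * w / D) * (Z * w / D) * D + (Z * w / D) * w = (Z * Z + Z) * (w * w) / D"
        using D by (simp add: distrib_left distrib_right add_divide_distrib ac_simps)
      show ?thesis unfolding e using D w' by (simp add: divide_eq_eq eq_divide_eq)
    qed
    have "card {X. X \<noteq> 0 \<and> X * X * D + X * w = A} = card {Z. Z * Z + Z = A * D / (w * w)}"
    proof (rule bij_betw_same_card[of "\<lambda>X. X * D / w"], rule bij_betw_byWitness[of _ "\<lambda>Z. Z * w / D"])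
      show "(\<lambda>X. X * D / w) ` {X. X \<noteq> 0 \<and> X * X * D + X * w = A} \<subseteq> {Z. Z * Z + Z = A * D / (w * w)}"
      proof (rule image_subsetI)
        fix X assume X: "X \<in> {X. X \<noteq> 0 \<and> X * X * D + X * w = A}"
        have "(X * D / w) * w / D = X" using D w' by simp
        then show "X * D / w \<in> {Z. Z * Z + Z = A * D / (w * w)}" using iff[of "X * D / w"] X by simp
      qed
      show "(\<lambda>Z. Z * w / D) ` {Z. Z * Z + Z = A * D / (w * w)} \<subseteq> {X. X \<noteq> 0 \<and> X * X * D + X * w = A}"
      proof (rule image_subsetI)
        fix Z assume "Z \<in> {Z. Z * Z + Z = A * D / (w * w)}"
        then have eq: "(Z * w / D) * (Z * w / D) * D + (Z * w / D) * w = A" using iff by simp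
        then have "Z * w / D \<noteq> 0" using assms by (metis add.right_neutral mult_zero_left)
        then show "Z * w / D \<in> {X. X \<noteq> 0 \<and> X * X * D + X * w = A}" using eq by blast
      qed
    qed (use D w' in auto)
    then show ?thesis unfolding square_fibre D_def[symmetric] by (simp add: chi_def)
  qed
  have "int (card {(w, X). X \<noteq> 0 \<and> X * X * ?D w + X * w = A}) =
      (\<Sum>w\<in>UNIV. int (card {X. X \<noteq> 0 \<and> X * X * ?D w + X * w = A}))"
    unfolding card_pairs_sum by simp
  also have "\<dots> = 1 + (\<Sum>w\<in>UNIV - {0}. int (card {X. X \<noteq> 0 \<and> X * X * ?D w + X * w = A}))"
    by (subst sum.remove[of UNIV 0]) (use w0 in simp_all)
  also have "\<dots> = 1 + (\<Sum>w\<in>UNIV - {0}. 1 + chi (A * ?D w / (w * w)))"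
    by (rule arg_cong[where f = "(+) 1"], rule sum.cong[OF refl w1])
  also have "\<dots> = 1 + (int (card (UNIV - {0 :: 'k})) + (\<Sum>w\<in>UNIV - {0}. chi (A * ?D w / (w * w))))"
    by (simp add: sum.distrib)
  also have "1 + (int (card (UNIV - {0 :: 'k})) + (\<Sum>w\<in>UNIV - {0}. chi (A * ?D w / (w * w)))) =
      int (card (UNIV :: 'k set)) + (\<Sum>w\<in>UNIV - {0}. chi (A * ?D w / (w * w)))"
    using card_Suc_Diff1[of UNIV "0 :: 'k"] by simp
  finally show ?thesis .
qed

text \<open>Points with \<open>x = 0\<close> give an Artin-Schreier equation. For
  \<open>x \<noteq> 0\<close>, putting \<open>X = x * T x\<close> and \<open>tt x y = X * w\<close>
  makes the equation quadratic in \<open>X\<close>. For nonzero \<open>A\<close> the term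
  \<open>chi A\<close> from \<open>x = 0\<close> is the missing \<open>r = 0\<close> term of the
  other count, so together they give q + 1 plus \<open>chi A\<close> times a complete character
  sum.\<close>

lemma card_section_standard:
  "int (card (UNIV :: 'k set)) + 1 - 2 * int tau \<le> int (card {(x, y). nn x y + tt x y + A = 0})"
proof -
  let ?D = "\<lambda>w. S w + 1 + w * w"
  let ?Q0 = "{t. t * t + t = A}" and ?Q1 = "{(w, X). X \<noteq> 0 \<and> X * X * ?D w + X * w = A}"
  let ?R = "{(x, y). nn x y + tt x y + A = 0}"
  let ?h0 = "\<lambda>t. (0 :: 'k, S t)" and ?h1 = "\<lambda>(w, X). (root_T X, S (X * w) + root_T X * S (root_T X))"
  have R: "(x, y) \<in> ?R \<longleftrightarrow> nn x y + tt x y = A" for x y by (simp add: add_eq_0_iff2)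
  have 0: "?h0 ` ?Q0 \<subseteq> ?R"
    unfolding image_subset_iff R by (auto simp: nn_def tt_def add_eq_0_iff2)
  have 1: "?h1 ` ?Q1 \<subseteq> ?R"
  proof (rule image_subsetI)
    fix p assume p: "p \<in> ?Q1"
    obtain w X where wX: "p = (w, X)" by (rule prod.exhaust)
    define x where "x = root_T X"
    have X: "X = x * T x" unfolding x_def root_T ..
    let ?y = "S (X * w) + x * S x"
    have t: "tt x ?y = X * w" by (simp add: tt_def T_add T_mult X char2)
    have SX: "S X = x * S x" unfolding X by (simp add: S_mult mult.commute)
    have XX: "X * X = x * x * S x" unfolding X S_def by (simp only: ac_simps)
    have "nn x ?y = x * ?y + (X * w) * (X * w)" unfolding nn_tt t ..
    also have "x * ?y = X * X * S w + X * X" unfolding S_mult SX XX by (simp add: char2)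
    finally have "nn x ?y + tt x ?y = X * X * ?D w + X * w" unfolding t by (simp add: char2)
    then have "(x, ?y) \<in> ?R" using p by (simp add: wX add_eq_0_iff2)
    then show "?h1 p \<in> ?R" by (simp add: wX x_def)
  qed
  have "inj ?h0" by (rule injI) simp
  then have i0: "inj_on ?h0 ?Q0" by (rule inj_on_subset) simp
  have i1: "inj_on ?h1 ?Q1"
  proof (rule inj_onI)
    fix p p' assume p: "p \<in> ?Q1" "p' \<in> ?Q1" "?h1 p = ?h1 p'"
    obtain w X w' X' where wX: "p = (w, X)" "p' = (w', X')" by (metis surj_pair)
    have "root_T X = root_T X'" using p(3) by (simp add: wX)
    then have "X = X'" by (metis root_T)
    then have "X * w = X * w'" using p(3) by (simp add: wX)
    then show "p = p'" using p(1) \<open>X = X'\<close> by (simp add: wX)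
  qed
  have dj: "?h0 ` ?Q0 \<inter> ?h1 ` ?Q1 = {}" by auto
  have "card ?Q0 + card ?Q1 = card (?h0 ` ?Q0 \<union> ?h1 ` ?Q1)"
    using i0 i1 dj by (subst card_Un_disjoint) (simp_all add: card_image)
  also have "\<dots> \<le> card ?R" using 0 1 by (intro card_mono) auto
  finally have le: "int (card ?Q0) + int (card ?Q1) \<le> int (card ?R)" by linarith
  have Q0: "int (card ?Q0) = 1 + chi A" unfolding square_fibre by (simp add: chi_def)
  show ?thesis
  proof (cases "A = 0")
    case True
    have "card ((\<lambda>w. (w, w / ?D w)) ` (UNIV - {0 :: 'k})) \<le> card ?Q1"
    proof (rule card_mono)
      show "(\<lambda>w. (w, w / ?D w)) ` (UNIV - {0}) \<subseteq> ?Q1"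
      proof (rule image_subsetI)
        fix w :: 'k assume w: "w \<in> UNIV - {0}"
        have D: "?D w \<noteq> 0" by (rule nucleus_form_nonzero)
        have "w / ?D w * (w / ?D w) * ?D w = w / ?D w * w" using D by simp
        then have "w / ?D w * (w / ?D w) * ?D w + w / ?D w * w = 0" by (simp only: add_self)
        then show "(w, w / ?D w) \<in> ?Q1" using D w True by simp
      qed
    qed simp
    moreover have "card ((\<lambda>w. (w, w / ?D w)) ` (UNIV - {0 :: 'k})) = card (UNIV - {0 :: 'k})"
      by (intro card_image inj_onI) simp
    ultimately have "int (card (UNIV :: 'k set)) \<le> int (card ?Q1) + 1"
      using card_Suc_Diff1[of UNIV "0 :: 'k"] by simp
    then show ?thesis using le Q0 True by simp
  next
    case False
    let ?s = "\<Sum>r\<in>UNIV. chi (rt (rt A) * r * T r + rt A * r)"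
    have "?s = 1 + (\<Sum>r\<in>UNIV - {0}. chi (rt (rt A) * r * T r + rt A * r))"
      by (subst sum.remove[of UNIV 0]) simp_all
    then have "int (card ?Q1) = int (card (UNIV :: 'k set)) + chi A * (?s - 1)"
      unfolding card_conic_pairs[OF False] sum_chi_quotient[OF False] by simp
    then have "int (card ?Q0) + int (card ?Q1) = int (card (UNIV :: 'k set)) + 1 + chi A * ?s"
      unfolding Q0 by (simp add: algebra_simps)
    moreover have "rt (rt A) \<noteq> 0" using False by (metis mult_zero_left rt_square)
    then have "\<bar>?s\<bar> \<le> 2 * int tau" by (rule char_sum_bound)
    then have "\<bar>chi A * ?s\<bar> \<le> 2 * int tau" using chi_cases[of A] by auto
    ultimately show ?thesis using le by linarith
  qed
qed

lemma card_section:
  assumes d: "d \<noteq> 0"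
  shows "int (card (UNIV :: 'k set)) + 1 - 2 * int tau \<le> int (card {(x, y). d * nn x y + tt x y + b * x + g * y + c = 0})"
proof -
  \<comment> \<open>Translation by \<open>(a, b0)\<close> removes the linear terms. Scaling by
    \<open>l\<close>, with \<open>l * T l = 1 / d\<close>, then gives \<open>nn\<close> and
    \<open>tt\<close> the same coefficient \<open>1 / d\<close>.\<close>
  define l a b0 where "l = root_T (1 / d)" and "a = g / d" and "b0 = (b + T a) / d"
  define c' where "c' = c + d * nn a b0 + T b0"
  have l: "l * T l = 1 / d" unfolding l_def by (rule root_T)
  have l0: "l \<noteq> 0" using d by (simp add: l_def)
  have ll: "l * l * S l = (1 / d) * (1 / d)" unfolding l[symmetric] S_def by (simp only: ac_simps)
  have da: "d * a = g" and db: "d * b0 = b + T a" using d by (simp_all add: a_def b0_def)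
  let ?h = "\<lambda>(X, Y). (l * X + a, l * S l * Y + b0 + S a * (l * X))"
  have eq: "d * nn (l * X + a) (l * S l * Y + b0 + S a * (l * X)) + tt (l * X + a) (l * S l * Y + b0 + S a * (l * X))
      + b * (l * X + a) + g * (l * S l * Y + b0 + S a * (l * X)) + c = (nn X Y + tt X Y + d * c') / d" for X Y
  proof -
    define x y where "x = l * X + a" and "y = l * S l * Y + b0 + S a * (l * X)"
    have x: "x + a = l * X" and y: "y + b0 + S a * (x + a) = l * S l * Y" by (simp_all add: x_def y_def ac_simps)
    have n: "nn x y = nn (l * X) (l * S l * Y) + nn a b0 + x * b0 + y * a"
      using nn_translate'[of x y a b0] unfolding y unfolding x .
    have t: "tt x y = tt (l * X) (l * S l * Y) + x * T a + T b0"
      using tt_translate[of x a y b0] unfolding y unfolding x by (simp add: ac_simps)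
    have "d * nn x y + tt x y + b * x + g * y + c = d * nn (l * X) (l * S l * Y) + tt (l * X) (l * S l * Y)
        + x * (d * b0 + T a + b) + y * (d * a + g) + c'"
      unfolding n t c'_def by (simp add: char2)
    also have "d * b0 + T a + b = 0" unfolding db by (simp add: ac_simps)
    also have "d * a + g = 0" unfolding da by simp
    finally have "d * nn x y + tt x y + b * x + g * y + c = d * ((1 / d) * (1 / d) * nn X Y) + 1 / d * tt X Y + c'"
      by (simp add: nn_scale tt_scale ll l)
    also have "\<dots> = (nn X Y + tt X Y + d * c') / d" using d by (simp add: add_divide_distrib)
    finally show ?thesis unfolding x_def y_def .
  qed
  have "card {(x, y). nn x y + tt x y + d * c' = 0} \<le> card {(x, y). d * nn x y + tt x y + b * x + g * y + c = 0}"
  proof (rule card_inj_on_le)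
    show "inj_on ?h {(x, y). nn x y + tt x y + d * c' = 0}" using l0 by (auto intro: inj_onI)
    show "?h ` {(x, y). nn x y + tt x y + d * c' = 0} \<subseteq> {(x, y). d * nn x y + tt x y + b * x + g * y + c = 0}"
      by (rule image_subsetI) (use eq in auto)
  qed simp
  then show ?thesis using card_section_standard[of "d * c'"] by linarith
qed

lemma tau_bound: "2 * tau < card (UNIV :: 'k set)"
proof -
  have "2 * tau * 2 \<le> 2 * tau * tau" using tau_ge by (intro mult_left_mono) auto
  then show ?thesis using tau_ge by (simp add: card_tau)
qed

lemma section_nonempty: "\<exists>x y. d * nn x y + tt x y + b * x + g * y + c = 0"
proof -
  consider "d \<noteq> 0" | "d = 0" "g \<noteq> 0" | "d = 0" "g = 0" by blast
  then show ?thesis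
  proof cases
    case 1
    then have "0 < card {(x, y). d * nn x y + tt x y + b * x + g * y + c = 0}"
      using card_section[OF 1, of b g c] tau_bound by linarith
    then show ?thesis by (auto simp: card_gt_0_iff)
  next
    case 2
    then have "0 < card {(x, y). tt x y + b * x + g * y + c = 0}"
      using card_section_infinity[OF 2(2), of b c] tau_bound by linarith
    then show ?thesis using 2 by (auto simp: card_gt_0_iff)
  next
    case 3
    have "0 * nn 0 (S c) + tt 0 (S c) + b * 0 + 0 * S c + c = 0" by (simp add: tt_def)
    then show ?thesis unfolding 3 by blast
  qed
qed

text \<open>\<open>tpt\<close> lists the points of the Tits ovoid except \<open>(0, 0, 0, 1, 0, 0)\<close>, and \<open>tnuc\<close> the points on the line
  of its nucleus.\<close>

definition tpt :: "'k \<times> 'k \<Rightarrow> 'k vec6" where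
  "tpt = (\<lambda>(x, y). (1, x, tt x y, nn x y, y, tt x y))"

definition tnuc :: "'k \<Rightarrow> 'k vec6" where
  "tnuc l = (0, 0, l, 0, 0, l)"

definition tits_nucleus :: "'k vec6 set" where
  "tits_nucleus = insert (0, 0, 0, 1, 0, 0) (range tpt) \<union> tnuc ` (UNIV - {0})"

lemma d6_tpt: "d6 (tpt (x, y)) (tpt (a, b)) = 0 \<longleftrightarrow> x = a \<and> y = b"
proof -
  have "d6 (tpt (x, y)) (tpt (a, b)) = nn x y + nn a b + x * b + y * a"
    by (simp add: tpt_def nn_tt char2)
  then show ?thesis by (simp only: nn_difference)
qed

lemma d6_tits_nucleus:
  "d6 (tpt (x, y)) (0, 0, 0, 1, 0, 0) = 1" "d6 (0, 0, 0, 1, 0, 0) (tpt (x, y)) = 1"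
  "d6 (tpt (x, y)) (tnuc l) = l * l" "d6 (tnuc l) (tpt (x, y)) = l * l"
  "d6 (0, 0, 0, 1, 0, 0) (tnuc l) = l * l" "d6 (tnuc l) (0, 0, 0, 1, 0, 0) = l * l"
  by (simp_all add: tpt_def tnuc_def nn_tt char2)

lemma d6_tnuc: "d6 (tnuc l) (tnuc l') = 0 \<longleftrightarrow> l = l'"
  by (simp add: tnuc_def add_eq_0_iff2)

lemma tits_nucleus_cases:
  assumes "z \<in> tits_nucleus"
  shows "(\<exists>x y. z = tpt (x, y)) \<or> z = (0, 0, 0, 1, 0, 0) \<or> (\<exists>l. z = tnuc l \<and> l \<noteq> 0)"
proof -
  have "z = (0, 0, 0, 1, 0, 0) \<or> z \<in> range tpt \<or> z \<in> tnuc ` (UNIV - {0})"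
    using assms unfolding tits_nucleus_def Un_iff insert_iff by blast
  then show ?thesis
  proof (elim disjE)
    assume "z \<in> range tpt"
    then obtain p where p: "z = tpt p" by blast
    obtain a b where "p = (a, b)" by (rule prod.exhaust)
    then show ?thesis using p by blast
  next
    assume "z \<in> tnuc ` (UNIV - {0})"
    then show ?thesis by blast
  qed blast
qed

lemma tits_nucleus_clique:
  assumes "x \<in> tits_nucleus" "y \<in> tits_nucleus" "x \<noteq> y"
  shows "d6 x y \<noteq> 0"
  using tits_nucleus_cases[OF assms(1)] tits_nucleus_cases[OF assms(2)] assms(3)
  by (elim disjE exE conjE) (auto simp del: d6_simp simp: d6_tpt d6_tits_nucleus d6_tnuc)

text \<open>If \<open>z\<close> is not orthogonal to the nucleus, its section of the ovoid is
  nonempty by the character sum bound. Otherwise a nonzero \<open>Q\<close> is matched by the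
  nucleus point with parameter \<open>rt Q\<close>. For \<open>Q = 0\<close> the section passes
  through the nucleus and always contains an ovoid point, possibly the one at infinity.\<close>

lemma tits_nucleus_maximal: "\<exists>x\<in>tits_nucleus. d6 z x = 0"
proof -
  obtain a1 a2 a3 c1 c2 c3 where z: "z = (a1, a2, a3, c1, c2, c3)" by (metis surj_pair)
  define Q where "Q = a1 * c1 + a2 * c2 + a3 * c3"
  have pt: "d6 z (tpt (x, y)) = a1 * nn x y + (a3 + c3) * tt x y + c2 * x + a2 * y + (Q + c1)" for x y
    by (simp add: z tpt_def Q_def nn_tt char2)
  have in_pt: "tpt (x, y) \<in> tits_nucleus" for x y unfolding tits_nucleus_def by blast
  show ?thesis
  proof (cases "a3 + c3 = 0")
    case False
    define w where "w = a3 + c3"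
    obtain x y where "a1 / w * nn x y + tt x y + c2 / w * x + a2 / w * y + (Q + c1) / w = 0"
      using section_nonempty by blast
    moreover have "a1 / w * nn x y + tt x y + c2 / w * x + a2 / w * y + (Q + c1) / w = d6 z (tpt (x, y)) / w"
      using False unfolding pt w_def[symmetric] by (simp add: add_divide_distrib)
    ultimately have "d6 z (tpt (x, y)) = 0" using False by (simp add: w_def del: d6_simp)
    then show ?thesis using in_pt by blast
  next
    case w: True
    have nuc: "d6 z (tnuc l) = Q + l * l" for l
    proof -
      have "d6 z (tnuc l) = Q + l * (a3 + c3) + l * l" by (simp add: z tnuc_def Q_def char2)
      then show ?thesis by (simp add: w)
    qed
    show ?thesis
    proof (cases "Q = 0")
      case False
      then have "rt Q \<noteq> 0" by (metis mult_zero_left rt_square)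
      moreover have "d6 z (tnuc (rt Q)) = 0" unfolding nuc by simp
      ultimately show ?thesis unfolding tits_nucleus_def by blast
    next
      case Q: True
      show ?thesis
      proof (cases "a1 = 0")
        case True
        have "d6 z (0, 0, 0, 1, 0, 0) = Q + a1" by (simp add: z Q_def char2)
        then have "d6 z (0, 0, 0, 1, 0, 0) = 0" by (simp only: Q True) simp
        then show ?thesis unfolding tits_nucleus_def by blast
      next
        case False
        \<comment> \<open>Translation by \<open>(a, b)\<close> reduces the section to
          \<open>nn x y = k\<close>, which has the solution \<open>(0, T k)\<close>; translated back
          this is \<open>(?x, ?y)\<close>.\<close>
        define a b where "a = a2 / a1" and "b = c2 / a1"
        define k where "k = nn a b + c1 / a1"
        let ?x = "a" and ?y = "T k + b"
        have e: "a2 = a1 * a" "c2 = a1 * b" "c1 = a1 * (nn a b + k)"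
          using False by (simp_all add: a_def b_def k_def)
        have "nn ?x ?y = k + nn a b + a * b + ?y * a"
          using nn_translate'[of a "T k + b" a b] by (simp add: add.assoc nn_def[of 0])
        then have "d6 z (tpt (?x, ?y)) = 0"
          unfolding pt w Q e by (simp add: char2)
        then show ?thesis using in_pt by blast
      qed
    qed
  qed
qed

lemma card_tits_nucleus: "card tits_nucleus = card (UNIV :: 'k set) ^ 2 + card (UNIV :: 'k set)"
proof -
  have fin: "finite (UNIV :: ('k \<times> 'k) set)" by (rule finite_points)
  have "inj tpt" by (auto simp: inj_def tpt_def)
  then have "card (range tpt) = card (UNIV :: 'k set) ^ 2"
    by (simp add: card_image power2_eq_square card_cartesian_product flip: UNIV_Times_UNIV)
  moreover have "(0, 0, 0, 1, 0, 0) \<notin> range tpt" by (auto simp: tpt_def)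
  ultimately have 1: "card (insert (0, 0, 0, 1, 0, 0) (range tpt)) = Suc (card (UNIV :: 'k set) ^ 2)"
    using fin by simp
  have "card (tnuc ` (UNIV - {0})) = card (UNIV - {0 :: 'k})"
    by (intro card_image inj_onI) (simp add: tnuc_def)
  then have 2: "Suc (card (tnuc ` (UNIV - {0}))) = card (UNIV :: 'k set)"
    using card_Suc_Diff1[of UNIV "0 :: 'k"] by simp
  have "insert (0, 0, 0, 1, 0, 0) (range tpt) \<inter> tnuc ` (UNIV - {0}) = {}"
    by (auto simp: tpt_def tnuc_def)
  then have "card tits_nucleus = card (insert (0, 0, 0, 1, 0, 0) (range tpt)) + card (tnuc ` (UNIV - {0}))"
    unfolding tits_nucleus_def using fin by (intro card_Un_disjoint) auto
  then show ?thesis using 1 2 by simp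
qed

section \<open>Points of a section on the lines of the removed plane sections\<close>

lemma avoid_lines:
  fixes R :: "('k \<times> 'k) set"
  assumes "card {y. (0, y) \<in> R} \<le> B0" "\<And>m. m \<in> M \<Longrightarrow> card {x. (x, m * x) \<in> R} \<le> B1" "B0 + card M * B1 < card R"
  shows "\<exists>x y. (x, y) \<in> R \<and> x \<noteq> 0 \<and> (\<forall>m\<in>M. y \<noteq> m * x)"
proof (rule ccontr)
  assume no: "\<not> ?thesis"
  have "R \<subseteq> (\<lambda>y. (0 :: 'k, y)) ` {y. (0, y) \<in> R} \<union> (\<Union>m\<in>M. (\<lambda>x. (x, m * x)) ` {x. (x, m * x) \<in> R})"
  proof
    fix p assume p: "p \<in> R"
    obtain x y where xy: "p = (x, y)" by (rule prod.exhaust)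
    then have "x = 0 \<or> (\<exists>m\<in>M. y = m * x)" using no p by blast
    then show "p \<in> (\<lambda>y. (0 :: 'k, y)) ` {y. (0, y) \<in> R} \<union> (\<Union>m\<in>M. (\<lambda>x. (x, m * x)) ` {x. (x, m * x) \<in> R})"
      using p unfolding xy by blast
  qed
  then have "card R \<le> card ((\<lambda>y. (0 :: 'k, y)) ` {y. (0, y) \<in> R} \<union> (\<Union>m\<in>M. (\<lambda>x. (x, m * x)) ` {x. (x, m * x) \<in> R}))"
    by (intro card_mono) auto
  also have "\<dots> \<le> card ((\<lambda>y. (0 :: 'k, y)) ` {y. (0, y) \<in> R}) + card (\<Union>m\<in>M. (\<lambda>x. (x, m * x)) ` {x. (x, m * x) \<in> R})"
    by (rule card_Un_le)
  also have "card ((\<lambda>y. (0 :: 'k, y)) ` {y. (0, y) \<in> R}) \<le> B0"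
    by (rule order_trans[OF card_image_le assms(1)]) simp
  also have "card (\<Union>m\<in>M. (\<lambda>x. (x, m * x)) ` {x. (x, m * x) \<in> R}) \<le> (\<Sum>m\<in>M. card ((\<lambda>x. (x, m * x)) ` {x. (x, m * x) \<in> R}))"
    by (rule card_UN_le) simp
  also have "\<dots> \<le> (\<Sum>m\<in>M. B1)"
    by (intro sum_mono order_trans[OF card_image_le assms(2)]) simp_all
  finally show False using assms(3) by simp
qed

lemma card_monom_roots:
  fixes p :: "'k poly"
  assumes "coeff p n \<noteq> 0" "\<And>i. i > n \<Longrightarrow> coeff p i = 0" "\<And>x. F x = poly p x"
  shows "card {x. F x = 0} \<le> n"
  unfolding assms(3) using assms(1,2) by (intro card_roots_le degree_le) auto

lemma card_vertical_finite:
  assumes "d \<noteq> 0"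
  shows "card {y. d * S y + w * T y + g * y + c = 0} \<le> 2 * tau"
proof (rule card_monom_roots)
  let ?p = "monom d (2 * tau) + monom w tau + monom g 1 + monom c 0"
  show "coeff ?p (2 * tau) \<noteq> 0" using assms tau_ge by simp
  show "coeff ?p i = 0" if "i > 2 * tau" for i using that tau_ge by simp
  show "d * S x + w * T x + g * x + c = poly ?p x" for x by (simp add: poly_monom S_power T_def)
qed

lemma card_vertical_infinity: "card {y. T y + g * y + c = 0} \<le> tau"
proof (rule card_monom_roots)
  let ?p = "monom 1 tau + monom g 1 + monom c 0"
  show "coeff ?p tau \<noteq> 0" using tau_ge by simp
  show "coeff ?p i = 0" if "i > tau" for i using that tau_ge by simp
  show "T x + g * x + c = poly ?p x" for x by (simp add: poly_monom T_def)
qed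

lemma card_line_planar: "card {x. nn x (m * x) + a * x + g * (m * x) + c = 0} \<le> 2 * tau + 2"
proof (rule card_monom_roots)
  let ?p = "monom 1 (2 * tau + 2) + monom (S m) (2 * tau) + monom m 2 + monom (a + g * m) 1 + monom c 0"
  show "coeff ?p (2 * tau + 2) \<noteq> 0" using tau_ge by simp
  show "coeff ?p i = 0" if "i > 2 * tau + 2" for i using that tau_ge by simp
  show "nn x (m * x) + a * x + g * (m * x) + c = poly ?p x" for x
  proof -
    have pw: "x ^ (2 * tau + 2) = S x * (x * x)" by (simp add: S_power power_add power2_eq_square)
    show ?thesis unfolding poly_add poly_monom pw S_power[of x, symmetric] nn_def S_mult
      by (simp add: power2_eq_square char2)
  qed
qed

lemma card_line_infinity: "card {x. tt x (m * x) + a * x + g * (m * x) + c = 0} \<le> tau + 1"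
proof (rule card_monom_roots)
  let ?p = "monom 1 (tau + 1) + monom (T m) tau + monom (a + g * m) 1 + monom c 0"
  show "coeff ?p (tau + 1) \<noteq> 0" using tau_ge by simp
  show "coeff ?p i = 0" if "i > tau + 1" for i using that tau_ge by simp
  show "tt x (m * x) + a * x + g * (m * x) + c = poly ?p x" for x
    by (simp add: poly_monom tt_def T_mult char2 flip: T_def)
qed

text \<open>The equation of the section restricted to a line has degree \<open>2 * tau + 2\<close>.  Combining it with its
  image under \<open>S\<close> eliminates the terms of high degree.\<close>

lemma card_line:
  assumes d: "d \<noteq> 0"
  shows "card {x. d * nn x (m * x) + tt x (m * x) + a * x + g * (m * x) + c = 0} \<le> tau + 2"
proof -
  \<comment> \<open>Since \<open>tt x (m * x) = (x + T m) * T x\<close>, the shift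
    \<open>x = X + T m\<close> reduces it to \<open>X * T X + r * X\<close>, where \<open>r\<close>
    is the square root of \<open>m\<close>.\<close>
  define r where "r = T (T m)"
  have rr: "r * r = m" unfolding r_def by (rule TT)
  define l k where "l = r + a + g * m" and "k = d * (m * S m) + a * T m + g * (m * T m) + c"
  have line: "d * nn x (m * x) + tt x (m * x) + a * x + g * (m * x) + c =
      d * (X * X * S X) + X * T X + l * X + k" if x: "x = X + T m" for x X
  proof -
    have t: "tt x (m * x) = X * T X + r * X"
      by (simp add: tt_def x T_add T_mult r_def char2)
    have "nn x (m * x) = r * r * ((X + T m) * (X + T m)) + (X * T X + r * X) * (X * T X + r * X)"
      unfolding nn_tt t rr by (simp add: x ac_simps)
    also have "\<dots> = X * X * S X + r * r * S m" by (simp add: S_def char2)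
    finally have n: "nn x (m * x) = X * X * S X + m * S m" unfolding rr .
    show ?thesis unfolding n t l_def k_def by (simp add: x char2)
  qed
  define e1 e2 e3 e4 where "e1 = S d + d * d * S l" and "e2 = d * S d * (l * l) + d * d * d * S k + d * d * l"
    and "e3 = e1 * l + d * d * k" and "e4 = e1 * k + d * S d * (k * k)"
  have low: "d * d * (X * X * T X) + e1 * (X * T X) + e2 * (X * X) + e3 * X + e4 = 0"
    if E: "d * (X * X * S X) + X * T X + l * X + k = 0" for X
  proof -
    define L where "L = X * T X + l * X + k"
    have E1: "d * (X * X * S X) = L" using E unfolding L_def by (simp add: add_eq_0_iff2 add.assoc)
    have "S (d * (X * X * S X) + X * T X + l * X + k) = S 0" by (simp only: E)
    then have E2: "S d * (S X * S X * (X * X)) + S X * X + S l * S X + S k = 0"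
      by (simp add: S_add S_mult)
    have LL: "d * (L * L) = L + d * (l * l * (X * X)) + d * (k * k)"
    proof -
      have "L * L = X * X * S X + l * l * (X * X) + k * k" by (simp add: L_def S_def char2)
      then show ?thesis unfolding E1[symmetric] by (simp add: distrib_left)
    qed
    have "0 = d * (d * d * (X * X) * (S d * (S X * S X * (X * X)) + S X * X + S l * S X + S k))"
      unfolding E2 by simp
    also have "\<dots> = d * (S d * (d * (X * X * S X) * (d * (X * X * S X))) + d * X * (d * (X * X * S X))
        + d * S l * (d * (X * X * S X)) + d * d * S k * (X * X))"
      by (simp only: distrib_left distrib_right ac_simps)
    also have "\<dots> = S d * (d * (L * L)) + d * (d * X * L + d * S l * L + d * d * S k * (X * X))"
      unfolding E1 by (simp only: distrib_left distrib_right ac_simps)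
    also have "\<dots> = d * d * (X * X * T X) + e1 * (X * T X) + e2 * (X * X) + e3 * X + e4"
      unfolding LL unfolding L_def e1_def e2_def e3_def e4_def by (simp add: char2)
    finally show ?thesis by simp
  qed
  have "card {X. d * d * (X * X * T X) + e1 * (X * T X) + e2 * (X * X) + e3 * X + e4 = 0} \<le> tau + 2"
  proof (rule card_monom_roots)
    let ?p = "monom (d * d) (tau + 2) + monom e1 (tau + 1) + monom e2 2 + monom e3 1 + monom e4 0"
    show "coeff ?p (tau + 2) \<noteq> 0" using d tau_ge by simp
    show "coeff ?p i = 0" if "i > tau + 2" for i using that tau_ge by simp
    show "d * d * (x * x * T x) + e1 * (x * T x) + e2 * (x * x) + e3 * x + e4 = poly ?p x" for x
      by (simp add: poly_monom power_add power2_eq_square ac_simps flip: T_def)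
  qed
  moreover have "{x. d * nn x (m * x) + tt x (m * x) + a * x + g * (m * x) + c = 0} \<subseteq>
    (\<lambda>X. X + T m) ` {X. d * d * (X * X * T X) + e1 * (X * T X) + e2 * (X * X) + e3 * X + e4 = 0}"
  proof
    fix x assume x: "x \<in> {x. d * nn x (m * x) + tt x (m * x) + a * x + g * (m * x) + c = 0}"
    have xX: "x = (x + T m) + T m" by (simp add: add.assoc)
    show "x \<in> (\<lambda>X. X + T m) ` {X. d * d * (X * X * T X) + e1 * (X * T X) + e2 * (X * X) + e3 * X + e4 = 0}"
      using x line[OF xX] low[of "x + T m"] xX by (intro image_eqI[of _ _ "x + T m"]) simp_all
  qed
  ultimately show ?thesis by (meson card_image_le card_mono finite_imageI finite_set order_trans)
qed

end

section \<open>Replacing plane sections of the Tits ovoid by their poles\<close>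

context tits_field
begin

text \<open>The Tits ovoid with coordinates arranged so that the base point of the chart is the pole
  of the section \<open>x = 0\<close>; its affine points inside the chart are those with
  \<open>x \<noteq> 0\<close>.\<close>

definition pt8 :: "'k \<Rightarrow> 'k \<Rightarrow> 'k vec8" where
  "pt8 x y = (1, tt x y, 0, y, nn x y, tt x y, 0, x)"

definition con8 :: "'k \<Rightarrow> 'k vec8" where
  "con8 m = (0, T (T m), 0, m, 0, T (T m), 0, 1)"

text \<open>The points \<open>con8 m\<close> and the base point of the chart lie on the conic of singular points orthogonal
  to two points of the Tits ovoid.\<close>

definition tits_derived :: "'k set \<Rightarrow> 'k vec8 set" where
  "tits_derived M = {pt8 x y | x y. x \<noteq> 0 \<and> (\<forall>m\<in>M. y \<noteq> m * x)} \<union> con8 ` M"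

lemma b8_pt8: "b8 (pt8 x y) (pt8 a b) = nn x y + nn a b + x * b + y * a"
  by (simp add: pt8_def char2)

lemma b8_con8: "b8 (con8 m) (pt8 x y) = y + m * x" "b8 (pt8 x y) (con8 m) = y + m * x" "b8 (con8 m) (con8 m') = m + m'"
  by (simp_all add: pt8_def con8_def char2)

lemma tits_derived_singular:
  assumes "z \<in> tits_derived M"
  shows "q8 z = 0 \<and> last8 z \<noteq> 0"
proof -
  have "q8 (pt8 x y) = 0" "last8 (pt8 x y) = x" for x y by (simp_all add: pt8_def nn_tt char2)
  moreover have "q8 (con8 m) = 0" "last8 (con8 m) = 1" for m by (simp_all add: con8_def TT)
  ultimately show ?thesis using assms unfolding tits_derived_def by auto
qed

lemma tits_derived_clique:
  assumes "z \<in> tits_derived M" "z' \<in> tits_derived M" "z \<noteq> z'"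
  shows "b8 z z' \<noteq> 0"
proof -
  have cases: "(\<exists>x y. z = pt8 x y \<and> (\<forall>m\<in>M. y \<noteq> m * x)) \<or> (\<exists>m\<in>M. z = con8 m)" if "z \<in> tits_derived M" for z
    using that unfolding tits_derived_def by blast
  from cases[OF assms(1)] show ?thesis
  proof (elim disjE exE bexE conjE)
    fix x y assume z: "z = pt8 x y" "\<forall>m\<in>M. y \<noteq> m * x"
    from cases[OF assms(2)] show ?thesis
    proof (elim disjE exE bexE conjE)
      fix a b assume "z' = pt8 a b"
      then have "\<not> (x = a \<and> y = b)" "b8 z z' = nn x y + nn a b + x * b + y * a" using assms(3) z by (auto simp: b8_pt8)
      then show ?thesis by (simp only: nn_difference) simp
    next
      fix m assume "m \<in> M" "z' = con8 m"
      then show ?thesis using z by (simp add: b8_con8 add_eq_0_iff2)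
    qed
  next
    fix m assume m: "m \<in> M" "z = con8 m"
    from cases[OF assms(2)] show ?thesis
    proof (elim disjE exE bexE conjE)
      fix a b assume "z' = pt8 a b" "\<forall>m\<in>M. b \<noteq> m * a"
      then show ?thesis using m by (simp add: b8_con8 add_eq_0_iff2)
    next
      fix m' assume "m' \<in> M" "z' = con8 m'"
      then show ?thesis using m assms(3) by (auto simp: b8_con8 add_eq_0_iff2)
    qed
  qed
qed

text \<open>Hyperplanes through the nucleus. A tangent one meets the affine ovoid in the single
  point \<open>(g', a')\<close>, which \<open>nz\<close> keeps off the removed sections. A
  nontangent one with \<open>d \<noteq> 0\<close> has at least q points, and
  \<open>2 * tau + card M * (2 * tau + 2) < 2 * tau * tau\<close> is the inequality that limits
  \<open>card M\<close> to \<open>tau - 2\<close>: it already fails for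
  \<open>tau - 1\<close>.\<close>

lemma planar_avoiding:
  assumes M: "card M + 2 \<le> tau" and g: "g \<noteq> 0" and nz: "\<And>m. m \<in> M \<Longrightarrow> a + g * m \<noteq> 0"
  shows "\<exists>x y. d * nn x y + a * x + g * y + c = 0 \<and> x \<noteq> 0 \<and> (\<forall>m\<in>M. y \<noteq> m * x)"
proof (cases "d = 0")
  case True
  have cM: "card (insert 0 ((\<lambda>m. c / (a + g * m)) ` M)) \<le> card M + 1"
    using card_image_le[of M "\<lambda>m. c / (a + g * m)"] by (simp add: card_insert_if)
  also have "\<dots> < card (UNIV :: 'k set)" using M tau_bound by linarith
  finally have "insert 0 ((\<lambda>m. c / (a + g * m)) ` M) \<noteq> UNIV" by auto
  then obtain x where x: "x \<notin> insert 0 ((\<lambda>m. c / (a + g * m)) ` M)" by blast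
  define y where "y = (a * x + c) / g"
  have gy: "g * y = a * x + c" using g by (simp add: y_def)
  have "y \<noteq> m * x" if m: "m \<in> M" for m
  proof
    assume "y = m * x"
    then have "a * x + c = g * m * x" using gy by (simp add: mult.assoc)
    then have "x * (a + g * m) = c" by (metis add.commute add_self_left distrib_left mult.commute)
    then have "x = c / (a + g * m)" using nz[OF m] by (metis nonzero_mult_div_cancel_right)
    then show False using x m by blast
  qed
  moreover have "d * nn x y + a * x + g * y + c = 0" unfolding True gy by (simp add: ac_simps)
  ultimately show ?thesis using x by blast
next
  case d: False
  define a' g' c' where "a' = a / d" and "g' = g / d" and "c' = c / d"
  have e: "a = d * a'" "g = d * g'" "c = d * c'" using d by (simp_all add: a'_def g'_def c'_def)
  have "\<exists>x y. nn x y + a' * x + g' * y + c' = 0 \<and> x \<noteq> 0 \<and> (\<forall>m\<in>M. y \<noteq> m * x)"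
  proof (cases "nn g' a' + c' = 0")
    case True
    have "nn g' a' + a' * g' + g' * a' + c' = 0" using True by (simp add: ac_simps)
    moreover have "g' \<noteq> 0" using g d by (simp add: g'_def)
    moreover have "a' \<noteq> m * g'" if "m \<in> M" for m
    proof
      assume "a' = m * g'"
      then have "a + g * m = 0" unfolding e by (simp add: ac_simps)
      then show False using nz[OF that] by blast
    qed
    ultimately show ?thesis by blast
  next
    case False
    let ?R = "{(x, y). nn x y + a' * x + g' * y + c' = 0}"
    have "\<exists>x y. (x, y) \<in> ?R \<and> x \<noteq> 0 \<and> (\<forall>m\<in>M. y \<noteq> m * x)"
    proof (rule avoid_lines[of _ "2 * tau" _ "2 * tau + 2"])
      show "card {y. (0, y) \<in> ?R} \<le> 2 * tau"
        using card_vertical_finite[of 1 0 g' c'] by (simp add: nn_def)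
      show "card {x. (x, m * x) \<in> ?R} \<le> 2 * tau + 2" for m
        using card_line_planar[of m a' g' c'] by simp
      obtain j where j: "tau = card M + 2 + j" using M le_Suc_ex by blast
      have "2 * tau + card M * (2 * tau + 2) < 2 * tau * tau" unfolding j by (simp add: algebra_simps)
      also have "\<dots> \<le> card ?R" using card_planar_section[OF False] by (simp add: card_tau)
      finally show "2 * tau + card M * (2 * tau + 2) < card ?R" .
    qed
    then show ?thesis by simp
  qed
  then obtain x y where xy: "nn x y + a' * x + g' * y + c' = 0" "x \<noteq> 0" "\<forall>m\<in>M. y \<noteq> m * x" by blast
  have "d * nn x y + a * x + g * y + c = d * (nn x y + a' * x + g' * y + c')"
    unfolding e by (simp add: distrib_left ac_simps)
  then show ?thesis using xy by auto
qed

text \<open>For a nonzero \<open>nn\<close> coefficient the guaranteed size is only q + 1 - 2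
  \<open>tau\<close>, so \<open>2 * tau + 2\<close> points per line would be too many in general;
  the bound \<open>tau + 2\<close> from \<open>card_line\<close> closes the gap.\<close>

lemma nonplanar_avoiding:
  assumes M: "card M + 2 \<le> tau" and g: "g \<noteq> 0"
  shows "\<exists>x y. d * nn x y + tt x y + a * x + g * y + c = 0 \<and> x \<noteq> 0 \<and> (\<forall>m\<in>M. y \<noteq> m * x)"
proof -
  let ?R = "{(x, y). d * nn x y + tt x y + a * x + g * y + c = 0}"
  obtain j where j: "tau = card M + 2 + j" using M le_Suc_ex by blast
  have "\<exists>x y. (x, y) \<in> ?R \<and> x \<noteq> 0 \<and> (\<forall>m\<in>M. y \<noteq> m * x)"
  proof (cases "d = 0")
    case True
    show ?thesis
    proof (rule avoid_lines[of _ tau _ "tau + 1"])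
      show "card {y. (0, y) \<in> ?R} \<le> tau"
        using card_vertical_infinity[of g c] by (simp add: True tt_def)
      show "card {x. (x, m * x) \<in> ?R} \<le> tau + 1" for m
        using card_line_infinity[of m a g c] by (simp add: True)
      have "tau + card M * (tau + 1) + 2 * tau < 2 * tau * tau" unfolding j by (simp add: algebra_simps)
      moreover have "int (2 * tau * tau) \<le> int (card ?R + 2 * tau)"
        using card_section_infinity[OF g, of a c] by (simp add: card_tau True)
      then have "2 * tau * tau \<le> card ?R + 2 * tau" by (simp only: of_nat_le_iff)
      ultimately show "tau + card M * (tau + 1) < card ?R" by linarith
    qed
  next
    case False
    show ?thesis
    proof (rule avoid_lines[of _ "2 * tau" _ "tau + 2"])
      show "card {y. (0, y) \<in> ?R} \<le> 2 * tau"
        using card_vertical_finite[OF False, of 1 g c] by (simp add: nn_def tt_def)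
      show "card {x. (x, m * x) \<in> ?R} \<le> tau + 2" for m
        using card_line[OF False, of m a g c] by simp
      have "2 * tau + card M * (tau + 2) + 2 * tau < 2 * tau * tau + 1" unfolding j by (simp add: algebra_simps)
      moreover have "int (2 * tau * tau + 1) \<le> int (card ?R + 2 * tau)"
        using card_section[OF False, of a g c] by (simp add: card_tau)
      then have "2 * tau * tau + 1 \<le> card ?R + 2 * tau" by (simp only: of_nat_le_iff)
      ultimately show "2 * tau + card M * (tau + 2) < card ?R" by linarith
    qed
  qed
  then show ?thesis by simp
qed

lemma tits_derived_maximal:
  assumes M: "card M + 2 \<le> tau" and z: "last8 z \<noteq> 0"
  shows "\<exists>x\<in>tits_derived M. b8 z x = 0"
proof (rule ccontr)
  assume no: "\<not> ?thesis"
  obtain a1 a2 a3 a4 c1 c2 c3 c4 where zz: "z = (a1, a2, a3, a4, c1, c2, c3, c4)" by (metis surj_pair)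
  have c4: "c4 \<noteq> 0" using z by (simp add: zz)
  \<comment> \<open>The value of the polar form at \<open>z\<close> and the nucleus
    \<open>(0, 1, 0, 0, 0, 1, 0, 0)\<close>.\<close>
  define w where "w = a2 + c2"
  have pt: "b8 z (pt8 x y) = a1 * nn x y + w * tt x y + a4 * x + c4 * y + c1" for x y
    by (simp add: zz pt8_def w_def char2)
  have con: "b8 z (con8 m) = a4 + c4 * m + w * T (T m)" for m
    by (simp add: zz con8_def w_def char2)
  have nopt: "b8 z (pt8 x y) \<noteq> 0" if "x \<noteq> 0" "\<forall>m\<in>M. y \<noteq> m * x" for x y
    using no that unfolding tits_derived_def by blast
  show False
  proof (cases "w = 0")
    case True
    have nz: "a4 + c4 * m \<noteq> 0" if "m \<in> M" for m
    proof -
      have "b8 z (con8 m) \<noteq> 0" using no that unfolding tits_derived_def by blast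
      then show ?thesis unfolding con True by simp
    qed
    obtain x y where "a1 * nn x y + a4 * x + c4 * y + c1 = 0" "x \<noteq> 0" "\<forall>m\<in>M. y \<noteq> m * x"
      using planar_avoiding[OF M c4 nz] by blast
    then show False using nopt[of x y] unfolding pt True by simp
  next
    case False
    then have "c4 / w \<noteq> 0" using c4 by simp
    then obtain x y where xy: "a1 / w * nn x y + tt x y + a4 / w * x + c4 / w * y + c1 / w = 0" "x \<noteq> 0" "\<forall>m\<in>M. y \<noteq> m * x"
      using nonplanar_avoiding[OF M] by blast
    have "b8 z (pt8 x y) = w * (a1 / w * nn x y + tt x y + a4 / w * x + c4 / w * y + c1 / w)"
      unfolding pt using False by (simp add: distrib_left)
    then have "b8 z (pt8 x y) = 0" unfolding xy by simp
    then show False using nopt xy by blast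
  qed
qed

lemma card_tits_derived:
  "card (tits_derived M) = (card (UNIV :: 'k set) - 1) * (card (UNIV :: 'k set) - card M) + card M"
proof -
  let ?h = "\<lambda>(x, u). pt8 x (u * x)"
  have eq: "{pt8 x y | x y. x \<noteq> 0 \<and> (\<forall>m\<in>M. y \<noteq> m * x)} = ?h ` ((UNIV - {0}) \<times> (UNIV - M))"
  proof
    show "{pt8 x y | x y. x \<noteq> 0 \<and> (\<forall>m\<in>M. y \<noteq> m * x)} \<subseteq> ?h ` ((UNIV - {0}) \<times> (UNIV - M))"
    proof
      fix z assume "z \<in> {pt8 x y | x y. x \<noteq> 0 \<and> (\<forall>m\<in>M. y \<noteq> m * x)}"
      then obtain x y where xy: "z = pt8 x y" "x \<noteq> 0" "\<forall>m\<in>M. y \<noteq> m * x" by blast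
      have "y = y / x * x" using xy by simp
      then have "y / x \<notin> M" "z = ?h (x, y / x)" using xy by auto
      then show "z \<in> ?h ` ((UNIV - {0}) \<times> (UNIV - M))" using xy(2) by blast
    qed
    show "?h ` ((UNIV - {0}) \<times> (UNIV - M)) \<subseteq> {pt8 x y | x y. x \<noteq> 0 \<and> (\<forall>m\<in>M. y \<noteq> m * x)}"
    proof (rule image_subsetI)
      fix p :: "'k \<times> 'k" assume "p \<in> (UNIV - {0}) \<times> (UNIV - M)"
      then obtain x u where p: "p = (x, u)" "x \<noteq> 0" "u \<notin> M" by blast
      then have "\<forall>m\<in>M. u * x \<noteq> m * x" by auto
      then show "?h p \<in> {pt8 x y | x y. x \<noteq> 0 \<and> (\<forall>m\<in>M. y \<noteq> m * x)}" using p(2) unfolding p(1) prod.case by blast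
    qed
  qed
  have "inj_on ?h ((UNIV - {0}) \<times> (UNIV - M))" by (rule inj_onI) (auto simp: pt8_def)
  then have 1: "card {pt8 x y | x y. x \<noteq> 0 \<and> (\<forall>m\<in>M. y \<noteq> m * x)} = (card (UNIV :: 'k set) - 1) * (card (UNIV :: 'k set) - card M)"
    unfolding eq by (simp add: card_image card_cartesian_product card_Diff_subset)
  have "inj_on con8 M" by (rule inj_onI) (simp add: con8_def)
  then have 2: "card (con8 ` M) = card M" by (rule card_image)
  have "{pt8 x y | x y. x \<noteq> 0 \<and> (\<forall>m\<in>M. y \<noteq> m * x)} \<inter> con8 ` M = {}" by (auto simp: pt8_def con8_def)
  moreover have "finite {pt8 x y | x y. x \<noteq> 0 \<and> (\<forall>m\<in>M. y \<noteq> m * x)}" unfolding eq by simp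
  ultimately show ?thesis unfolding tits_derived_def using 1 2 by (subst card_Un_disjoint) auto
qed

end

context Sp6_char2
begin

lemma maximal_spread_tits_nucleus:
  assumes q: "q = 2 ^ (2 * e + 1)" and e: "e \<ge> 1"
  shows "has_maximal_spread_of_size (int q ^ 2 + int q + 1)"
proof -
  interpret tits_field "TYPE('k)" e using q e card_field by unfold_locales auto
  have "has_maximal_spread_of_size (int (card tits_nucleus) + 1)"
    by (rule maximal_spread_from_d6[OF tits_nucleus_clique tits_nucleus_maximal])
  then show ?thesis by (simp add: card_tits_nucleus card_field)
qed

lemma maximal_spread_tits_derived:
  assumes q: "q = 2 ^ (2 * e + 1)" and e: "e \<ge> 1" and s: "1 \<le> s" "s + 1 \<le> 2 ^ e"
  shows "has_maximal_spread_of_size (int q ^ 2 - int s * int q + 2 * int s - 1)"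
proof -
  interpret tits_field "TYPE('k)" e using q e card_field by unfold_locales auto
  have "s - 1 \<le> card (UNIV :: 'k set)" using s tau_bound by (simp add: tau_def)
  \<comment> \<open>Only \<open>s - 1\<close> parameters are needed, because the section
    \<open>x = 0\<close> of the base point is the remaining one.\<close>
  then obtain M :: "'k set" where M: "card M = s - 1" by (metis obtain_subset_with_card_n)
  then have M2: "card M + 2 \<le> tau" using s by (simp add: tau_def)
  have "has_maximal_spread_of_size (int (card (tits_derived M)) + 1)"
    by (rule maximal_spread_from_b8[OF tits_derived_singular tits_derived_clique tits_derived_maximal[OF M2]])
  moreover have "int (card (tits_derived M)) = (int q - 1) * (int q - (int s - 1)) + (int s - 1)"
  proof -
    have "s - 1 \<le> q" "1 \<le> q" using M2 M tau_bound card_field by simp_all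
    then show ?thesis unfolding card_tits_derived M card_field using s(1) by (simp add: of_nat_diff)
  qed
  ultimately show ?thesis by (simp add: algebra_simps power2_eq_square)
qed

end

subsection \<open>The theorem\<close>

theorem theorem7p15:
  fixes scale :: "'k::field \<Rightarrow> 'v::ab_group_add \<Rightarrow> 'v"
    and form :: "'v \<Rightarrow> 'v \<Rightarrow> 'k"
    and q :: nat
  assumes "Sp6_space scale form q" and "q > 2" and "even q"
  shows "Sp6_space.has_maximal_spread_of_size scale form (int q ^ 3 - int q ^ 2 + 1) \<and>
     Sp6_space.has_maximal_spread_of_size scale form (int q ^ 2 + 1) \<and>
     Sp6_space.has_maximal_spread_of_size scale form (2 * int q ^ 2 + 1) \<and>
     ((\<exists>e::nat. q = 2 ^ (2 * e + 1)) \<longrightarrow>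
       Sp6_space.has_maximal_spread_of_size scale form (int q ^ 2 + int q + 1)) \<and>
     ((\<exists>e::nat. q = 2 ^ (2 * e + 1)) \<longrightarrow>
       Sp6_space.has_maximal_spread_of_size scale form (int q ^ 2 - int q + 1)) \<and>
     (\<forall>s::nat. (\<exists>e::nat. q = 2 ^ (2 * e + 1)) \<and> 1 \<le> s \<and> real s \<le> sqrt (real q / 2) - 1 \<longrightarrow>
       Sp6_space.has_maximal_spread_of_size scale form (int q ^ 2 - int s * int q + 2 * int s - 1)) \<and>
     (\<forall>r::nat. 1 \<le> r \<and> real r \<le> real q / 5 \<longrightarrow>
       Sp6_space.has_maximal_spread_of_size scale form (int q ^ 3 - int r * int q ^ 2 + (int r - 1) * (int q + 2)
         + int (r choose 2) * (int q - 2) + 1)) \<and>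
     (q \<ge> 16 \<longrightarrow>
       Sp6_space.has_maximal_spread_of_size scale form (int q ^ 3 - 4 * int q ^ 2 + 3 * (int q + 2) + 6 * (int q - 2)))"
proof -
  interpret Sp6_space scale form q by fact
  have "(1::'k) + 1 = 0" using char2_if_even_card card_field \<open>even q\<close> by blast
  then interpret Sp6_char2 scale form q using card_field by unfold_locales auto
  have q4: "q \<ge> 4" using \<open>q > 2\<close> \<open>even q\<close> by (cases "q = 3") auto
  have e_pos: "e \<ge> 1" if "q = 2 ^ (2 * e + 1)" for e
    using that \<open>q > 2\<close> by (cases e) auto
  \<comment> \<open>A single removed section, treated apart because r \<le> q/5 would exclude q = 4;
    there 3q + 3 = 15 is still below q^2 = 16.\<close>
  have i: "has_maximal_spread_of_size (int q ^ 3 - int q ^ 2 + 1)"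
  proof -
    have "1 * (3 * q + 3) < 4 * q" using q4 by simp
    also have "\<dots> \<le> q ^ 2" unfolding power2_eq_square using q4 by (intro mult_right_mono) auto
    finally have "1 * (3 * q + 3) < q ^ 2" .
    from maximal_spread_diagonal[OF order_refl this] show ?thesis by (simp add: numeral_2_eq_2)
  qed
  have iv: "has_maximal_spread_of_size (int q ^ 2 + int q + 1)" if "q = 2 ^ (2 * e + 1)" for e
    using maximal_spread_tits_nucleus[OF that e_pos[OF that]] .
  have v: "has_maximal_spread_of_size (int q ^ 2 - int q + 1)" if "q = 2 ^ (2 * e + 1)" for e
  proof -
    have "(1::nat) + 1 \<le> 2 ^ e" using e_pos[OF that] power_increasing[of 1 e "2::nat"] by simp
    from maximal_spread_tits_derived[OF that e_pos[OF that] order_refl this] show ?thesis by (simp add: add.commute)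
  qed
  have vi: "has_maximal_spread_of_size (int q ^ 2 - int s * int q + 2 * int s - 1)"
    if q: "q = 2 ^ (2 * e + 1)" and s: "1 \<le> s" "real s \<le> sqrt (real q / 2) - 1" for e s
  proof -
    have "q = 2 * (2 ^ e) ^ 2" unfolding q power_add power_even_eq by simp
    then have "real q / 2 = (2 ^ e) ^ 2" by simp
    then have "sqrt (real q / 2) = 2 ^ e" by simp
    then have "real (s + 1) \<le> real (2 ^ e)" using s(2) by simp
    then have "s + 1 \<le> 2 ^ e" by (simp only: of_nat_le_iff)
    then show ?thesis by (rule maximal_spread_tits_derived[OF q e_pos[OF q] s(1)])
  qed
  have vii: "has_maximal_spread_of_size (int q ^ 3 - int r * int q ^ 2 + (int r - 1) * (int q + 2)
      + int (r choose 2) * (int q - 2) + 1)" if r: "1 \<le> r" "real r \<le> real q / 5" for r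
  proof (rule maximal_spread_diagonal[OF r(1)])
    have "5 * r \<le> q" using r(2) by simp
    then have "5 * r * (3 * q + 3) \<le> q * (3 * q + 3)" by (intro mult_right_mono) auto
    moreover have "q * (3 * q + 3) < q * (5 * q)" using q4 by (intro mult_strict_left_mono) auto
    ultimately have "5 * (r * (3 * q + 3)) < 5 * (q * q)" by (simp only: mult.assoc mult.left_commute[of q 5])
    then show "r * (3 * q + 3) < q ^ 2" by (simp only: power2_eq_square mult_less_cancel1)
  qed
  show ?thesis
    using i maximal_spread_quadric maximal_spread_two_quadrics iv v vi vii maximal_spread_four by blast
qed

end
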